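(* Let $1\le p<\infty$ and let $\alpha,\beta\in\mathbb{R}$ with $\min\{\alpha,\beta\}>-1/2$. Let $(p_n^{(\alpha,\beta)})_{n=0}^\infty$ be the Jacobi polynomials of indices $\alpha,\beta$, orthonormal with respect to the measure $d\mu_{\alpha,\beta}(x)=(1-x)^\alpha(1+x)^\beta\chi_{(-1,1)}(x)\,dx$. Then the $L_p(\mu_{\alpha,\beta})$-normalized system $\left(\|p_n^{(\alpha,\beta)}\|_{L_p(\mu_{\alpha,\beta})}^{-1}\,p_n^{(\alpha,\beta)}\right)_{n=0}^\infty$ is a quasi-greedy basis for $L_p(\mu_{\alpha,\beta})$ if and only if $p=2$.
   Context: A biorthogonal system for an infinite-dimensional (real or complex) separable Banach space $\mathbb{X}$ is a family $(\mathbf{x}_j,\mathbf{x}_j^* )_{j\in J}\subset \mathbb{X}\times\mathbb{X}^*$ such that $\mathbb{X}$ is the closed linear span of $\{\mathbf{x}_j\}$ and $\mathbf{x}_j^*(\mathbf{x}_k)=\delta_{jk}$. In this paper $(\mathbf{x}_j)_{j\in J}$ is then called a basis of $\mathbb{X}$ (with orthogonal family $(\mathbf{x}_j^* )_{j\in J}$). The basis is bounded if $\sup_j\|\mathbf{x}_j\|\,\|\mathbf{x}_j^*\|<\infty$, and semi-normalized if $0<\inf_j\|\mathbf{x}_j\|\le\sup_j\|\mathbf{x}_j\|<\infty$. Let $(\mathbf{x}_j)_{j\in J}$ be a semi-normalized bounded basis and fix a bijection $\tau\colon J\to\mathbb{N}$. For $f\in\mathbb{X}$ the greedy ordering is the unique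 one-to-one map $\rho\colon\mathbb{N}\to J$ such that $\{j:\mathbf{x}_j^*(f)\ne0\}\subseteq\rho(\mathbb{N})$, $|\mathbf{x}_{\rho(k)}^*(f)|\ge|\mathbf{x}_{\rho(n)}^*(f)|$ if $k\le n$, ties are broken so that $\tau(\rho(k))\le\tau(\rho(n))$ whenever $k\le n$ and $|\mathbf{x}_{\rho(k)}^*(f)|=|\mathbf{x}_{\rho(n)}^*(f)|$, and, if $f$ has finite support, $\rho(\mathbb{N})=J$. Put $\mathcal{G}_m(f)=\sum_{n=1}^m\mathbf{x}_{\rho(n)}^*(f)\mathbf{x}_{\rho(n)}$. A basis is quasi-greedy if it is a semi-normalized bounded basis and $\lim_{m\to\infty}\mathcal{G}_m(f)=f$ for all $f\in\mathbb{X}$ (the choice of $\tau$ is irrelevant for this property). For the Jacobi polynomials in $L_p(\mu_{\alpha,\beta})$, the orthogonal family of the normalized system consists of the functionals $f\mapsto \|p_n^{(\alpha,\beta)}\|_{L_p(\mu_{\alpha,\beta})}\int f\,p_n^{(\alpha,\beta)}\,d\mu_{\alpha,\beta}$. The polynomial $p_n^{(\alpha,\beta)}$ has degree $n$ and positive leading coefficient, and $\int p_n^{(\alpha,\beta)}p_m^{(\alpha,\beta)}d\mu_{\alpha,\beta}=\delta_{nm}$. *)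

theory Defs
  imports
    "HOL-Analysis.Analysis"
    "HOL-Computational_Algebra.Polynomial"
    "HOL-Library.Function_Algebras"
begin

section \<open>Bases of Banach spaces and the greedy algorithm\<close>

text \<open>
  A Banach space is represented by a subspace X of a vector space (with scalar multiplication
  sc) together with a seminorm nrm on X; the Banach space itself is the quotient of X by the
  vectors of seminorm zero. This allows elements of a Lebesgue space to be functions rather than
  classes of functions. The definitions below are invariant under passing to the quotient:
  convergence and density are expressed with nrm (f - g), and a linear functional that is bounded
  with respect to nrm vanishes on the vectors of seminorm zero. They are meant for X and nrm such
  that the quotient is a Banach space. That it is separable and infinite-dimensional need not be
  required separately, since every biorthogonal system whose index set is in bijection with the
  natural numbers forces it.
\<close>

definition dual_space ::
  "('k::real_normed_field \<Rightarrow> 'v::ab_group_add \<Rightarrow> 'v) \<Rightarrow> 'v set \<Rightarrow> ('v \<Rightarrow> real) \<Rightarrow> ('v \<Rightarrow> 'k) set"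
  where
  "dual_space sc X nrm = {\<phi>.
     (\<forall>f\<in>X. \<forall>g\<in>X. \<phi> (f + g) = \<phi> f + \<phi> g) \<and>
     (\<forall>c. \<forall>f\<in>X. \<phi> (sc c f) = c * \<phi> f) \<and>
     (\<exists>C. \<forall>f\<in>X. norm (\<phi> f) \<le> C * nrm f)}"

definition dual_norm :: "'v set \<Rightarrow> ('v \<Rightarrow> real) \<Rightarrow> ('v \<Rightarrow> 'k::real_normed_field) \<Rightarrow> real"
  where
  "dual_norm X nrm \<phi> = (SUP f\<in>{f \<in> X. nrm f \<le> 1}. norm (\<phi> f))"

definition closed_span ::
  "('k::real_normed_field \<Rightarrow> 'v::ab_group_add \<Rightarrow> 'v) \<Rightarrow> 'v set \<Rightarrow> ('v \<Rightarrow> real) \<Rightarrow> 'v set \<Rightarrow> 'v set"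
  where
  "closed_span sc X nrm S = {f \<in> X. \<forall>\<epsilon>>0. \<exists>g \<in> module.span sc S. nrm (f - g) < \<epsilon>}"

text \<open>The first family x is the basis, the second family xs its orthogonal family.\<close>

definition is_basis ::
  "('k::real_normed_field \<Rightarrow> 'v::ab_group_add \<Rightarrow> 'v) \<Rightarrow> 'v set \<Rightarrow> ('v \<Rightarrow> real)
    \<Rightarrow> ('j \<Rightarrow> 'v) \<Rightarrow> ('j \<Rightarrow> 'v \<Rightarrow> 'k) \<Rightarrow> bool"
  where
  "is_basis sc X nrm x xs \<longleftrightarrow>
     (\<forall>j. x j \<in> X) \<and>
     (\<forall>j. xs j \<in> dual_space sc X nrm) \<and>
     closed_span sc X nrm (range x) = X \<and>
     (\<forall>j k. xs j (x k) = (if j = k then 1 else 0))"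

definition bounded_basis ::
  "('k::real_normed_field \<Rightarrow> 'v::ab_group_add \<Rightarrow> 'v) \<Rightarrow> 'v set \<Rightarrow> ('v \<Rightarrow> real)
    \<Rightarrow> ('j \<Rightarrow> 'v) \<Rightarrow> ('j \<Rightarrow> 'v \<Rightarrow> 'k) \<Rightarrow> bool"
  where
  "bounded_basis sc X nrm x xs \<longleftrightarrow>
     is_basis sc X nrm x xs \<and>
     bdd_above (range (\<lambda>j. nrm (x j) * dual_norm X nrm (xs j)))"

definition semi_normalized :: "('v \<Rightarrow> real) \<Rightarrow> ('j \<Rightarrow> 'v) \<Rightarrow> bool"
  where
  "semi_normalized nrm x \<longleftrightarrow> 0 < (INF j. nrm (x j)) \<and> bdd_above (range (\<lambda>j. nrm (x j)))"

text \<open>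
  The greedy ordering of f only depends on the coefficients a j = xs j f. Positions are counted
  from 0, so the m-th greedy sum runs over the positions n < m.
\<close>

definition is_greedy_ordering ::
  "('j \<Rightarrow> nat) \<Rightarrow> ('j \<Rightarrow> 'k::real_normed_field) \<Rightarrow> (nat \<Rightarrow> 'j) \<Rightarrow> bool"
  where
  "is_greedy_ordering \<tau> a \<rho> \<longleftrightarrow>
     inj \<rho> \<and>
     {j. a j \<noteq> 0} \<subseteq> range \<rho> \<and>
     (\<forall>k n. k \<le> n \<longrightarrow> norm (a (\<rho> k)) \<ge> norm (a (\<rho> n))) \<and>
     (\<forall>k n. k \<le> n \<and> norm (a (\<rho> k)) = norm (a (\<rho> n)) \<longrightarrow> \<tau> (\<rho> k) \<le> \<tau> (\<rho> n)) \<and>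
     (finite {j. a j \<noteq> 0} \<longrightarrow> range \<rho> = UNIV)"

definition greedy_ordering ::
  "('j \<Rightarrow> nat) \<Rightarrow> ('j \<Rightarrow> 'k::real_normed_field) \<Rightarrow> nat \<Rightarrow> 'j"
  where
  "greedy_ordering \<tau> a = (THE \<rho>. is_greedy_ordering \<tau> a \<rho>)"

definition greedy_sum ::
  "('k::real_normed_field \<Rightarrow> 'v::ab_group_add \<Rightarrow> 'v) \<Rightarrow> ('j \<Rightarrow> nat)
    \<Rightarrow> ('j \<Rightarrow> 'v) \<Rightarrow> ('j \<Rightarrow> 'v \<Rightarrow> 'k) \<Rightarrow> nat \<Rightarrow> 'v \<Rightarrow> 'v"
  where
  "greedy_sum sc \<tau> x xs m f =
     (let \<rho> = greedy_ordering \<tau> (\<lambda>j. xs j f) in \<Sum>n<m. sc (xs (\<rho> n) f) (x (\<rho> n)))"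

definition quasi_greedy_basis ::
  "('k::real_normed_field \<Rightarrow> 'v::ab_group_add \<Rightarrow> 'v) \<Rightarrow> 'v set \<Rightarrow> ('v \<Rightarrow> real)
    \<Rightarrow> ('j \<Rightarrow> nat) \<Rightarrow> ('j \<Rightarrow> 'v) \<Rightarrow> ('j \<Rightarrow> 'v \<Rightarrow> 'k) \<Rightarrow> bool"
  where
  "quasi_greedy_basis sc X nrm \<tau> x xs \<longleftrightarrow>
     semi_normalized nrm x \<and>
     bounded_basis sc X nrm x xs \<and>
     (\<forall>f\<in>X. (\<lambda>m. nrm (greedy_sum sc \<tau> x xs m f - f)) \<longlonglongrightarrow> 0)"

section \<open>Lebesgue spaces of scalar functions\<close>

definition fun_scale :: "'k::field \<Rightarrow> ('a \<Rightarrow> 'k) \<Rightarrow> 'a \<Rightarrow> 'k"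
  where
  "fun_scale c f = (\<lambda>t. c * f t)"

lemma vector_space_fun_scale: "vector_space fun_scale"
  by unfold_locales (auto simp: fun_scale_def fun_eq_iff algebra_simps)

definition Lp_space :: "real \<Rightarrow> 'a measure \<Rightarrow> ('a \<Rightarrow> 'k::real_normed_field) set"
  where
  "Lp_space p M = {f \<in> borel_measurable M. integrable M (\<lambda>t. norm (f t) powr p)}"

definition Lp_norm :: "real \<Rightarrow> 'a measure \<Rightarrow> ('a \<Rightarrow> 'k::real_normed_field) \<Rightarrow> real"
  where
  "Lp_norm p M f = (\<integral>t. norm (f t) powr p \<partial>M) powr (1 / p)"

section \<open>Jacobi polynomials\<close>

definition jacobi_measure :: "real \<Rightarrow> real \<Rightarrow> real measure"
  where
  "jacobi_measure \<alpha> \<beta> =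
     density lborel (\<lambda>x. ennreal ((1 - x) powr \<alpha> * (1 + x) powr \<beta> * indicator {-1<..<1} x))"

text \<open>For indices greater than -1 these conditions determine the sequence P uniquely.\<close>

definition orthonormal_jacobi :: "real \<Rightarrow> real \<Rightarrow> (nat \<Rightarrow> real poly) \<Rightarrow> bool"
  where
  "orthonormal_jacobi \<alpha> \<beta> P \<longleftrightarrow>
     (\<forall>n. degree (P n) = n \<and> lead_coeff (P n) > 0) \<and>
     (\<forall>n m. (\<integral>x. poly (P n) x * poly (P m) x \<partial>jacobi_measure \<alpha> \<beta>) = (if n = m then 1 else 0))"

definition jacobi_system ::
  "real \<Rightarrow> real measure \<Rightarrow> (nat \<Rightarrow> real poly) \<Rightarrow> nat \<Rightarrow> real \<Rightarrow> 'k::real_normed_field"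
  where
  "jacobi_system p M P n =
     fun_scale (of_real (inverse (Lp_norm p M (poly (P n))))) (\<lambda>t. of_real (poly (P n) t))"

definition jacobi_functionals ::
  "real \<Rightarrow> real measure \<Rightarrow> (nat \<Rightarrow> real poly) \<Rightarrow> nat
    \<Rightarrow> (real \<Rightarrow> 'k) \<Rightarrow> 'k::{real_normed_field, banach, second_countable_topology}"
  where
  "jacobi_functionals p M P n f =
     of_real (Lp_norm p M (poly (P n))) * (\<integral>t. f t * of_real (poly (P n) t) \<partial>M)"

end

theory Submission
  imports Defs "HOL-Real_Asymp.Real_Asymp"
begin

text \<open>
  For p = 2 the system is an orthonormal basis of a Hilbert space: the polynomials are dense, and by
  the Pythagorean identity the expansion of a function converges to it along every exhaustion of its
  support, in particular along the greedy one (\<^const>\<open>greedy_sum\<close>).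

  For p different from 2, suppose that the system is quasi-greedy. A gliding hump argument then shows
  that thresholding of coefficients is uniformly bounded (large_projection_bounded), and from this
  follows the estimate that drives the proof, sign_combination_bounded: if the coefficients of a
  vector g at the indices of a finite set A have modulus at least t, then t times the norm of
  any signed sum of the basis vectors over A is at most C times the norm of g. By the Khintchine
  inequalities, some signed sum of n normalized functions has norm at most C n^(1/2) in L_p if
  p \<ge> 2, and some has norm at least c n^(1/2) if p \<le> 2. So it suffices to find a
  signed sum that is much larger, or a g that is much smaller, than n^(1/2) suggests.

  Both come from the concentration of Jacobi polynomials at one endpoint (jacobi_concentration). Let
  A consist of the n degrees from n to 2n - 1 and let M_k be the maximum of |p_k| on [-1, 1]. There is
  a set E, an interval of length about n^(-2) at the endpoint, on which each p_k with k in A keeps one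
  sign and is at least M_k / 2 in modulus, and the measure w of E satisfies M_k^2 w \<ge> c / n.
  Since the functions p_k have norm 1 in L_2, their norms in L_p compare with M_k^(1 - 2/p), from
  above if p > 2 and from below if p < 2.
  \<^item> If p > 2, choose the signs so that all terms of the sum of p_k / ||p_k||_p are positive
    on E. The sum is then at least a multiple of n M_k^(2/p) on E, so its norm is at least a multiple
    of n (M_k^2 w)^(1/p), that is, of n^(1 - 1/p), which exceeds n^(1/2).
  \<^item> If p < 2, take for g the indicator of E. Its coefficients are at least a multiple of
    ||p_k||_p M_k w, so the estimate yields n^(1/2) (M_k^2 w)^(1 - 1/p) \<le> C, that is,
    n^(1/p - 1/2) \<le> C, which fails for large n.

  The concentration rests on two facts. The Sonin function of the Jacobi differential equation is
  monotone on each side of one interior point, since \<alpha> and \<beta> exceed -1/2. So |p_k| attains its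
  maximum at an endpoint, and the derivative of p_k is controlled near it (jacobi_sonin_bound).
  Secondly, the values at the endpoints are known exactly (jacobi_at_one), because derivatives of
  Jacobi polynomials are Jacobi polynomials for the indices \<alpha> + 1 and \<beta> + 1.
\<close>

section \<open>Greedy orderings\<close>

lemma finite_large_values:
  assumes "(a :: nat \<Rightarrow> 'k::real_normed_field) \<longlonglongrightarrow> 0" "0 < t"
  shows "finite {j. t \<le> norm (a j)}"
proof -
  have "eventually (\<lambda>j. norm (a j) < t) sequentially"
    using order_tendstoD(2)[OF tendsto_norm_zero[OF assms(1)] assms(2)] .
  then obtain N where "\<And>j. j \<ge> N \<Longrightarrow> norm (a j) < t" unfolding eventually_sequentially by auto
  then have "{j. t \<le> norm (a j)} \<subseteq> {..<N}" by (auto simp: not_less[symmetric])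
  then show ?thesis by (rule finite_subset) simp
qed

text \<open>
  The greedy ordering enumerates indices by decreasing modulus of the coefficient, ties being broken
  by \<tau>. For a null sequence of coefficients, every index that has to be enumerated has only
  finitely many predecessors, so counting them gives its position.
\<close>

context
  fixes \<tau> :: "nat \<Rightarrow> nat" and a :: "nat \<Rightarrow> 'k::real_normed_field"
  assumes bij: "bij \<tau>" and null: "a \<longlonglongrightarrow> 0"
begin

definition precedes :: "nat \<Rightarrow> nat \<Rightarrow> bool" where
  "precedes i j \<longleftrightarrow> norm (a j) < norm (a i) \<or> norm (a i) = norm (a j) \<and> \<tau> i < \<tau> j"

text \<open>
  An infinite support is exhausted before any index with coefficient zero can be reached; if the
  support is finite, all indices follow.
\<close>

definition greedy_range :: "nat set" where
  "greedy_range = (if finite {j. a j \<noteq> 0} then UNIV else {j. a j \<noteq> 0})"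

definition greedy_rank :: "nat \<Rightarrow> nat" where
  "greedy_rank j = card {i \<in> greedy_range. precedes i j}"

lemma precedes_trans: "precedes i j \<Longrightarrow> precedes j k \<Longrightarrow> precedes i k"
  by (auto simp: precedes_def)

lemma precedes_irrefl: "\<not> precedes i i"
  by (auto simp: precedes_def)

lemma precedes_total: "i \<noteq> j \<Longrightarrow> precedes i j \<or> precedes j i"
  using injD[OF bij_is_inj[OF bij], of i j] unfolding precedes_def by (smt (verit) linorder_neqE_nat)

lemma finite_predecessors:
  assumes "j \<in> greedy_range"
  shows "finite {i \<in> greedy_range. precedes i j}"
proof (cases "a j = 0")
  case False
  have "{i \<in> greedy_range. precedes i j} \<subseteq> {i. norm (a j) \<le> norm (a i)}" by (auto simp: precedes_def)
  then show ?thesis using finite_large_values[OF null, of "norm (a j)"] False finite_subset by auto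
next
  case True
  then have "finite {i. a i \<noteq> 0}" using assms by (auto simp: greedy_range_def split: if_splits)
  moreover have "finite {i. \<tau> i < \<tau> j}"
    using finite_vimageI[OF finite_lessThan[of "\<tau> j"] bij_is_inj[OF bij]] by (simp add: vimage_def)
  moreover have "{i \<in> greedy_range. precedes i j} \<subseteq> {i. a i \<noteq> 0} \<union> {i. \<tau> i < \<tau> j}"
    using True by (auto simp: precedes_def)
  ultimately show ?thesis by (meson finite_UnI finite_subset)
qed

lemma greedy_rank_less:
  assumes "i \<in> greedy_range" "j \<in> greedy_range" "precedes i j"
  shows "greedy_rank i < greedy_rank j"
  unfolding greedy_rank_def
proof (rule psubset_card_mono[OF finite_predecessors[OF assms(2)]])
  have "{k \<in> greedy_range. precedes k i} \<subseteq> {k \<in> greedy_range. precedes k j}"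
    using precedes_trans assms by blast
  moreover have "i \<in> {k \<in> greedy_range. precedes k j} - {k \<in> greedy_range. precedes k i}"
    using assms precedes_irrefl by blast
  ultimately show "{k \<in> greedy_range. precedes k i} \<subset> {k \<in> greedy_range. precedes k j}" by blast
qed

lemma inj_on_greedy_rank: "inj_on greedy_rank greedy_range"
  by (rule inj_onI) (metis greedy_rank_less less_irrefl precedes_total)

text \<open>
  The ranks are unbounded, being distinct on an infinite set, and closed under predecessors: the
  predecessor of j with the largest rank has exactly one predecessor less than j.
\<close>

lemma greedy_rank_surj: "\<exists>j\<in>greedy_range. greedy_rank j = n"
proof -
  have down: "\<exists>i\<in>greedy_range. greedy_rank i = m" if "j \<in> greedy_range" "greedy_rank j = Suc m" for j m
  proof -
    define S where "S = {i \<in> greedy_range. precedes i j}"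
    have fin: "finite S" unfolding S_def by (rule finite_predecessors[OF that(1)])
    have card: "card S = Suc m" using that by (simp add: greedy_rank_def S_def)
    then have "S \<noteq> {}" by auto
    then have "Max (greedy_rank ` S) \<in> greedy_rank ` S" using fin by (intro Max_in) auto
    then obtain i where "i \<in> S" "greedy_rank i = Max (greedy_rank ` S)" by auto
    then have i: "i \<in> S" "\<And>k. k \<in> S \<Longrightarrow> greedy_rank k \<le> greedy_rank i" using fin by auto
    have "{k \<in> greedy_range. precedes k i} = S - {i}"
    proof (intro equalityI subsetI)
      fix k assume "k \<in> {k \<in> greedy_range. precedes k i}"
      then show "k \<in> S - {i}" using i(1) precedes_trans precedes_irrefl by (auto simp: S_def)
    next
      fix k assume k: "k \<in> S - {i}"
      then have "\<not> precedes i k" using i(2)[of k] greedy_rank_less[of i k] i(1) by (auto simp: S_def)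
      then show "k \<in> {k \<in> greedy_range. precedes k i}" using k precedes_total[of i k] by (auto simp: S_def)
    qed
    then have "greedy_rank i = m" using card i(1) fin by (simp add: greedy_rank_def)
    then show ?thesis using i(1) by (auto simp: S_def)
  qed
  have "infinite greedy_range" by (auto simp: greedy_range_def)
  then have "infinite (greedy_rank ` greedy_range)" using inj_on_greedy_rank finite_imageD by blast
  then obtain m where m: "m > n" "m \<in> greedy_rank ` greedy_range"
    using infinite_nat_iff_unbounded by blast
  have "\<exists>j\<in>greedy_range. greedy_rank j = m - d" if "d \<le> m" for d
    using that
  proof (induction d)
    case (Suc d)
    then obtain j where "j \<in> greedy_range" "greedy_rank j = m - d" by auto
    then show ?case using down[of j "m - Suc d"] Suc.prems by (simp add: Suc_diff_Suc)
  qed (use m in auto)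
  from this[of "m - n"] m show ?thesis by simp
qed

text \<open>
  If a greedy ordering reached an index with coefficient zero, all later ones would be zero as well and
  the support would be finite.
\<close>

lemma is_greedy_ordering_monotone:
  assumes "is_greedy_ordering \<tau> a \<rho>"
  shows "range \<rho> = greedy_range" and "k < n \<Longrightarrow> precedes (\<rho> k) (\<rho> n)"
proof -
  have inj: "inj \<rho>" and supp: "{j. a j \<noteq> 0} \<subseteq> range \<rho>"
    and mono: "\<And>k n. k \<le> n \<Longrightarrow> norm (a (\<rho> n)) \<le> norm (a (\<rho> k))"
    and tie: "\<And>k n. k \<le> n \<Longrightarrow> norm (a (\<rho> k)) = norm (a (\<rho> n)) \<Longrightarrow> \<tau> (\<rho> k) \<le> \<tau> (\<rho> n)"
    and fin: "finite {j. a j \<noteq> 0} \<Longrightarrow> range \<rho> = UNIV"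
    using assms unfolding is_greedy_ordering_def by auto
  show "precedes (\<rho> k) (\<rho> n)" if "k < n"
  proof -
    have "\<rho> k \<noteq> \<rho> n" using inj that by (metis injD less_irrefl)
    then have "\<tau> (\<rho> k) \<noteq> \<tau> (\<rho> n)" using injD[OF bij_is_inj[OF bij]] by blast
    then show ?thesis using mono[of k n] tie[of k n] that by (auto simp: precedes_def order_less_le)
  qed
  show "range \<rho> = greedy_range"
  proof (cases "finite {j. a j \<noteq> 0}")
    case False
    have "a (\<rho> k) \<noteq> 0" for k
    proof
      assume z: "a (\<rho> k) = 0"
      have "{j. a j \<noteq> 0} \<subseteq> \<rho> ` {..<k}"
      proof
        fix j assume j: "j \<in> {j. a j \<noteq> 0}"
        then obtain n where n: "j = \<rho> n" using supp by auto
        have "\<not> k \<le> n" using mono[of k n] z j n by auto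
        then show "j \<in> \<rho> ` {..<k}" using n by auto
      qed
      then show False using False finite_subset by blast
    qed
    then show ?thesis using False supp by (auto simp: greedy_range_def)
  qed (use fin in \<open>simp add: greedy_range_def\<close>)
qed

lemma is_greedy_ordering_rank:
  assumes "is_greedy_ordering \<tau> a \<rho>"
  shows "greedy_rank (\<rho> n) = n"
proof -
  note r = is_greedy_ordering_monotone[OF assms]
  have inj: "inj \<rho>" using assms unfolding is_greedy_ordering_def by auto
  have "{i \<in> greedy_range. precedes i (\<rho> n)} = \<rho> ` {..<n}"
  proof (intro equalityI subsetI)
    fix i assume i: "i \<in> {i \<in> greedy_range. precedes i (\<rho> n)}"
    then obtain k where k: "i = \<rho> k" using r(1) by blast
    have "k < n" using i r(2)[of n k] precedes_trans precedes_irrefl unfolding k by (metis linorder_neqE_nat mem_Collect_eq)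
    then show "i \<in> \<rho> ` {..<n}" using k by auto
  qed (use r in auto)
  then show ?thesis unfolding greedy_rank_def using inj by (simp add: card_image inj_on_subset)
qed

text \<open>
  Position and rank agree for every greedy ordering, so the inverse of the rank is the only one and the
  definite description in \<^const>\<open>greedy_ordering\<close> denotes it.
\<close>

lemma greedy_ordering_is_greedy: "is_greedy_ordering \<tau> a (greedy_ordering \<tau> a)"
proof -
  define \<rho> where "\<rho> = inv_into greedy_range greedy_rank"
  have img: "greedy_rank ` greedy_range = UNIV" using greedy_rank_surj by (metis UNIV_eq_I image_eqI)
  have rin: "\<rho> n \<in> greedy_range" and rr: "greedy_rank (\<rho> n) = n" for n
    unfolding \<rho>_def using img by (auto intro!: inv_into_into f_inv_into_f)
  have rinv: "\<rho> (greedy_rank j) = j" if "j \<in> greedy_range" for j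
    unfolding \<rho>_def using inj_on_greedy_rank that by simp
  have range: "range \<rho> = greedy_range" using rin rinv by (metis UNIV_I equalityI image_subset_iff rangeI subsetI)
  have inj: "inj \<rho>" using rr by (metis injI)
  have pre: "precedes (\<rho> k) (\<rho> n)" if "k < n" for k n
  proof -
    have "\<not> precedes (\<rho> n) (\<rho> k)" using greedy_rank_less[OF rin rin, of n k] that by (auto simp: rr)
    moreover have "\<rho> k \<noteq> \<rho> n" using rr that by (metis less_irrefl)
    ultimately show ?thesis using precedes_total by blast
  qed
  have "is_greedy_ordering \<tau> a \<rho>"
    unfolding is_greedy_ordering_def
  proof (intro conjI allI impI)
    show "{j. a j \<noteq> 0} \<subseteq> range \<rho>" unfolding range by (auto simp: greedy_range_def)
    show "norm (a (\<rho> n)) \<le> norm (a (\<rho> k))" if "k \<le> n" for k n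
      using pre[of k n] that by (cases "k = n") (auto simp: precedes_def)
    show "\<tau> (\<rho> k) \<le> \<tau> (\<rho> n)" if "k \<le> n \<and> norm (a (\<rho> k)) = norm (a (\<rho> n))" for k n
      using pre[of k n] that by (cases "k = n") (auto simp: precedes_def)
  qed (use inj range in \<open>auto simp: greedy_range_def\<close>)
  moreover have "\<rho>' = \<rho>" if "is_greedy_ordering \<tau> a \<rho>'" for \<rho>'
  proof
    fix n
    have "\<rho>' n \<in> greedy_range" using is_greedy_ordering_monotone(1)[OF that] by blast
    then show "\<rho>' n = \<rho> n" using is_greedy_ordering_rank[OF that, of n] rinv by metis
  qed
  ultimately show ?thesis unfolding greedy_ordering_def by (rule theI)
qed

end

section \<open>Complete seminormed spaces\<close>

text \<open>
  The Lebesgue spaces appear as spaces of functions, on which the norm of the quotient Banach space is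
  a seminorm.
\<close>

locale seminormed_space =
  fixes sc :: "'k::real_normed_field \<Rightarrow> 'v::ab_group_add \<Rightarrow> 'v" and X :: "'v set" and nrm :: "'v \<Rightarrow> real"
  assumes vector_space: "vector_space sc"
    and zero_mem: "0 \<in> X"
    and add_mem: "f \<in> X \<Longrightarrow> g \<in> X \<Longrightarrow> f + g \<in> X"
    and scale_mem: "f \<in> X \<Longrightarrow> sc c f \<in> X"
    and nrm_add: "f \<in> X \<Longrightarrow> g \<in> X \<Longrightarrow> nrm (f + g) \<le> nrm f + nrm g"
    and nrm_scale: "f \<in> X \<Longrightarrow> nrm (sc c f) = norm c * nrm f"
begin

sublocale vector_space sc by (rule vector_space)

lemma nrm_zero [simp]: "nrm 0 = 0"
  using nrm_scale[OF zero_mem, of 0] by simp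

lemma minus_mem: "f \<in> X \<Longrightarrow> - f \<in> X"
  using scale_mem[of f "-1"] by simp

lemma diff_mem: "f \<in> X \<Longrightarrow> g \<in> X \<Longrightarrow> f - g \<in> X"
  using add_mem[of f "-g"] minus_mem by simp

lemma nrm_minus: "f \<in> X \<Longrightarrow> nrm (- f) = nrm f"
  using nrm_scale[of f "-1"] by simp

lemma nrm_nonneg: "f \<in> X \<Longrightarrow> 0 \<le> nrm f"
  using nrm_add[of f "- f"] by (simp add: minus_mem nrm_minus)

lemma nrm_diff: "f \<in> X \<Longrightarrow> g \<in> X \<Longrightarrow> nrm (f - g) \<le> nrm f + nrm g"
  using nrm_add[of f "-g"] by (simp add: minus_mem nrm_minus)

lemma nrm_triangle: "f \<in> X \<Longrightarrow> g \<in> X \<Longrightarrow> nrm f \<le> nrm g + nrm (f - g)"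
  using nrm_add[of g "f - g"] by (simp add: diff_mem)

lemma nrm_diff_commute: "f \<in> X \<Longrightarrow> g \<in> X \<Longrightarrow> nrm (f - g) = nrm (g - f)"
  using nrm_minus[of "f - g"] by (simp add: diff_mem)

lemma sum_mem: "(\<And>i. i \<in> I \<Longrightarrow> f i \<in> X) \<Longrightarrow> (\<Sum>i\<in>I. f i) \<in> X"
  by (induction I rule: infinite_finite_induct) (auto simp: zero_mem add_mem)

lemma nrm_sum: "(\<And>i. i \<in> I \<Longrightarrow> f i \<in> X) \<Longrightarrow> nrm (\<Sum>i\<in>I. f i) \<le> (\<Sum>i\<in>I. nrm (f i))"
proof (induction I rule: infinite_finite_induct)
  case (insert i I)
  then have "nrm (f i + (\<Sum>i\<in>I. f i)) \<le> nrm (f i) + nrm (\<Sum>i\<in>I. f i)" by (intro nrm_add sum_mem) auto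
  with insert show ?case by auto
qed auto

lemma dual_add: "\<phi> \<in> dual_space sc X nrm \<Longrightarrow> f \<in> X \<Longrightarrow> g \<in> X \<Longrightarrow> \<phi> (f + g) = \<phi> f + \<phi> g"
  and dual_scale: "\<phi> \<in> dual_space sc X nrm \<Longrightarrow> f \<in> X \<Longrightarrow> \<phi> (sc c f) = c * \<phi> f"
  by (auto simp: dual_space_def)

lemma dual_zero: "\<phi> \<in> dual_space sc X nrm \<Longrightarrow> \<phi> 0 = 0"
  using dual_scale[OF _ zero_mem, of \<phi> 0] by simp

lemma dual_diff: "\<phi> \<in> dual_space sc X nrm \<Longrightarrow> f \<in> X \<Longrightarrow> g \<in> X \<Longrightarrow> \<phi> (f - g) = \<phi> f - \<phi> g"
  using dual_add[of \<phi> f "- g"] dual_scale[of \<phi> g "-1"] by (simp add: minus_mem)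

lemma dual_sum:
  "\<phi> \<in> dual_space sc X nrm \<Longrightarrow> (\<And>i. i \<in> I \<Longrightarrow> f i \<in> X) \<Longrightarrow> \<phi> (\<Sum>i\<in>I. f i) = (\<Sum>i\<in>I. \<phi> (f i))"
  by (induction I rule: infinite_finite_induct) (auto simp: dual_zero dual_add sum_mem)

text \<open>
  Vectors of seminorm zero cannot be rescaled to the unit ball; on these the functional vanishes
  because it is bounded.
\<close>

lemma dual_norm_bound:
  assumes "\<phi> \<in> dual_space sc X nrm" "f \<in> X"
  shows "norm (\<phi> f) \<le> dual_norm X nrm \<phi> * nrm f"
proof -
  obtain C where C: "\<And>f. f \<in> X \<Longrightarrow> norm (\<phi> f) \<le> C * nrm f"
    using assms unfolding dual_space_def by blast
  show ?thesis
  proof (cases "nrm f = 0")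
    case True
    then show ?thesis using C[OF assms(2)] by simp
  next
    case False
    then have pos: "nrm f > 0" using nrm_nonneg[OF assms(2)] by simp
    define g where "g = sc (of_real (1 / nrm f)) f"
    have g: "g \<in> X" "nrm g \<le> 1" using assms(2) pos by (auto simp: g_def scale_mem nrm_scale norm_divide)
    have "bdd_above ((\<lambda>f. norm (\<phi> f)) ` {f \<in> X. nrm f \<le> 1})"
    proof (rule bdd_aboveI2)
      fix h assume "h \<in> {f \<in> X. nrm f \<le> 1}"
      then have "norm (\<phi> h) \<le> C * nrm h" "0 \<le> nrm h" "nrm h \<le> 1" using C nrm_nonneg by auto
      then show "norm (\<phi> h) \<le> \<bar>C\<bar>" by (smt (verit) mult_left_le mult_right_mono)
    qed
    then have "norm (\<phi> g) \<le> dual_norm X nrm \<phi>"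
      unfolding dual_norm_def using g by (intro cSUP_upper) auto
    moreover have "norm (\<phi> g) = norm (\<phi> f) / nrm f"
      unfolding g_def using assms pos by (simp add: dual_scale norm_mult norm_divide)
    ultimately show ?thesis using pos by (simp add: field_simps)
  qed
qed

lemma span_mem: "S \<subseteq> X \<Longrightarrow> g \<in> span S \<Longrightarrow> g \<in> X"
  unfolding span_explicit by (auto intro!: sum_mem scale_mem)

lemma closed_span_add:
  assumes S: "S \<subseteq> X" and f: "f \<in> closed_span sc X nrm S" and g: "g \<in> closed_span sc X nrm S"
  shows "f + g \<in> closed_span sc X nrm S"
  unfolding closed_span_def
proof (intro CollectI conjI allI impI)
  have fX: "f \<in> X" "g \<in> X" using f g by (auto simp: closed_span_def)
  then show "f + g \<in> X" by (rule add_mem)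
  fix \<epsilon> :: real assume "0 < \<epsilon>"
  then have e2: "0 < \<epsilon> / 2" by simp
  obtain u where u: "u \<in> span S" "nrm (f - u) < \<epsilon> / 2" using f e2 unfolding closed_span_def by blast
  obtain v where v: "v \<in> span S" "nrm (g - v) < \<epsilon> / 2" using g e2 unfolding closed_span_def by blast
  have eq: "f + g - (u + v) = (f - u) + (g - v)" by simp
  have "nrm (f + g - (u + v)) \<le> nrm (f - u) + nrm (g - v)"
    unfolding eq using nrm_add[of "f - u" "g - v"] fX span_mem[OF S] u v by (simp add: diff_mem)
  then show "\<exists>w\<in>span S. nrm (f + g - w) < \<epsilon>" using u v span_add by (intro bexI[of _ "u + v"]) auto
qed

lemma closed_span_scale:
  assumes S: "S \<subseteq> X" and f: "f \<in> closed_span sc X nrm S"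
  shows "sc c f \<in> closed_span sc X nrm S"
  unfolding closed_span_def
proof (intro CollectI conjI allI impI)
  have fX: "f \<in> X" using f by (auto simp: closed_span_def)
  then show "sc c f \<in> X" by (rule scale_mem)
  fix \<epsilon> :: real assume e: "0 < \<epsilon>"
  have c1: "0 < norm c + 1" by (simp add: add_nonneg_pos)
  then have "0 < \<epsilon> / (norm c + 1)" using e by simp
  then obtain u where u: "u \<in> span S" "nrm (f - u) < \<epsilon> / (norm c + 1)"
    using f unfolding closed_span_def by blast
  have d: "f - u \<in> X" using fX span_mem[OF S u(1)] by (rule diff_mem)
  have "nrm (sc c f - sc c u) = norm c * nrm (f - u)" using nrm_scale[OF d] by (simp add: scale_right_diff_distrib)
  also have "\<dots> \<le> (norm c + 1) * nrm (f - u)" using nrm_nonneg[OF d] by (intro mult_right_mono) auto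
  also have "\<dots> < \<epsilon>" using u(2) c1 by (simp add: field_simps)
  finally show "\<exists>w\<in>span S. nrm (sc c f - w) < \<epsilon>" using u span_scale by (intro bexI[of _ "sc c u"]) auto
qed

lemma closed_span_limit:
  assumes S: "S \<subseteq> X" and f: "f \<in> X" and g: "\<And>i. g i \<in> closed_span sc X nrm S" and lim: "(\<lambda>i::nat. nrm (f - g i)) \<longlonglongrightarrow> 0"
  shows "f \<in> closed_span sc X nrm S"
  unfolding closed_span_def
proof (intro CollectI conjI allI impI f)
  fix \<epsilon> :: real assume e: "0 < \<epsilon>"
  then have "eventually (\<lambda>i. nrm (f - g i) < \<epsilon> / 2) sequentially" using lim by (intro order_tendstoD(2)[OF lim]) auto
  then obtain i where i: "nrm (f - g i) < \<epsilon> / 2" unfolding eventually_sequentially by blast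
  have e2: "0 < \<epsilon> / 2" using e by simp
  obtain u where u: "u \<in> span S" "nrm (g i - u) < \<epsilon> / 2"
    using g[of i] e2 unfolding closed_span_def by blast
  have gX: "g i \<in> X" using g[of i] by (auto simp: closed_span_def)
  have "f - u = (f - g i) + (g i - u)" by simp
  then have "nrm (f - u) \<le> nrm (f - g i) + nrm (g i - u)"
    using nrm_add[of "f - g i" "g i - u"] f gX span_mem[OF S u(1)] by (simp add: diff_mem)
  then show "\<exists>w\<in>span S. nrm (f - w) < \<epsilon>" using i u by (intro bexI[of _ u]) auto
qed

lemma closed_span_superset: "S \<subseteq> X \<Longrightarrow> span S \<subseteq> closed_span sc X nrm S"
proof
  fix g assume S: "S \<subseteq> X" and g: "g \<in> span S"
  have "\<exists>u\<in>span S. nrm (g - u) < \<epsilon>" if "0 < \<epsilon>" for \<epsilon> using that by (intro bexI[OF _ g]) simp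
  then show "g \<in> closed_span sc X nrm S" using span_mem[OF S g] by (simp add: closed_span_def)
qed

lemma closed_span_sum:
  assumes "S \<subseteq> X" "\<And>i. i \<in> I \<Longrightarrow> f i \<in> closed_span sc X nrm S"
  shows "(\<Sum>i\<in>I. f i) \<in> closed_span sc X nrm S"
  using assms(2)
proof (induction I rule: infinite_finite_induct)
  case (insert i I)
  then show ?case by (simp add: closed_span_add[OF assms(1)])
qed (use closed_span_superset[OF assms(1)] span_zero in auto)

end

section \<open>Bounds forced by a quasi-greedy basis\<close>

locale complete_seminormed_space = seminormed_space +
  assumes complete: "(\<And>j::nat. f j \<in> X) \<Longrightarrow> summable (\<lambda>j. nrm (f j)) \<Longrightarrow>
      \<exists>F\<in>X. (\<lambda>n. nrm (F - (\<Sum>j<n. f j))) \<longlonglongrightarrow> 0"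

locale quasi_greedy = complete_seminormed_space sc X nrm
  for sc :: "'k::real_normed_field \<Rightarrow> 'v::ab_group_add \<Rightarrow> 'v" and X nrm +
  fixes \<tau> :: "nat \<Rightarrow> nat" and x :: "nat \<Rightarrow> 'v" and xs :: "nat \<Rightarrow> 'v \<Rightarrow> 'k"
  assumes bij: "bij \<tau>" and quasi_greedy: "quasi_greedy_basis sc X nrm \<tau> x xs"
begin

lemma x_mem: "x j \<in> X" and xs_dual: "xs j \<in> dual_space sc X nrm"
  and biorthogonal: "xs j (x k) = (if j = k then 1 else 0)"
  and dense: "closed_span sc X nrm (range x) = X"
  using quasi_greedy unfolding quasi_greedy_basis_def bounded_basis_def is_basis_def by blast+

text \<open>
  The norms of the basis vectors are bounded away from zero, so boundedness of the basis bounds the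
  norms of the coefficient functionals.
\<close>

lemma ex_coefficient_bound: "\<exists>kappa>0. \<forall>j. \<forall>f\<in>X. norm (xs j f) \<le> kappa * nrm f"
proof -
  obtain B where B: "\<And>j. nrm (x j) * dual_norm X nrm (xs j) \<le> B"
    using quasi_greedy unfolding quasi_greedy_basis_def bounded_basis_def by (auto simp: bdd_above_def)
  define c where "c = (INF j. nrm (x j))"
  have c: "0 < c" using quasi_greedy unfolding quasi_greedy_basis_def semi_normalized_def c_def by auto
  have cx: "c \<le> nrm (x j)" for j
    unfolding c_def by (rule cINF_lower) (auto intro!: bdd_belowI[of _ 0] nrm_nonneg x_mem)
  have "norm (xs j f) \<le> (\<bar>B\<bar> / c + 1) * nrm f" if "f \<in> X" for j f
  proof -
    have "norm (xs j (x j)) \<le> dual_norm X nrm (xs j) * nrm (x j)"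
      by (rule dual_norm_bound[OF xs_dual x_mem])
    then have "0 < dual_norm X nrm (xs j) * nrm (x j)" by (simp add: biorthogonal)
    then have d: "0 < dual_norm X nrm (xs j)" using nrm_nonneg[OF x_mem, of j] zero_less_mult_pos2 by force
    have "dual_norm X nrm (xs j) * c \<le> dual_norm X nrm (xs j) * nrm (x j)"
      using d cx by (intro mult_left_mono) auto
    also have "\<dots> \<le> \<bar>B\<bar>" using B[of j] by (simp add: mult.commute)
    finally have "dual_norm X nrm (xs j) \<le> \<bar>B\<bar> / c" using c by (simp add: field_simps)
    then have "dual_norm X nrm (xs j) * nrm f \<le> (\<bar>B\<bar> / c + 1) * nrm f"
      using nrm_nonneg[OF that] by (intro mult_right_mono) auto
    then show ?thesis using dual_norm_bound[OF xs_dual that, of j] by simp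
  qed
  moreover have "\<bar>B\<bar> / c + 1 > 0" using c by (simp add: add_nonneg_pos)
  ultimately show ?thesis by blast
qed

definition kappa where "kappa = (SOME C. 0 < C \<and> (\<forall>j. \<forall>f\<in>X. norm (xs j f) \<le> C * nrm f))"

lemma kappa_pos: "0 < kappa" and coefficient_bound: "f \<in> X \<Longrightarrow> norm (xs j f) \<le> kappa * nrm f"
proof -
  have "0 < kappa \<and> (\<forall>j. \<forall>f\<in>X. norm (xs j f) \<le> kappa * nrm f)"
    unfolding kappa_def by (rule someI_ex) (use ex_coefficient_bound in blast)
  then show "0 < kappa" "f \<in> X \<Longrightarrow> norm (xs j f) \<le> kappa * nrm f" by auto
qed

lemma ex_basis_bound: "\<exists>B>0. \<forall>j. nrm (x j) \<le> B"
proof -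
  obtain B where "\<And>j. nrm (x j) \<le> B"
    using quasi_greedy unfolding quasi_greedy_basis_def semi_normalized_def by (auto simp: bdd_above_def)
  then have "nrm (x j) \<le> \<bar>B\<bar> + 1" for j using order_trans[of "nrm (x j)" B "\<bar>B\<bar> + 1"] by simp
  then show ?thesis by (intro exI[of _ "\<bar>B\<bar> + 1"]) simp
qed

definition comb :: "nat set \<Rightarrow> (nat \<Rightarrow> 'k) \<Rightarrow> 'v" where
  "comb A a = (\<Sum>j\<in>A. sc (a j) (x j))"

lemma comb_mem [simp]: "comb A a \<in> X"
  unfolding comb_def by (intro sum_mem scale_mem x_mem)

lemma comb_cong: "A = B \<Longrightarrow> (\<And>j. j \<in> B \<Longrightarrow> a j = b j) \<Longrightarrow> comb A a = comb B b"
  unfolding comb_def by (rule sum.cong) auto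

lemma comb_union: "finite A \<Longrightarrow> finite B \<Longrightarrow> A \<inter> B = {} \<Longrightarrow> comb (A \<union> B) a = comb A a + comb B a"
  unfolding comb_def by (rule sum.union_disjoint)

lemma comb_scale: "comb A (\<lambda>j. c * a j) = sc c (comb A a)"
  unfolding comb_def by (simp add: scale_sum_right)

lemma comb_add: "comb A (\<lambda>j. a j + b j) = comb A a + comb A b"
  unfolding comb_def by (simp add: scale_left_distrib sum.distrib)

lemma comb_diff: "comb A (\<lambda>j. a j - b j) = comb A a - comb A b"
  unfolding comb_def by (simp add: scale_left_diff_distrib sum_subtractf)

lemma comb_restrict: "finite A \<Longrightarrow> B \<subseteq> A \<Longrightarrow> (\<And>j. j \<in> A - B \<Longrightarrow> a j = 0) \<Longrightarrow> comb B a = comb A a"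
  unfolding comb_def by (rule sum.mono_neutral_left) auto

lemma coefficient_comb: "finite A \<Longrightarrow> xs k (comb A a) = (if k \<in> A then a k else 0)"
  unfolding comb_def
  by (subst dual_sum[OF xs_dual])
     (auto simp: scale_mem x_mem dual_scale[OF xs_dual x_mem] biorthogonal if_distrib sum.delta cong: if_cong)

lemma nrm_comb_le:
  assumes "\<And>j. nrm (x j) \<le> B" "0 \<le> D" "\<And>j. j \<in> A \<Longrightarrow> norm (a j) \<le> D"
  shows "nrm (comb A a) \<le> real (card A) * (D * B)"
proof -
  have "nrm (comb A a) \<le> (\<Sum>j\<in>A. nrm (sc (a j) (x j)))"
    unfolding comb_def by (intro nrm_sum scale_mem x_mem)
  also have "\<dots> \<le> (\<Sum>j\<in>A. D * B)"
    using assms nrm_nonneg[OF x_mem] by (intro sum_mono) (auto simp: nrm_scale x_mem intro!: mult_mono)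
  finally show ?thesis by simp
qed

text \<open>
  Biorthogonality makes the basis vectors distinct, so a linear combination of them can be indexed by
  the indices.
\<close>

lemma span_comb:
  assumes "g \<in> span (range x)"
  obtains A a where "finite A" "g = comb A a"
proof -
  from assms obtain t r where t: "finite t" "t \<subseteq> range x" "g = (\<Sum>v\<in>t. sc (r v) v)"
    unfolding span_explicit by auto
  have inj: "inj x"
  proof (rule injI)
    fix i j assume "x i = x j"
    then show "i = j" using biorthogonal[of i i] biorthogonal[of i j] by (auto split: if_splits)
  qed
  obtain A where A: "finite A" "t = x ` A" using t(1,2) finite_subset_image by metis
  have "g = comb A (\<lambda>j. r (x j))"
    unfolding comb_def t(3) A(2) using inj by (subst sum.reindex) (auto intro: inj_on_subset)
  then show ?thesis using A that by blast
qed

lemma approx_comb: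
  assumes "f \<in> X" "0 < \<epsilon>"
  obtains A a where "finite A" "nrm (f - comb A a) < \<epsilon>"
proof -
  have "f \<in> closed_span sc X nrm (range x)" using assms dense by simp
  then obtain g where "g \<in> span (range x)" "nrm (f - g) < \<epsilon>" using assms unfolding closed_span_def by auto
  then show ?thesis using span_comb that by metis
qed

text \<open>
  A finite combination close to f has only finitely many nonzero coefficients, and the coefficient
  functionals are uniformly bounded.
\<close>

lemma coefficients_tendsto_0:
  assumes "f \<in> X"
  shows "(\<lambda>j. xs j f) \<longlonglongrightarrow> 0"
proof (rule LIMSEQ_I)
  fix e :: real assume "0 < e"
  then obtain A a where A: "finite A" "nrm (f - comb A a) < e / kappa"
    using approx_comb[OF assms, of "e / kappa"] kappa_pos by auto
  obtain N where N: "\<And>j. j \<in> A \<Longrightarrow> j < N" using A(1) finite_nat_set_iff_bounded by auto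
  have "norm (xs j f - 0) < e" if "j \<ge> N" for j
  proof -
    have "xs j f = xs j (f - comb A a)"
      using N[of j] that A(1) assms by (auto simp: dual_diff[OF xs_dual] coefficient_comb)
    also have "norm \<dots> \<le> kappa * nrm (f - comb A a)" using assms by (intro coefficient_bound diff_mem) auto
    also have "\<dots> < e" using A(2) kappa_pos by (simp add: field_simps)
    finally show ?thesis by simp
  qed
  then show "\<exists>N. \<forall>j\<ge>N. norm (xs j f - 0) < e" by blast
qed

definition large :: "(nat \<Rightarrow> 'k) \<Rightarrow> real \<Rightarrow> nat set" where
  "large a t = {j. t \<le> norm (a j)}"

text \<open>
  A set of all coefficients above a threshold is an initial segment of the greedy ordering, however
  ties are broken. Through this lemma all later arguments become independent of \<tau>.
\<close>

lemma greedy_sum_large: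
  assumes f: "f \<in> X" and t: "0 < t"
  defines "S \<equiv> large (\<lambda>j. xs j f) t"
  shows "greedy_sum sc \<tau> x xs (card S) f = comb S (\<lambda>j. xs j f)"
proof -
  define a where "a = (\<lambda>j. xs j f)"
  define \<rho> where "\<rho> = greedy_ordering \<tau> a"
  have null: "a \<longlonglongrightarrow> 0" unfolding a_def by (rule coefficients_tendsto_0[OF f])
  have "is_greedy_ordering \<tau> a \<rho>" unfolding \<rho>_def by (rule greedy_ordering_is_greedy[OF bij null])
  then have inj: "inj \<rho>" and supp: "{j. a j \<noteq> 0} \<subseteq> range \<rho>"
    and mono: "\<And>k n. k \<le> n \<Longrightarrow> norm (a (\<rho> n)) \<le> norm (a (\<rho> k))"
    unfolding is_greedy_ordering_def by auto
  have S: "S = {j. t \<le> norm (a j)}" by (simp add: S_def large_def a_def)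
  have fin: "finite S" unfolding S by (rule finite_large_values[OF null t])
  define T where "T = {n. t \<le> norm (a (\<rho> n))}"
  have "S \<subseteq> range \<rho>" using supp t by (fastforce simp: S)
  then have img: "S = \<rho> ` T" by (auto simp: S T_def)
  have finT: "finite T" using fin inj unfolding img by (metis finite_imageD inj_on_subset subset_UNIV)
  have "T = {..<card T}"
  proof -
    have down: "m \<in> T" if "n \<in> T" "m \<le> n" for m n using mono[OF that(2)] that(1) by (auto simp: T_def)
    show ?thesis
    proof (cases "T = {}")
      case False
      define N where "N = Max T"
      have "N \<in> T" "\<And>n. n \<in> T \<Longrightarrow> n \<le> N" using finT False by (auto simp: N_def)
      then have "T = {..N}" using down by blast
      then show ?thesis by (simp add: lessThan_Suc_atMost)
    qed auto
  qed
  moreover have "card S = card T" unfolding img using inj by (intro card_image) (auto intro: inj_on_subset)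
  ultimately have "S = \<rho> ` {..<card S}" using img by simp
  then have "comb S a = comb (\<rho> ` {..<card S}) a" by simp
  also have "\<dots> = (\<Sum>n<card S. sc (a (\<rho> n)) (x (\<rho> n)))"
    unfolding comb_def using inj by (subst sum.reindex) (auto intro: inj_on_subset)
  finally have "(\<Sum>n<card S. sc (a (\<rho> n)) (x (\<rho> n))) = comb S a" by simp
  then show ?thesis unfolding greedy_sum_def Let_def a_def \<rho>_def by simp
qed

lemma large_sums_tendsto:
  assumes f: "f \<in> X" and t: "\<And>j. 0 < t j" and card: "\<And>j. j \<le> card (large (\<lambda>k. xs k f) (t j))"
  shows "(\<lambda>j. nrm (comb (large (\<lambda>k. xs k f) (t j)) (\<lambda>k. xs k f) - f)) \<longlonglongrightarrow> 0"
proof -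
  have "(\<lambda>m. nrm (greedy_sum sc \<tau> x xs m f - f)) \<longlonglongrightarrow> 0"
    using quasi_greedy f unfolding quasi_greedy_basis_def by blast
  moreover have "filterlim (\<lambda>j. card (large (\<lambda>k. xs k f) (t j))) at_top sequentially"
    by (rule filterlim_at_top_mono[OF filterlim_ident]) (use card in auto)
  ultimately have "(\<lambda>j. nrm (greedy_sum sc \<tau> x xs (card (large (\<lambda>k. xs k f) (t j))) f - f)) \<longlonglongrightarrow> 0"
    by (rule filterlim_compose)
  then show ?thesis unfolding greedy_sum_large[OF f t] .
qed

text \<open>
  A finite combination beyond the index N, of small norm, whose large coefficients alone form a
  combination of norm at least 1: one hump for the gliding hump argument.
\<close>

definition block :: "nat \<Rightarrow> real \<Rightarrow> nat set \<Rightarrow> (nat \<Rightarrow> 'k) \<Rightarrow> real \<Rightarrow> bool" where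
  "block N \<epsilon> A a t \<longleftrightarrow> finite A \<and> A \<subseteq> {N..} \<and> (\<forall>j. j \<in> A \<longleftrightarrow> a j \<noteq> 0) \<and>
     nrm (comb A a) \<le> \<epsilon> \<and> 0 < t \<and> 1 \<le> nrm (comb (A \<inter> large a t) a)"

text \<open>
  If thresholding is unbounded, then it remains so beyond any index N, because the first N coordinates
  contribute only a bounded multiple of the norm. Scaling to norm \<epsilon> then gives a block.
\<close>

lemma unbounded_blocks:
  assumes unb: "\<And>C. 0 \<le> C \<Longrightarrow> \<exists>A a t. finite A \<and> 0 < t \<and> C * nrm (comb A a) < nrm (comb (A \<inter> large a t) a)"
    and e: "0 < \<epsilon>"
  shows "\<exists>A a t. block N \<epsilon> A a t"
proof -
  obtain B where B: "0 < B" "\<And>j. nrm (x j) \<le> B" using ex_basis_bound by blast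
  define D where "D = real N * (kappa * B)"
  have D: "0 \<le> D" using B kappa_pos by (simp add: D_def)
  \<comment> \<open>Discarding the first N coordinates changes the norms before and after thresholding by at most D times the norm; the constant absorbs both changes.\<close>
  obtain A a t where A: "finite A" "0 < t"
    and viol: "((1 + D) / \<epsilon> + D) * nrm (comb A a) < nrm (comb (A \<inter> large a t) a)"
    using unb[of "(1 + D) / \<epsilon> + D"] D e by auto
  define n where "n = nrm (comb A a)"
  have n: "0 \<le> n" unfolding n_def by (simp add: nrm_nonneg)
  have coef: "norm (a j) \<le> kappa * n" if "j \<in> A" for j
    using coefficient_bound[OF comb_mem, of j A a] that A(1) by (simp add: coefficient_comb n_def)
  have low: "nrm (comb (A \<inter> S \<inter> {..<N}) a) \<le> D * n" for S
  proof -
    have "nrm (comb (A \<inter> S \<inter> {..<N}) a) \<le> real (card (A \<inter> S \<inter> {..<N})) * (kappa * n * B)"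
      using B(2) n kappa_pos coef by (intro nrm_comb_le) auto
    also have "card (A \<inter> S \<inter> {..<N}) \<le> card {..<N}" by (intro card_mono) auto
    then have "real (card (A \<inter> S \<inter> {..<N})) * (kappa * n * B) \<le> real N * (kappa * n * B)"
      using n kappa_pos B by (intro mult_right_mono) auto
    finally show ?thesis by (simp add: D_def mult_ac)
  qed
  define A2 where "A2 = {j \<in> A. N \<le> j \<and> a j \<noteq> 0}"
  have A2: "finite A2" using A by (simp add: A2_def)
  have split: "comb (A \<inter> S) a = comb (A \<inter> S \<inter> {..<N}) a + comb (A2 \<inter> S) a" for S
  proof -
    have "comb (A \<inter> S) a = comb (A \<inter> S \<inter> {..<N} \<union> A \<inter> S \<inter> {N..}) a" by (rule comb_cong) auto
    also have "\<dots> = comb (A \<inter> S \<inter> {..<N}) a + comb (A \<inter> S \<inter> {N..}) a"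
      using A by (intro comb_union) auto
    also have "comb (A \<inter> S \<inter> {N..}) a = comb (A2 \<inter> S) a"
      using A by (intro comb_restrict[symmetric]) (auto simp: A2_def)
    finally show ?thesis .
  qed
  have high: "nrm (comb (A2 \<inter> S) a) \<le> nrm (comb (A \<inter> S) a) + D * n"
    and high': "nrm (comb (A \<inter> S) a) \<le> nrm (comb (A2 \<inter> S) a) + D * n" for S
    using nrm_diff[OF comb_mem comb_mem, of "A \<inter> S" a "A \<inter> S \<inter> {..<N}" a]
      nrm_add[OF comb_mem comb_mem, of "A2 \<inter> S" a "A \<inter> S \<inter> {..<N}" a] low[of S]
    by (auto simp: split[of S] add.commute)
  define n2 where "n2 = nrm (comb A2 a)"
  have "n2 \<le> (1 + D) * n" using high[of UNIV] by (simp add: n2_def n_def algebra_simps)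
  then have "n2 / \<epsilon> \<le> (1 + D) / \<epsilon> * n" using e by (simp add: field_simps)
  then have viol2: "n2 / \<epsilon> < nrm (comb (A2 \<inter> large a t) a)"
    using viol high'[of "large a t"] by (simp add: n_def[symmetric] algebra_simps)
  have n2: "0 < n2"
  proof (rule ccontr)
    assume "\<not> 0 < n2"
    then have "n2 = 0" using nrm_nonneg[OF comb_mem, of A2 a] by (simp add: n2_def)
    then have "norm (a j) \<le> 0" if "j \<in> A2" for j
      using coefficient_bound[OF comb_mem, of j A2 a] that A2 by (simp add: coefficient_comb n2_def)
    then have "A2 = {}" by (auto simp: A2_def)
    then show False using viol2 \<open>n2 = 0\<close> by (simp add: comb_def)
  qed
  define s where "s = \<epsilon> / n2"
  have s: "0 < s" using e n2 by (simp add: s_def)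
  define b where "b = (\<lambda>j. if j \<in> A2 then of_real s * a j else 0)"
  have scaled: "nrm (comb (A2 \<inter> S) b) = s * nrm (comb (A2 \<inter> S) a)" for S
  proof -
    have "comb (A2 \<inter> S) b = comb (A2 \<inter> S) (\<lambda>j. of_real s * a j)" by (rule comb_cong) (auto simp: b_def)
    then show ?thesis using s by (simp add: comb_scale nrm_scale)
  qed
  have lar: "A2 \<inter> large b (s * t) = A2 \<inter> large a t"
    using s by (auto simp: large_def b_def norm_mult)
  have "block N \<epsilon> A2 b (s * t)"
    unfolding block_def
  proof (intro conjI)
    show "finite A2" "A2 \<subseteq> {N..}" using A by (auto simp: A2_def)
    show "\<forall>j. j \<in> A2 \<longleftrightarrow> b j \<noteq> 0" using s by (auto simp: b_def A2_def)
    show "nrm (comb A2 b) \<le> \<epsilon>" using scaled[of UNIV] n2 by (simp add: s_def n2_def[symmetric])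
    show "0 < s * t" using s A by simp
    have "1 = s * (n2 / \<epsilon>)" using e n2 by (simp add: s_def)
    also have "\<dots> \<le> s * nrm (comb (A2 \<inter> large a t) a)" using s viol2 by (intro mult_left_mono) auto
    finally show "1 \<le> nrm (comb (A2 \<inter> large b (s * t)) b)" using scaled lar by (simp add: lar)
  qed
  then show ?thesis by blast
qed

text \<open>
  Otherwise, choose blocks successively, with consecutive supports and with norms that decrease so fast
  that all coefficients of a block are smaller than all coefficients and the threshold of the previous
  one. The blocks have a summable series. For its sum F, the indices above the threshold of the j-th
  block are those of the earlier blocks together with the large ones of the j-th. Hence two
  threshold sums of F differ by a vector of norm at least 1, for every j, whereas both converge to F.
\<close>

lemma large_projection_bounded:
  "\<exists>C\<ge>0. \<forall>A a t. finite A \<longrightarrow> 0 < t \<longrightarrow> nrm (comb (A \<inter> large a t) a) \<le> C * nrm (comb A a)"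
proof (rule ccontr)
  assume "\<not> ?thesis"
  then have unb: "\<exists>A a t. finite A \<and> 0 < t \<and> C * nrm (comb A a) < nrm (comb (A \<inter> large a t) a)" if "0 \<le> C" for C
    using that by (meson not_le)
  have blocks: "\<exists>A a t. block N \<epsilon> A a t" if "0 < \<epsilon>" for N \<epsilon>
    by (rule unbounded_blocks) (use unb that in auto)
  define ok :: "nat \<times> real \<times> nat set \<times> (nat \<Rightarrow> 'k) \<times> real \<Rightarrow> bool"
    where "ok = (\<lambda>(N, \<epsilon>, A, a, t). 0 < \<epsilon> \<and> block N \<epsilon> A a t)"
  define succ :: "nat \<times> real \<times> nat set \<times> (nat \<Rightarrow> 'k) \<times> real \<Rightarrow> nat \<times> real \<times> nat set \<times> (nat \<Rightarrow> 'k) \<times> real \<Rightarrow> bool"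
    where "succ = (\<lambda>(N, \<epsilon>, A, a, t) (N', \<epsilon>', A', a', t').
       A \<subseteq> {..<N'} \<and> N \<le> N' \<and> \<epsilon>' \<le> \<epsilon> / 2 \<and> 2 * kappa * \<epsilon>' \<le> t \<and> (\<forall>j\<in>A. 2 * kappa * \<epsilon>' \<le> norm (a j)))"
  obtain A a t where "block 0 1 A a t" using blocks[of 1 0] by auto
  then have start: "\<exists>s. ok s" by (intro exI[of _ "(0, 1, A, a, t)"]) (simp add: ok_def)
  have step: "\<exists>s'. ok s' \<and> succ s s'" if ok: "ok s" for s
  proof -
    obtain N \<epsilon> A a t where s: "s = (N, \<epsilon>, A, a, t)" by (cases s)
    have e: "0 < \<epsilon>" and bl: "block N \<epsilon> A a t" using ok by (auto simp: s ok_def)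
    have fin: "finite A" using bl by (simp add: block_def)
    define M where "M = Min (insert t ((\<lambda>j. norm (a j)) ` A))"
    have "0 < M" unfolding M_def using bl by (subst Min_gr_iff) (auto simp: block_def)
    have M: "M \<le> t" "\<And>j. j \<in> A \<Longrightarrow> M \<le> norm (a j)" using fin by (auto simp: M_def)
    define \<epsilon>' where "\<epsilon>' = min (\<epsilon> / 2) (M / (2 * kappa))"
    have e': "0 < \<epsilon>'" using e \<open>0 < M\<close> kappa_pos by (simp add: \<epsilon>'_def)
    have "2 * kappa * \<epsilon>' \<le> 2 * kappa * (M / (2 * kappa))" using kappa_pos by (intro mult_left_mono) (auto simp: \<epsilon>'_def)
    then have Ke: "2 * kappa * \<epsilon>' \<le> M" using kappa_pos by simp
    obtain N0 where N0: "A \<subseteq> {..<N0}" using fin finite_nat_set_iff_bounded by auto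
    obtain A' a' t' where bl': "block (max N N0) \<epsilon>' A' a' t'" using blocks[OF e'] by blast
    have "ok (max N N0, \<epsilon>', A', a', t')" using e' bl' by (simp add: ok_def)
    moreover have "succ s (max N N0, \<epsilon>', A', a', t')"
      unfolding succ_def s using N0 M Ke by (auto simp: \<epsilon>'_def intro: order_trans)
    ultimately show ?thesis by blast
  qed
  obtain S where S: "\<And>n. ok (S n)" "\<And>n. succ (S n) (S (Suc n))"
    using dependent_nat_choice[of "\<lambda>_. ok" "\<lambda>_. succ"] start step by blast
  define N \<epsilon> A a t where "N = (\<lambda>n. fst (S n))" and "\<epsilon> = (\<lambda>n. fst (snd (S n)))"
    and "A = (\<lambda>n. fst (snd (snd (S n))))" and "a = (\<lambda>n. fst (snd (snd (snd (S n)))))"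
    and "t = (\<lambda>n. snd (snd (snd (snd (S n)))))"
  note defs = N_def \<epsilon>_def A_def a_def t_def
  have Seq: "S n = (N n, \<epsilon> n, A n, a n, t n)" for n by (simp add: defs)
  have epos: "0 < \<epsilon> n" and bl: "block (N n) (\<epsilon> n) (A n) (a n) (t n)" for n
    using S(1)[of n] by (auto simp: ok_def Seq)
  have fin: "finite (A n)" and low: "A n \<subseteq> {N n..}" and supp: "j \<in> A n \<longleftrightarrow> a n j \<noteq> 0"
    and small: "nrm (comb (A n) (a n)) \<le> \<epsilon> n" and tpos: "0 < t n"
    and big: "1 \<le> nrm (comb (A n \<inter> large (a n) (t n)) (a n))" for n j
    using bl[of n] by (auto simp: block_def)
  have up: "A n \<subseteq> {..<N (Suc n)}" and Nle: "N n \<le> N (Suc n)" and half: "\<epsilon> (Suc n) \<le> \<epsilon> n / 2"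
    and Ket: "2 * kappa * \<epsilon> (Suc n) \<le> t n" and Kea: "j \<in> A n \<Longrightarrow> 2 * kappa * \<epsilon> (Suc n) \<le> norm (a n j)" for n j
    using S(2)[of n] by (auto simp: succ_def Seq)
  have Nmono: "N i \<le> N j" if "i \<le> j" for i j using that Nle by (rule lift_Suc_mono_le[of N, rotated])
  have emono: "\<epsilon> j \<le> \<epsilon> i" if "i \<le> j" for i j
    using that by (rule lift_Suc_antimono_le[of \<epsilon>, rotated]) (use half epos in \<open>smt (verit) field_sum_of_halves\<close>)
  have disj: "A i \<inter> A j = {}" if "i < j" for i j
    using up[of i] low[of j] Nmono[of "Suc i" j] that by fastforce
  have disj': "i = j" if "k \<in> A i" "k \<in> A j" for i j k
    using disj[of i j] disj[of j i] that by (metis IntI empty_iff linorder_neqE_nat)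
  have coef_kappa: "norm (a n k) \<le> kappa * \<epsilon> n" for n k
  proof (cases "k \<in> A n")
    case True
    then have "norm (a n k) \<le> kappa * nrm (comb (A n) (a n))"
      using coefficient_bound[OF comb_mem, of k "A n" "a n"] fin by (simp add: coefficient_comb)
    also have "\<dots> \<le> kappa * \<epsilon> n" using small kappa_pos by (intro mult_left_mono) auto
    finally show ?thesis .
  qed (use supp[of k n] epos[of n] kappa_pos in auto)
  define f where "f = (\<lambda>n. comb (A n) (a n))"
  have "\<epsilon> n \<le> \<epsilon> 0 * (1 / 2) ^ n" for n
  proof (induction n)
    case (Suc n)
    then show ?case using half[of n] by simp
  qed simp
  then have geo: "nrm (f n) \<le> \<epsilon> 0 * (1 / 2) ^ n" for n
    unfolding f_def by (rule order_trans[OF small])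
  have "summable (\<lambda>n. nrm (f n))"
  proof (rule summable_comparison_test')
    show "summable (\<lambda>n. \<epsilon> 0 * (1 / 2) ^ n)" by (intro summable_mult summable_geometric) simp
    show "norm (nrm (f n)) \<le> \<epsilon> 0 * (1 / 2) ^ n" if "0 \<le> n" for n
      using geo[of n] by (simp add: f_def nrm_nonneg)
  qed
  then obtain F where F: "F \<in> X" "(\<lambda>n. nrm (F - (\<Sum>j<n. f j))) \<longlonglongrightarrow> 0"
    using complete[of f] by (auto simp: f_def)
  define b where "b = (\<lambda>k. xs k F)"
  have coefsum: "xs k (\<Sum>j<n. f j) = (\<Sum>j<n. a j k)" for k n
    using supp[of k] fin by (subst dual_sum[OF xs_dual]) (auto simp: f_def coefficient_comb intro!: sum.cong)
  have lim: "(\<lambda>n. \<Sum>j<n. a j k) \<longlonglongrightarrow> b k" for k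
  proof -
    have "(\<lambda>n. b k - (\<Sum>j<n. a j k)) \<longlonglongrightarrow> 0"
    proof (rule Lim_null_comparison)
      show "eventually (\<lambda>n. norm (b k - (\<Sum>j<n. a j k)) \<le> kappa * nrm (F - (\<Sum>j<n. f j))) sequentially"
      proof (rule always_eventually, rule allI)
        fix n
        have m: "(\<Sum>j<n. f j) \<in> X" by (intro sum_mem) (simp add: f_def)
        then show "norm (b k - (\<Sum>j<n. a j k)) \<le> kappa * nrm (F - (\<Sum>j<n. f j))"
          using coefficient_bound[OF diff_mem[OF F(1) m], of k]
          by (simp add: dual_diff[OF xs_dual F(1) m] coefsum b_def)
      qed
      show "(\<lambda>n. kappa * nrm (F - (\<Sum>j<n. f j))) \<longlonglongrightarrow> 0" using tendsto_mult_left[OF F(2), of kappa] by simp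
    qed
    from tendsto_diff[OF tendsto_const[of "b k"] this] show ?thesis by simp
  qed
  have b_in: "b k = a i k" if "k \<in> A i" for i k
  proof -
    have off: "a j k = 0" if "j \<noteq> i" for j using supp[of k j] disj'[of k j i] \<open>k \<in> A i\<close> that by blast
    have "(\<Sum>j<n. a j k) = a i k" if "n \<ge> Suc i" for n
    proof -
      have "(\<Sum>j<n. a j k) = (\<Sum>j<n. if j = i then a i k else 0)"
        using off by (intro sum.cong) auto
      then show ?thesis using that by simp
    qed
    then have "(\<lambda>n. \<Sum>j<n. a j k) \<longlonglongrightarrow> a i k"
      by (intro tendsto_eventually) (auto simp: eventually_sequentially)
    then show ?thesis using lim LIMSEQ_unique by blast
  qed
  have b_out: "b k = 0" if "\<And>i. k \<notin> A i" for k
  proof -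
    have "(\<lambda>n. \<Sum>j<n. a j k) \<longlonglongrightarrow> 0" using that supp by simp
    then show ?thesis using lim LIMSEQ_unique by blast
  qed
  have earlier: "2 * kappa * \<epsilon> j \<le> norm (b k)" if "k \<in> A i" "i < j" for i j k
    using b_in[OF that(1)] Kea[OF that(1)] emono[of "Suc i" j] that(2) kappa_pos
    by (smt (verit) Suc_leI mult_left_mono)
  have later: "norm (b k) \<le> kappa * \<epsilon> j" if "k \<in> A i" "j \<le> i" for i j k
    using b_in[OF that(1)] coef_kappa[of i k] emono[OF that(2)] kappa_pos by (smt (verit) mult_left_mono)
  have Ke: "0 < kappa * \<epsilon> j" for j using kappa_pos epos by simp
  have t_le: "t j \<le> kappa * \<epsilon> j" for j
  proof -
    have "A j \<inter> large (a j) (t j) \<noteq> {}" using big[of j] by (auto simp: comb_def)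
    then obtain k where "t j \<le> norm (a j k)" by (auto simp: large_def)
    then show ?thesis using coef_kappa[of j k] by simp
  qed
  define U where "U = (\<lambda>j. \<Union>i<j. A i)"
  \<comment> \<open>The coefficients of the j-th and later blocks are at most kappa * \<epsilon> j, those of the earlier blocks at least twice as large.\<close>
  have large1: "large b (2 * kappa * \<epsilon> j) = U j" for j
  proof (intro equalityI subsetI)
    fix k assume k: "k \<in> large b (2 * kappa * \<epsilon> j)"
    then have k': "2 * (kappa * \<epsilon> j) \<le> norm (b k)" by (simp add: large_def mult.assoc)
    then have "b k \<noteq> 0" using Ke[of j] by (metis less_le_not_le mult_pos_pos norm_zero zero_less_numeral)
    then obtain i where i: "k \<in> A i" using b_out by blast
    then have "i < j" using later[OF i, of j] k' Ke[of j] by (cases "i < j") auto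
    then show "k \<in> U j" using i by (auto simp: U_def)
  qed (use earlier in \<open>auto simp: U_def large_def\<close>)
  have large2: "large b (t j) = U j \<union> (A j \<inter> large (a j) (t j))" for j
  proof (intro equalityI subsetI)
    fix k assume k: "k \<in> large b (t j)"
    then have "b k \<noteq> 0" using tpos[of j] by (auto simp: large_def)
    then obtain i where i: "k \<in> A i" using b_out by blast
    have "i \<le> j"
    proof (rule ccontr)
      assume "\<not> i \<le> j"
      then have "norm (b k) \<le> kappa * \<epsilon> (Suc j)" using later[OF i, of "Suc j"] by simp
      then show False using Ket[of j] k Ke[of "Suc j"] by (simp add: large_def)
    qed
    then show "k \<in> U j \<union> (A j \<inter> large (a j) (t j))"
      using i k b_in[OF i] by (cases "i = j") (auto simp: U_def large_def)
  next
    fix k assume "k \<in> U j \<union> (A j \<inter> large (a j) (t j))"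
    then show "k \<in> large b (t j)"
    proof
      assume "k \<in> U j"
      then have "2 * kappa * \<epsilon> j \<le> norm (b k)" using earlier by (auto simp: U_def)
      then show ?thesis using t_le[of j] Ke[of j] by (simp add: large_def)
    qed (use b_in in \<open>auto simp: large_def\<close>)
  qed
  have finU: "finite (U j)" for j using fin by (simp add: U_def)
  have cardU: "j \<le> card (U j)" for j
  proof -
    have "1 \<le> card (A i)" for i
      using big[of i] fin[of i] by (cases "A i = {}") (auto simp: comb_def card_gt_0_iff Suc_le_eq)
    then have "(\<Sum>i<j. 1) \<le> (\<Sum>i<j. card (A i))" by (intro sum_mono) auto
    also have "\<dots> = card (U j)" unfolding U_def
      using fin disj' by (intro card_UN_disjoint[symmetric]) auto
    finally show ?thesis by simp
  qed
  have lim1: "(\<lambda>j. nrm (comb (large b (2 * kappa * \<epsilon> j)) b - F)) \<longlonglongrightarrow> 0"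
  proof (rule large_sums_tendsto[OF F(1), folded b_def])
    show "0 < 2 * kappa * \<epsilon> j" for j using Ke[of j] by (simp add: mult.commute)
    show "j \<le> card (large b (2 * kappa * \<epsilon> j))" for j unfolding large1 by (rule cardU)
  qed
  have lim2: "(\<lambda>j. nrm (comb (large b (t j)) b - F)) \<longlonglongrightarrow> 0"
  proof (rule large_sums_tendsto[OF F(1), folded b_def])
    show "0 < t j" for j by (rule tpos)
    have "card (U j) \<le> card (large b (t j))" for j
      unfolding large2 using finU fin by (intro card_mono) auto
    then show "j \<le> card (large b (t j))" for j using cardU order_trans by blast
  qed
  have "1 \<le> nrm (comb (large b (t j)) b - F) + nrm (comb (large b (2 * kappa * \<epsilon> j)) b - F)" for j
  proof -
    have "comb (large b (t j)) b = comb (U j) b + comb (A j \<inter> large (a j) (t j)) b"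
      unfolding large2 using finU fin disj' by (intro comb_union) (auto simp: U_def)
    also have "comb (A j \<inter> large (a j) (t j)) b = comb (A j \<inter> large (a j) (t j)) (a j)"
      using b_in by (intro comb_cong) auto
    finally have "comb (A j \<inter> large (a j) (t j)) (a j)
        = (comb (large b (t j)) b - F) - (comb (large b (2 * kappa * \<epsilon> j)) b - F)"
      by (simp add: large1)
    then show ?thesis using big[of j] nrm_diff[of "comb (large b (t j)) b - F" "comb (large b (2 * kappa * \<epsilon> j)) b - F"]
      by (simp add: diff_mem F(1))
  qed
  moreover have "(\<lambda>j. nrm (comb (large b (t j)) b - F) + nrm (comb (large b (2 * kappa * \<epsilon> j)) b - F)) \<longlonglongrightarrow> 0 + 0"
    by (intro tendsto_add lim1 lim2)
  ultimately have "(1::real) \<le> 0 + 0" by (intro LIMSEQ_le_const) auto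
  then show False by simp
qed

text \<open>
  Replace every coefficient of modulus at least t by one of modulus t with the same sign. Let h t be
  the combination with the new coefficients and U t the one with the old ones. If v is the smallest
  modulus greater than t, then h t - U t = r (h v - U v) - (1 - r) U v with r = t / v. This is, up to
  sign, a convex combination of vectors of norm at most D, so induction over the moduli keeps the bound D.
\<close>

lemma flattening_bounded:
  assumes A: "finite A" and D: "\<And>t. 0 < t \<Longrightarrow> nrm (comb (A \<inter> large a t) a) \<le> D" and t: "0 < t"
  shows "nrm (comb (A \<inter> large a t) (\<lambda>k. of_real t * sgn (a k) - a k)) \<le> D"
  using t
proof (induction "card {k \<in> A. t < norm (a k)}" arbitrary: t rule: less_induct)
  case less
  have D0: "0 \<le> D" using order_trans[OF nrm_nonneg[OF comb_mem] D[OF less.prems]] .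
  define S where "S = {k \<in> A. t < norm (a k)}"
  have finS: "finite S" using A by (simp add: S_def)
  have tS: "comb (A \<inter> large a t) (\<lambda>k. of_real t * sgn (a k) - a k) = comb S (\<lambda>k. of_real t * sgn (a k) - a k)"
  proof (rule comb_restrict[symmetric])
    fix k assume "k \<in> A \<inter> large a t - S"
    then have "norm (a k) = t" by (auto simp: S_def large_def)
    then show "of_real t * sgn (a k) - a k = 0" using less.prems by (auto simp: sgn_div_norm scaleR_conv_of_real)
  qed (use A in \<open>auto simp: S_def large_def\<close>)
  show ?case
  proof (cases "S = {}")
    case True
    then show ?thesis unfolding tS using D0 by (simp add: comb_def)
  next
    case False
    define v where "v = Min ((\<lambda>k. norm (a k)) ` S)"
    have "v \<in> (\<lambda>k. norm (a k)) ` S" unfolding v_def using finS False by (intro Min_in) auto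
    then obtain k0 where k0: "k0 \<in> S" "v = norm (a k0)" by auto
    have vle: "v \<le> norm (a k)" if "k \<in> S" for k using that finS by (simp add: v_def)
    have tv: "t < v" using k0 by (simp add: S_def)
    then have v: "0 < v" using less.prems by simp
    have Sv: "S = A \<inter> large a v" using vle tv by (auto simp: S_def large_def)
    have "{k \<in> A. v < norm (a k)} \<subset> S" using tv k0 by (auto simp: S_def)
    then have IH: "nrm (comb S (\<lambda>k. of_real v * sgn (a k) - a k)) \<le> D"
      using less.hyps[of v] v finS psubset_card_mono unfolding Sv[symmetric] S_def[symmetric] by blast
    define r where "r = t / v"
    have r: "0 \<le> r" "r \<le> 1" "r * v = t" using tv v less.prems by (auto simp: r_def)
    have "comb S (\<lambda>k. of_real t * sgn (a k) - a k)
        = comb S (\<lambda>k. of_real r * (of_real v * sgn (a k) - a k) - of_real (1 - r) * a k)"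
    proof (rule comb_cong[OF refl])
      fix k
      have "of_real t = (of_real r * of_real v :: 'k)" using r(3) by (simp flip: of_real_mult)
      then show "of_real t * sgn (a k) - a k = of_real r * (of_real v * sgn (a k) - a k) - of_real (1 - r) * a k"
        by (simp add: algebra_simps)
    qed
    also have "\<dots> = sc (of_real r) (comb S (\<lambda>k. of_real v * sgn (a k) - a k)) - sc (of_real (1 - r)) (comb S a)"
      by (simp add: comb_diff comb_scale)
    finally have split: "comb S (\<lambda>k. of_real t * sgn (a k) - a k)
        = sc (of_real r) (comb S (\<lambda>k. of_real v * sgn (a k) - a k)) - sc (of_real (1 - r)) (comb S a)" .
    have "nrm (comb S (\<lambda>k. of_real t * sgn (a k) - a k))
        \<le> nrm (sc (of_real r) (comb S (\<lambda>k. of_real v * sgn (a k) - a k))) + nrm (sc (of_real (1 - r)) (comb S a))"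
      unfolding split by (intro nrm_diff scale_mem comb_mem)
    also have "\<dots> = r * nrm (comb S (\<lambda>k. of_real v * sgn (a k) - a k)) + (1 - r) * nrm (comb S a)"
      using r by (simp add: nrm_scale del: of_real_diff)
    also have "\<dots> \<le> r * D + (1 - r) * D"
      using r IH D[OF v] unfolding Sv[symmetric] by (intro add_mono mult_left_mono) auto
    finally show ?thesis unfolding tS by (simp add: algebra_simps)
  qed
qed

text \<open>
  Enlarging the coefficients on B by a factor 1 + d makes B the set of large coefficients; then let d
  tend to zero.
\<close>

lemma subset_of_constant_coefficients:
  assumes C: "0 \<le> C" "\<And>A a t. finite A \<Longrightarrow> 0 < t \<Longrightarrow> nrm (comb (A \<inter> large a t) a) \<le> C * nrm (comb A a)"
    and A: "finite A" "B \<subseteq> A" and t: "0 < t" and u: "\<And>k. k \<in> A \<Longrightarrow> norm (u k) = t"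
  shows "nrm (comb B u) \<le> C * nrm (comb A u)"
proof (rule field_le_epsilon)
  fix e :: real assume e: "0 < e"
  have nn: "0 \<le> nrm (comb B u)" by (simp add: nrm_nonneg)
  define d where "d = e / (C * nrm (comb B u) + 1)"
  have pos: "0 < C * nrm (comb B u) + 1" using C nn by (simp add: add_nonneg_pos)
  have d: "0 < d" using e pos by (simp add: d_def)
  define w where "w = (\<lambda>k. u k + of_real d * (if k \<in> B then u k else 0))"
  have wB: "w k = of_real (1 + d) * u k" if "k \<in> B" for k using that by (simp add: w_def algebra_simps)
  have lar: "A \<inter> large w ((1 + d) * t) = B"
  proof (intro equalityI subsetI)
    fix k assume k: "k \<in> A \<inter> large w ((1 + d) * t)"
    show "k \<in> B"
    proof (rule ccontr)
      assume "k \<notin> B"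
      then have "(1 + d) * t \<le> t" using k u by (auto simp: large_def w_def)
      then show False using d t by simp
    qed
  next
    fix k assume k: "k \<in> B"
    then have "norm (w k) = (1 + d) * t" using u[of k] A d unfolding wB[OF k] norm_mult norm_of_real by auto
    then show "k \<in> A \<inter> large w ((1 + d) * t)" using k A by (auto simp: large_def)
  qed
  have "nrm (comb B w) = (1 + d) * nrm (comb B u)"
  proof -
    have "comb B w = sc (of_real (1 + d)) (comb B u)"
      unfolding comb_scale[symmetric] by (rule comb_cong) (use wB in auto)
    then show ?thesis using d by (simp add: nrm_scale del: of_real_add)
  qed
  moreover have "nrm (comb B w) \<le> C * nrm (comb A w)"
    using C(2)[OF A(1), of "(1 + d) * t" w] d t unfolding lar by simp
  moreover have "nrm (comb A w) \<le> nrm (comb A u) + d * nrm (comb B u)"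
  proof -
    have "comb B (\<lambda>k. if k \<in> B then u k else 0) = comb A (\<lambda>k. if k \<in> B then u k else 0)"
      using A by (intro comb_restrict) auto
    moreover have "comb B (\<lambda>k. if k \<in> B then u k else 0) = comb B u" by (rule comb_cong) auto
    ultimately have "comb A w = comb A u + sc (of_real d) (comb B u)"
      unfolding w_def comb_add comb_scale by simp
    then show ?thesis using nrm_add[of "comb A u" "sc (of_real d) (comb B u)"] d
      by (simp add: scale_mem nrm_scale)
  qed
  ultimately have "(1 + d) * nrm (comb B u) \<le> C * (nrm (comb A u) + d * nrm (comb B u))"
    using C(1) mult_left_mono by (metis order_trans)
  moreover have "nrm (comb B u) \<le> (1 + d) * nrm (comb B u)" using d nn by (simp add: distrib_right)
  ultimately have "nrm (comb B u) \<le> C * nrm (comb A u) + d * (C * nrm (comb B u))" by (simp add: algebra_simps)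
  also have "d * (C * nrm (comb B u)) \<le> d * (C * nrm (comb B u) + 1)" using d by (intro mult_left_mono) auto
  also have "\<dots> = e" using pos by (simp add: d_def)
  finally show "nrm (comb B u) \<le> C * nrm (comb A u) + e" by simp
qed

text \<open>
  For finite combinations g, flatten the large coefficients to modulus t, pass to the subset A, and
  split A according to the signs. For general g, approximate by finite combinations with the same
  coefficients on A.
\<close>

theorem sign_combination_bounded:
  "\<exists>C\<ge>0. \<forall>g\<in>X. \<forall>A t \<eta>. finite A \<longrightarrow> 0 < t \<longrightarrow> (\<forall>k\<in>A. t \<le> norm (xs k g)) \<longrightarrow> (\<forall>k\<in>A. \<eta> k \<in> {-1, 1::real}) \<longrightarrow>
     t * nrm (comb A (\<lambda>k. of_real (\<eta> k) * sgn (xs k g))) \<le> C * nrm g"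
proof -
  obtain C where C: "0 \<le> C" "\<And>A a t. finite A \<Longrightarrow> 0 < t \<Longrightarrow> nrm (comb (A \<inter> large a t) a) \<le> C * nrm (comb A a)"
    using large_projection_bounded by blast
  have fin: "t * nrm (comb A (\<lambda>k. of_real (\<eta> k) * sgn (a k))) \<le> 4 * C\<^sup>2 * nrm (comb S a)"
    if S: "finite S" and AS: "A \<subseteq> S" and t: "0 < t" and A: "\<And>k. k \<in> A \<Longrightarrow> t \<le> norm (a k)"
      and eta: "\<And>k. k \<in> A \<Longrightarrow> \<eta> k \<in> {-1, 1::real}" for S A t a \<eta>
  proof -
    define n where "n = nrm (comb S a)"
    define u where "u = (\<lambda>k. of_real t * sgn (a k))"
    define L where "L = S \<inter> large a t"
    have L: "finite L" "A \<subseteq> L" using S AS A by (auto simp: L_def large_def)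
    have "comb L u = comb L (\<lambda>k. of_real t * sgn (a k) - a k) + comb L a"
      by (simp add: u_def flip: comb_add)
    then have "nrm (comb L u) \<le> nrm (comb L (\<lambda>k. of_real t * sgn (a k) - a k)) + nrm (comb L a)"
      by (simp add: nrm_add)
    also have "\<dots> \<le> C * n + C * n"
      unfolding L_def n_def using C(2)[OF S] t by (intro add_mono flattening_bounded[OF S]) auto
    finally have nL: "nrm (comb L u) \<le> 2 * C * n" by simp
    have nu: "norm (u k) = t" if "k \<in> L" for k
      using that t by (auto simp: u_def L_def large_def norm_mult norm_sgn)
    have sub: "nrm (comb B u) \<le> 2 * C\<^sup>2 * n" if "B \<subseteq> A" for B
    proof -
      have "nrm (comb B u) \<le> C * nrm (comb L u)"
        using subset_of_constant_coefficients[OF C L(1) _ t nu] that L(2) by auto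
      also have "\<dots> \<le> C * (2 * C * n)" using nL C(1) by (rule mult_left_mono)
      finally show ?thesis by (simp add: power2_eq_square mult_ac)
    qed
    define A1 A2 where "A1 = {k \<in> A. \<eta> k = 1}" and "A2 = {k \<in> A. \<eta> k = -1}"
    have finA: "finite A1" "finite A2" using L finite_subset[OF L(2,1)] by (auto simp: A1_def A2_def)
    have dec: "A = A1 \<union> A2" "A1 \<inter> A2 = {}" using eta by (auto simp: A1_def A2_def)
    have "t * nrm (comb A (\<lambda>k. of_real (\<eta> k) * sgn (a k))) = nrm (comb A (\<lambda>k. of_real t * (of_real (\<eta> k) * sgn (a k))))"
      using t unfolding comb_scale by (simp add: nrm_scale)
    also have "comb A (\<lambda>k. of_real t * (of_real (\<eta> k) * sgn (a k))) = comb A1 u - comb A2 u"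
    proof -
      have "comb A1 (\<lambda>k. of_real t * (of_real (\<eta> k) * sgn (a k))) = comb A1 u"
        by (rule comb_cong) (auto simp: A1_def u_def)
      moreover have "comb A2 (\<lambda>k. of_real t * (of_real (\<eta> k) * sgn (a k))) = comb A2 (\<lambda>k. (-1) * u k)"
        by (rule comb_cong) (auto simp: A2_def u_def)
      ultimately show ?thesis unfolding dec(1) comb_union[OF finA dec(2)] comb_scale
          by (simp add: scale_right_distrib)
    qed
    also have "nrm \<dots> \<le> nrm (comb A1 u) + nrm (comb A2 u)" by (simp add: nrm_diff)
    also have "\<dots> \<le> 2 * C\<^sup>2 * n + 2 * C\<^sup>2 * n" by (intro add_mono sub) (auto simp: A1_def A2_def)
    finally show ?thesis by (simp add: n_def)
  qed
  obtain B where B: "0 < B" "\<And>j. nrm (x j) \<le> B" using ex_basis_bound by blast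
  show ?thesis
  proof (intro exI[of _ "4 * C\<^sup>2"] conjI ballI allI impI)
    fix g A t \<eta>
    assume g: "g \<in> X" and A: "finite A" and t: "0 < t" and lower: "\<forall>k\<in>A. t \<le> norm (xs k g)"
      and eta: "\<forall>k\<in>A. \<eta> k \<in> {-1, 1::real}"
    show "t * nrm (comb A (\<lambda>k. of_real (\<eta> k) * sgn (xs k g))) \<le> 4 * C\<^sup>2 * nrm g"
    proof (rule field_le_epsilon)
      fix e :: real assume e: "0 < e"
      define Q where "Q = real (card A) * (kappa * B)"
      have Q: "0 \<le> Q" using kappa_pos B by (simp add: Q_def)
      define d where "d = e / (4 * C\<^sup>2 * (1 + Q) + 1)"
      have pos: "0 < 4 * C\<^sup>2 * (1 + Q) + 1" using Q by (simp add: add_nonneg_pos)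
      have d: "0 < d" using e pos by (simp add: d_def)
      obtain S a where S: "finite S" "nrm (g - comb S a) < d" using approx_comb[OF g d] .
      define h where "h = comb S a"
      have h: "h \<in> X" "nrm (g - h) < d" using S by (auto simp: h_def)
      \<comment> \<open>Correct the approximation so that its coefficients on A agree with those of g.\<close>
      define b where "b = (\<lambda>k. if k \<in> A then xs k g else if k \<in> S then a k else 0)"
      have corr: "comb (S \<union> A) b - h = comb A (\<lambda>k. xs k (g - h))"
      proof -
        have "comb (S \<union> A) b - h = comb (S \<union> A) b - comb (S \<union> A) (\<lambda>k. if k \<in> S then a k else 0)"
        proof -
          have "comb S (\<lambda>k. if k \<in> S then a k else 0) = comb (S \<union> A) (\<lambda>k. if k \<in> S then a k else 0)"
            using S A by (intro comb_restrict) auto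
          moreover have "comb S (\<lambda>k. if k \<in> S then a k else 0) = h" unfolding h_def by (rule comb_cong) auto
          ultimately show ?thesis by simp
        qed
        also have "\<dots> = comb (S \<union> A) (\<lambda>k. b k - (if k \<in> S then a k else 0))" by (simp add: comb_diff)
        also have "\<dots> = comb A (\<lambda>k. b k - (if k \<in> S then a k else 0))"
          using S A by (intro comb_restrict[symmetric]) (auto simp: b_def)
        also have "\<dots> = comb A (\<lambda>k. xs k (g - h))"
        proof (rule comb_cong[OF refl])
          have "xs k h = (if k \<in> S then a k else 0)" for k unfolding h_def by (rule coefficient_comb[OF S(1)])
          then show "b k - (if k \<in> S then a k else 0) = xs k (g - h)" if "k \<in> A" for k
            using that by (simp add: b_def dual_diff[OF xs_dual g h(1)])
        qed
        finally show ?thesis .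
      qed
      have "nrm (comb A (\<lambda>k. xs k (g - h))) \<le> real (card A) * (kappa * nrm (g - h) * B)"
        using coefficient_bound[OF diff_mem[OF g h(1)]] kappa_pos nrm_nonneg[OF diff_mem[OF g h(1)]] B
        by (intro nrm_comb_le) auto
      also have "\<dots> = Q * nrm (g - h)" by (simp add: Q_def)
      also have "\<dots> \<le> Q * d" using h Q by (intro mult_left_mono) auto
      finally have c: "nrm (comb (S \<union> A) b - h) \<le> Q * d" unfolding corr .
      have "nrm (comb (S \<union> A) b) \<le> nrm h + Q * d"
        using nrm_triangle[OF comb_mem h(1), of "S \<union> A" b] c by simp
      also have "nrm h \<le> nrm g + d" using nrm_triangle[OF h(1) g] h(2) nrm_diff_commute[OF h(1) g] by simp
      finally have nb: "nrm (comb (S \<union> A) b) \<le> nrm g + (1 + Q) * d" by (simp add: algebra_simps)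
      have "comb A (\<lambda>k. of_real (\<eta> k) * sgn (xs k g)) = comb A (\<lambda>k. of_real (\<eta> k) * sgn (b k))"
        by (rule comb_cong) (auto simp: b_def)
      then have "t * nrm (comb A (\<lambda>k. of_real (\<eta> k) * sgn (xs k g))) = t * nrm (comb A (\<lambda>k. of_real (\<eta> k) * sgn (b k)))"
        by simp
      also have "\<dots> \<le> 4 * C\<^sup>2 * nrm (comb (S \<union> A) b)"
        using S A lower eta t by (intro fin) (auto simp: b_def)
      also have "\<dots> \<le> 4 * C\<^sup>2 * (nrm g + (1 + Q) * d)" using nb by (intro mult_left_mono) auto
      also have "\<dots> = 4 * C\<^sup>2 * nrm g + 4 * C\<^sup>2 * (1 + Q) * d" by (simp add: algebra_simps)
      also have "4 * C\<^sup>2 * (1 + Q) * d \<le> (4 * C\<^sup>2 * (1 + Q) + 1) * d" using d by (intro mult_right_mono) auto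
      also have "\<dots> = e" using pos by (simp add: d_def)
      finally show "t * nrm (comb A (\<lambda>k. of_real (\<eta> k) * sgn (xs k g))) \<le> 4 * C\<^sup>2 * nrm g + e" by simp
    qed
  qed simp
qed

end

section \<open>Lebesgue spaces\<close>

text \<open>
  The closed half-line needs a separate argument where one of the points is zero.
\<close>

lemma powr_convex_nonneg:
  assumes "1 \<le> p" shows "convex_on {0..} (\<lambda>x::real. x powr p)"
proof (rule convex_onI)
  fix t x y :: real
  assume t: "0 < t" "t < 1" and xy: "x \<in> {0..}" "y \<in> {0..}"
  have scale: "(s * z) powr p \<le> s * z powr p" if "0 < s" "s < 1" "0 \<le> z" for s z :: real
  proof -
    have "s powr p \<le> s powr 1" using that assms by (intro powr_mono') auto
    then show ?thesis using that by (simp add: powr_mult mult_right_mono)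
  qed
  show "((1 - t) *\<^sub>R x + t *\<^sub>R y) powr p \<le> (1 - t) * x powr p + t * y powr p"
  proof (cases "x = 0 \<or> y = 0")
    case True
    then show ?thesis using scale[of "1 - t" x] scale[of t y] t xy assms by auto
  next
    case False
    then show ?thesis using convex_onD[OF powr_convex[OF assms], of t x y] t xy by auto
  qed
qed auto

lemma Lp_norm_nonneg: "0 \<le> Lp_norm p M f"
  by (simp add: Lp_norm_def)

lemma Lp_norm_powr:
  assumes "0 < p" shows "Lp_norm p M f powr p = (\<integral>t. norm (f t) powr p \<partial>M)"
  using assms by (simp add: Lp_norm_def powr_powr)

lemma Lp_norm_le_iff:
  assumes "0 < p" "0 \<le> c"
  shows "Lp_norm p M f \<le> c \<longleftrightarrow> (\<integral>t. norm (f t) powr p \<partial>M) \<le> c powr p"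
  using assms powr_mono2[of p "Lp_norm p M f" c] powr_less_mono2[of p c "Lp_norm p M f"]
  unfolding Lp_norm_powr[OF assms(1), symmetric] by (auto simp: Lp_norm_nonneg not_le[symmetric])

context
  fixes p :: real
  assumes p: "1 \<le> p"
begin

text \<open>
  Convexity of the p-th power applied to f / a and g / b. Strict bounds a and b on the norms, instead
  of the norms themselves, avoid division by zero.
\<close>

lemma Lp_add_aux:
  fixes f g :: "'a \<Rightarrow> 'k::{real_normed_field, second_countable_topology}"
  assumes f: "f \<in> Lp_space p M" and g: "g \<in> Lp_space p M"
    and a: "Lp_norm p M f < a" and b: "Lp_norm p M g < b"
  shows "integrable M (\<lambda>t. norm (f t + g t) powr p)"
    and "Lp_norm p M (\<lambda>t. f t + g t) \<le> a + b"
proof -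
  have ab: "0 < a" "0 < b" using a b Lp_norm_nonneg[of p M f] Lp_norm_nonneg[of p M g] by linarith+
  have [measurable]: "f \<in> borel_measurable M" "g \<in> borel_measurable M"
    and int: "integrable M (\<lambda>t. norm (f t) powr p)" "integrable M (\<lambda>t. norm (g t) powr p)"
    using f g by (auto simp: Lp_space_def)
  define l where "l = b / (a + b)"
  have l: "0 \<le> l" "l \<le> 1" using ab by (auto simp: l_def)
  have l1: "1 - l = a / (a + b)" using ab by (simp add: l_def field_simps)
  define h where "h = (\<lambda>t. (a + b) powr p * ((1 - l) * (norm (f t) powr p / a powr p) + l * (norm (g t) powr p / b powr p)))"
  have pt: "norm (f t + g t) powr p \<le> h t" for t
  proof -
    have "norm (f t + g t) powr p \<le> (norm (f t) + norm (g t)) powr p"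
      using p by (intro powr_mono2 norm_triangle_ineq) auto
    also have "norm (f t) + norm (g t) = (a + b) * ((1 - l) *\<^sub>R (norm (f t) / a) + l *\<^sub>R (norm (g t) / b))"
      using ab unfolding l1 by (simp add: l_def distrib_left)
    also have "\<dots> powr p = (a + b) powr p * ((1 - l) *\<^sub>R (norm (f t) / a) + l *\<^sub>R (norm (g t) / b)) powr p"
      by (rule powr_mult)
    also have "\<dots> \<le> (a + b) powr p * ((1 - l) * (norm (f t) / a) powr p + l * (norm (g t) / b) powr p)"
      using ab l by (intro mult_left_mono convex_onD[OF powr_convex_nonneg[OF p]]) auto
    also have "\<dots> = h t" using ab by (simp add: h_def powr_divide)
    finally show ?thesis .
  qed
  have hint: "integrable M h" unfolding h_def using int by auto
  show I: "integrable M (\<lambda>t. norm (f t + g t) powr p)"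
    by (rule Bochner_Integration.integrable_bound[OF hint]) (use pt in \<open>auto intro!: order_trans[OF pt]\<close>)
  have A: "(\<integral>t. norm (f t) powr p \<partial>M) \<le> a powr p" "(\<integral>t. norm (g t) powr p \<partial>M) \<le> b powr p"
    using a b ab p by (auto simp flip: Lp_norm_le_iff)
  have "(\<integral>t. norm (f t + g t) powr p \<partial>M) \<le> (\<integral>t. h t \<partial>M)"
    using I hint pt by (intro integral_mono) auto
  also have "\<dots> = (a + b) powr p * ((1 - l) * ((\<integral>t. norm (f t) powr p \<partial>M) / a powr p) + l * ((\<integral>t. norm (g t) powr p \<partial>M) / b powr p))"
    unfolding h_def using int by simp
  also have "\<dots> \<le> (a + b) powr p * ((1 - l) * 1 + l * 1)"
    using A ab l by (intro mult_left_mono add_mono) auto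
  finally show "Lp_norm p M (\<lambda>t. f t + g t) \<le> a + b"
    using ab p by (subst Lp_norm_le_iff) auto
qed

lemma Lp_space_add:
  fixes f g :: "'a \<Rightarrow> 'k::{real_normed_field, second_countable_topology}"
  shows "f \<in> Lp_space p M \<Longrightarrow> g \<in> Lp_space p M \<Longrightarrow> (\<lambda>t. f t + g t) \<in> Lp_space p M"
  using Lp_add_aux(1)[of f M g "Lp_norm p M f + 1" "Lp_norm p M g + 1"] by (auto simp: Lp_space_def)

lemma Lp_norm_triangle:
  fixes f g :: "'a \<Rightarrow> 'k::{real_normed_field, second_countable_topology}"
  assumes "f \<in> Lp_space p M" "g \<in> Lp_space p M"
  shows "Lp_norm p M (\<lambda>t. f t + g t) \<le> Lp_norm p M f + Lp_norm p M g"
proof (rule field_le_epsilon)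
  fix e :: real assume "0 < e"
  then show "Lp_norm p M (\<lambda>t. f t + g t) \<le> Lp_norm p M f + Lp_norm p M g + e"
    using Lp_add_aux(2)[OF assms, of "Lp_norm p M f + e / 2" "Lp_norm p M g + e / 2"] by simp
qed

lemma Lp_norm_scale: "Lp_norm p M (\<lambda>t. c * f t) = norm c * Lp_norm p M f"
  using p by (simp add: Lp_norm_def norm_mult powr_mult powr_powr)

lemma Lp_space_scale:
  fixes f :: "'a \<Rightarrow> 'k::{real_normed_field, second_countable_topology}"
  shows "f \<in> Lp_space p M \<Longrightarrow> (\<lambda>t. c * f t) \<in> Lp_space p M"
  by (auto simp: Lp_space_def norm_mult powr_mult)

lemma seminormed_space_Lp:
  "seminormed_space (fun_scale :: 'k::{real_normed_field, second_countable_topology} \<Rightarrow> ('a \<Rightarrow> 'k) \<Rightarrow> 'a \<Rightarrow> 'k) (Lp_space p M) (Lp_norm p M)"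
proof
  show "0 \<in> Lp_space p M" by (simp add: Lp_space_def zero_fun_def)
qed (auto simp: plus_fun_def fun_scale_def Lp_space_add Lp_norm_triangle Lp_norm_scale Lp_space_scale
     vector_space_fun_scale algebra_simps)

lemma nn_integral_Lp:
  assumes "f \<in> Lp_space p M"
  shows "(\<integral>\<^sup>+t. ennreal (norm (f t) powr p) \<partial>M) = ennreal (Lp_norm p M f powr p)"
  using assms p by (subst nn_integral_eq_integral) (auto simp: Lp_space_def Lp_norm_powr)

lemma Lp_spaceI:
  assumes "f \<in> borel_measurable M" "0 \<le> c" "(\<integral>\<^sup>+t. ennreal (norm (f t) powr p) \<partial>M) \<le> ennreal (c powr p)"
  shows "f \<in> Lp_space p M" "Lp_norm p M f \<le> c"
proof -
  have "(\<integral>\<^sup>+t. ennreal (norm (f t) powr p) \<partial>M) < \<infinity>"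
    using assms(3) by (rule order_le_less_trans) simp
  then show m: "f \<in> Lp_space p M"
    using assms(1) by (auto simp: Lp_space_def intro!: integrableI_nonneg)
  show "Lp_norm p M f \<le> c"
    using assms(2,3) p unfolding nn_integral_Lp[OF m]
    by (simp add: Lp_norm_powr Lp_norm_le_iff)
qed

text \<open>
  The Riesz--Fischer argument: the series of absolute values converges almost everywhere by monotone
  convergence, and Fatou's lemma bounds the tails of the series by the tails of the norms.
\<close>

lemma complete_seminormed_space_Lp:
  "complete_seminormed_space (fun_scale :: 'k::{real_normed_field, banach, second_countable_topology} \<Rightarrow> ('a \<Rightarrow> 'k) \<Rightarrow> 'a \<Rightarrow> 'k) (Lp_space p M) (Lp_norm p M)"
proof -
  interpret seminormed_space "fun_scale :: 'k \<Rightarrow> ('a \<Rightarrow> 'k) \<Rightarrow> 'a \<Rightarrow> 'k" "Lp_space p M" "Lp_norm p M"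
    by (rule seminormed_space_Lp)
  show ?thesis
  proof
    fix f :: "nat \<Rightarrow> 'a \<Rightarrow> 'k"
    assume f: "\<And>j. f j \<in> Lp_space p M" and sm: "summable (\<lambda>j. Lp_norm p M (f j))"
    have [measurable]: "f j \<in> borel_measurable M" for j using f[of j] by (simp add: Lp_space_def)
    define F where "F = (\<lambda>t. \<Sum>j. f j t)"
    have [measurable]: "F \<in> borel_measurable M" unfolding F_def by measurable
    define T where "T = (\<lambda>n. \<Sum>j. Lp_norm p M (f (j + n)))"
    have T0: "T \<longlonglongrightarrow> 0" unfolding T_def by (rule suminf_exist_split2[OF sm])
    have partial: "(\<Sum>j=n..<m. Lp_norm p M (f j)) \<le> T n" if "n \<le> m" for n m
    proof -
      have "(\<Sum>j=n..<m. Lp_norm p M (f j)) = (\<Sum>j<m-n. Lp_norm p M (f (j + n)))"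
        using sum.shift_bounds_nat_ivl[of "\<lambda>j. Lp_norm p M (f j)" 0 n "m - n"] that
        by (simp add: atLeast0LessThan)
      also have "\<dots> \<le> T n" unfolding T_def
        using sm by (intro sum_le_suminf) (auto simp: Lp_norm_nonneg intro: summable_ignore_initial_segment)
      finally show ?thesis .
    qed
    have Tnn: "0 \<le> T n" for n using partial[of n n] by simp
    \<comment> \<open>The partial sums of the absolute values are bounded in norm, so they converge almost everywhere.\<close>
    define G where "G = (\<lambda>n t. \<Sum>j<n. norm (f j t))"
    have nG: "(\<integral>\<^sup>+t. ennreal (G n t powr p) \<partial>M) \<le> ennreal (T 0 powr p)" for n
    proof -
      define g where "g = (\<lambda>j t. of_real (norm (f j t)) :: 'k)"
      have g: "g j \<in> Lp_space p M" "Lp_norm p M (g j) = Lp_norm p M (f j)" for j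
        using f[of j] by (auto simp: Lp_space_def g_def Lp_norm_def)
      have mem: "(\<Sum>j<n. g j) \<in> Lp_space p M" by (intro sum_mem g)
      have "Lp_norm p M (\<Sum>j<n. g j) \<le> (\<Sum>j<n. Lp_norm p M (g j))" by (intro nrm_sum g)
      also have "\<dots> \<le> T 0" using partial[of 0 n] by (simp add: g atLeast0LessThan)
      finally have "Lp_norm p M (\<Sum>j<n. g j) powr p \<le> T 0 powr p"
        using p by (intro powr_mono2) (auto simp: Lp_norm_nonneg)
      moreover have "norm ((\<Sum>j<n. g j) t) = G n t" for t
      proof -
        have "(\<Sum>j<n. g j) t = of_real (G n t)" by (induction n) (auto simp: g_def G_def)
        then show ?thesis using sum_nonneg[of "{..<n}" "\<lambda>j. norm (f j t)"] by (simp only: norm_of_real) (simp add: G_def)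
      qed
      ultimately show ?thesis using nn_integral_Lp[OF mem] by (simp add: ennreal_leI)
    qed
    have Gnn: "0 \<le> G n t" for n t by (simp add: G_def sum_nonneg)
    have Ginc: "G n t \<le> G m t" if "n \<le> m" for n m t
      unfolding G_def using that by (intro sum_mono2) auto
    have inc: "incseq (\<lambda>n t. ennreal (G n t powr p))"
      using Ginc Gnn p by (intro incseq_SucI le_funI ennreal_leI powr_mono2) auto
    have "(\<integral>\<^sup>+t. (SUP n. ennreal (G n t powr p)) \<partial>M) = (SUP n. \<integral>\<^sup>+t. ennreal (G n t powr p) \<partial>M)"
      using inc by (intro nn_integral_monotone_convergence_SUP) (auto simp: G_def)
    also have "\<dots> \<le> ennreal (T 0 powr p)" by (intro SUP_least nG)
    finally have "(\<integral>\<^sup>+t. (SUP n. ennreal (G n t powr p)) \<partial>M) \<noteq> \<infinity>" by (auto simp: top_unique)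
    then have "AE t in M. (SUP n. ennreal (G n t powr p)) \<noteq> \<infinity>"
      by (intro nn_integral_PInf_AE) (auto simp: G_def)
    then have AEsum: "AE t in M. summable (\<lambda>j. f j t)"
    proof eventually_elim
      case (elim t)
      define s where "s = enn2real (SUP n. ennreal (G n t powr p))"
      have "G n t \<le> s powr (1 / p)" for n
      proof -
        have "ennreal (G n t powr p) \<le> (SUP n. ennreal (G n t powr p))" by (rule SUP_upper) simp
        also have "\<dots> = ennreal s" using elim unfolding s_def
          by (intro ennreal_enn2real[symmetric]) (simp only: less_top[symmetric] infinity_ennreal_def not_False_eq_True)
        finally have "G n t powr p \<le> s" by (simp add: s_def)
        then have "(G n t powr p) powr (1 / p) \<le> s powr (1 / p)" using p by (intro powr_mono2) auto
        then show ?thesis using p Gnn by (simp add: powr_powr)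
      qed
      then have "(\<Sum>j\<le>n. norm (f j t)) \<le> s powr (1 / p)" for n
        unfolding G_def lessThan_Suc_atMost[symmetric] .
      then have "summable (\<lambda>j. norm (f j t))" by (intro bounded_imp_summable) auto
      then show ?case by (rule summable_norm_cancel)
    qed
    have tail: "F - (\<Sum>j<n. f j) \<in> Lp_space p M \<and> Lp_norm p M (F - (\<Sum>j<n. f j)) \<le> T n" for n
    proof -
      define S where "S = (\<lambda>m. \<Sum>j=n..<m. f j)"
      have Sapp: "S m t = (\<Sum>j=n..<m. f j t)" for m t
        unfolding S_def by (induction m) auto
      have app: "(\<Sum>j<n. f j) t = (\<Sum>j<n. f j t)" for t by (induction n) auto
      have Sm: "S m \<in> Lp_space p M" for m unfolding S_def by (intro sum_mem f)
      have [measurable]: "(\<Sum>j<n. f j) \<in> borel_measurable M" unfolding app[abs_def, symmetric]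
        using sum_mem[of "{..<n}" f] f by (simp add: Lp_space_def)
      have bound: "(\<integral>\<^sup>+t. ennreal (norm (S m t) powr p) \<partial>M) \<le> ennreal (T n powr p)" for m
      proof -
        have "Lp_norm p M (S m) \<le> (\<Sum>j=n..<m. Lp_norm p M (f j))" unfolding S_def by (intro nrm_sum f)
        also have "\<dots> \<le> T n" using partial[of n m] Tnn[of n] by (cases "n \<le> m") auto
        finally have "Lp_norm p M (S m) powr p \<le> T n powr p"
          using p by (intro powr_mono2) (auto simp: Lp_norm_nonneg)
        then show ?thesis unfolding nn_integral_Lp[OF Sm] by (rule ennreal_leI)
      qed
      have AElim: "AE t in M. ennreal (norm ((F - (\<Sum>j<n. f j)) t) powr p) = liminf (\<lambda>m. ennreal (norm (S m t) powr p))"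
        using AEsum
      proof eventually_elim
        case (elim t)
        have "(\<lambda>m. (\<Sum>j<m. f j t) - (\<Sum>j<n. f j t)) \<longlonglongrightarrow> F t - (\<Sum>j<n. f j t)"
          unfolding F_def by (intro tendsto_diff summable_LIMSEQ elim tendsto_const)
        moreover have "eventually (\<lambda>m. (\<Sum>j<m. f j t) - (\<Sum>j<n. f j t) = S m t) sequentially"
          using eventually_ge_at_top[of n]
        proof eventually_elim
          case (elim m)
          have "(\<Sum>j<m. f j t) = (\<Sum>j<n. f j t) + (\<Sum>j=n..<m. f j t)"
            using sum.atLeastLessThan_concat[of 0 n m "\<lambda>j. f j t"] elim by (simp add: atLeast0LessThan)
          then show ?case by (simp add: Sapp)
        qed
        ultimately have "(\<lambda>m. S m t) \<longlonglongrightarrow> F t - (\<Sum>j<n. f j t)"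
          by (rule Lim_transform_eventually)
        then have "(\<lambda>m. S m t) \<longlonglongrightarrow> (F - (\<Sum>j<n. f j)) t" by (simp add: app)
        then have "(\<lambda>m. ennreal (norm (S m t) powr p)) \<longlonglongrightarrow> ennreal (norm ((F - (\<Sum>j<n. f j)) t) powr p)"
          using p by (intro tendsto_ennrealI tendsto_powr' tendsto_norm tendsto_const) auto
        then show ?case by (intro lim_imp_Liminf[symmetric]) auto
      qed
      have "(\<integral>\<^sup>+t. ennreal (norm ((F - (\<Sum>j<n. f j)) t) powr p) \<partial>M)
          = (\<integral>\<^sup>+t. liminf (\<lambda>m. ennreal (norm (S m t) powr p)) \<partial>M)"
        by (rule nn_integral_cong_AE[OF AElim])
      also have "\<dots> \<le> liminf (\<lambda>m. \<integral>\<^sup>+t. ennreal (norm (S m t) powr p) \<partial>M)"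
        using Sm by (intro nn_integral_liminf) (auto simp: Lp_space_def)
      also have "\<dots> \<le> liminf (\<lambda>m::nat. ennreal (T n powr p))"
        by (intro Liminf_mono always_eventually allI bound)
      also have "\<dots> = ennreal (T n powr p)" by (simp add: Liminf_const)
      finally have le: "(\<integral>\<^sup>+t. ennreal (norm ((F - (\<Sum>j<n. f j)) t) powr p) \<partial>M) \<le> ennreal (T n powr p)" .
      have "F - (\<Sum>j<n. f j) \<in> borel_measurable M" unfolding fun_diff_def by measurable
      then show ?thesis using Lp_spaceI[OF _ Tnn le] by (simp only:)
    qed
    have "F \<in> Lp_space p M" using tail[of 0] by simp
    moreover have "(\<lambda>n. Lp_norm p M (F - (\<Sum>j<n. f j))) \<longlonglongrightarrow> 0"
      by (rule tendsto_sandwich[OF _ _ tendsto_const T0]) (use tail in \<open>auto simp: Lp_norm_nonneg\<close>)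
    ultimately show "\<exists>F\<in>Lp_space p M. (\<lambda>n. Lp_norm p M (F - (\<Sum>j<n. f j))) \<longlonglongrightarrow> 0" by blast
  qed
qed

end

section \<open>Averages over signs\<close>

text \<open>
  The sign of the k-th term is positive if and only if k belongs to B; averages over all choices of
  signs are averages over the subsets B of A.
\<close>

definition signed_sum :: "nat set \<Rightarrow> nat set \<Rightarrow> (nat \<Rightarrow> real) \<Rightarrow> real" where
  "signed_sum A B b = (\<Sum>k\<in>A. (if k \<in> B then 1 else -1) * b k)"

lemma sum_over_signs_insert:
  assumes "finite A" "i \<notin> A"
  shows "(\<Sum>B\<in>Pow (insert i A). F (signed_sum (insert i A) B b) :: real)
     = (\<Sum>B\<in>Pow A. F (b i + signed_sum A B b) + F (- b i + signed_sum A B b))"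
proof -
  have s1: "signed_sum (insert i A) B b = - b i + signed_sum A B b"
    and s2: "signed_sum (insert i A) (insert i B) b = b i + signed_sum A B b" if "B \<in> Pow A" for B
  proof -
    have iB: "i \<notin> B" using that assms by auto
    show "signed_sum (insert i A) B b = - b i + signed_sum A B b"
      using assms iB by (simp add: signed_sum_def)
    have "(\<Sum>k\<in>A. (if k \<in> insert i B then 1 else -1) * b k) = (\<Sum>k\<in>A. (if k \<in> B then 1 else -1) * b k)"
      using assms by (intro sum.cong) auto
    then show "signed_sum (insert i A) (insert i B) b = b i + signed_sum A B b"
      using assms by (simp add: signed_sum_def)
  qed
  have "(\<Sum>B\<in>Pow (insert i A). F (signed_sum (insert i A) B b))
     = (\<Sum>B\<in>Pow A. F (signed_sum (insert i A) B b)) + (\<Sum>B\<in>insert i ` Pow A. F (signed_sum (insert i A) B b))"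
    unfolding Pow_insert using assms by (intro sum.union_disjoint) auto
  also have "(\<Sum>B\<in>insert i ` Pow A. F (signed_sum (insert i A) B b)) = (\<Sum>B\<in>Pow A. F (signed_sum (insert i A) (insert i B) b))"
  proof -
    have "inj_on (insert i) (Pow A)"
      by (rule inj_onI) (use assms in \<open>metis PowD insert_ident subsetD\<close>)
    then show ?thesis by (simp add: sum.reindex)
  qed
  finally show ?thesis by (simp add: s1 s2 sum.distrib add.commute)
qed

lemma sum_signs_square:
  assumes "finite A"
  shows "(\<Sum>B\<in>Pow A. (signed_sum A B b)\<^sup>2) = 2 ^ card A * (\<Sum>k\<in>A. (b k)\<^sup>2)"
  using assms
proof (induction A rule: finite_induct)
  case (insert i A)
  have "(\<Sum>B\<in>Pow (insert i A). (signed_sum (insert i A) B b)\<^sup>2) = (\<Sum>B\<in>Pow A. 2 * (b i)\<^sup>2 + 2 * (signed_sum A B b)\<^sup>2)"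
    unfolding sum_over_signs_insert[OF insert.hyps, where F = "\<lambda>s. s\<^sup>2"]
    by (intro sum.cong) (auto simp: power2_eq_square algebra_simps)
  then show ?case using insert by (simp add: sum.distrib card_Pow algebra_simps flip: sum_distrib_left)
qed (simp add: signed_sum_def)

lemma sum_signs_fourth:
  assumes "finite A"
  shows "(\<Sum>B\<in>Pow A. (signed_sum A B b) ^ 4) \<le> 3 * 2 ^ card A * (\<Sum>k\<in>A. (b k)\<^sup>2)\<^sup>2"
  using assms
proof (induction A rule: finite_induct)
  case (insert i A)
  define q where "q = (\<Sum>k\<in>A. (b k)\<^sup>2)"
  have "(\<Sum>B\<in>Pow (insert i A). (signed_sum (insert i A) B b) ^ 4)
     = (\<Sum>B\<in>Pow A. 2 * (signed_sum A B b) ^ 4 + 12 * (b i)\<^sup>2 * (signed_sum A B b)\<^sup>2 + 2 * (b i) ^ 4)"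
    unfolding sum_over_signs_insert[OF insert.hyps, where F = "\<lambda>s. s ^ 4"]
    by (intro sum.cong) (auto simp: power2_eq_square power4_eq_xxxx algebra_simps)
  also have "\<dots> = 2 * (\<Sum>B\<in>Pow A. (signed_sum A B b) ^ 4) + 12 * (b i)\<^sup>2 * (2 ^ card A * q) + 2 ^ card A * (2 * (b i) ^ 4)"
    using insert.hyps by (simp add: sum.distrib card_Pow q_def sum_signs_square flip: sum_distrib_left)
  also have "\<dots> \<le> 2 * (3 * 2 ^ card A * q\<^sup>2) + 12 * (b i)\<^sup>2 * (2 ^ card A * q) + 2 ^ card A * (6 * (b i) ^ 4)"
    using insert.IH by (intro add_mono mult_left_mono) (auto simp: q_def)
  also have "\<dots> = 3 * 2 ^ card (insert i A) * (\<Sum>k\<in>insert i A. (b k)\<^sup>2)\<^sup>2"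
  proof -
    have sq: "(\<Sum>k\<in>insert i A. (b k)\<^sup>2) = (b i)\<^sup>2 + q" using insert.hyps by (simp add: q_def)
    show ?thesis unfolding sq using insert.hyps by (simp add: power2_eq_square power4_eq_xxxx algebra_simps)
  qed
  finally show ?case .
qed (simp add: signed_sum_def)

text \<open>
  The function cosh x exp(- x^2 / 2) decreases for x \<ge> 0, since sinh x \<le> x cosh x.
\<close>

lemma cosh_le_exp_square: "cosh x \<le> exp (x\<^sup>2 / 2)" for x :: real
proof -
  have pos: "cosh x \<le> exp (x\<^sup>2 / 2)" if x: "0 \<le> x" for x :: real
  proof -
    have s: "sinh y - y * cosh y \<le> 0" if "0 \<le> y" for y :: real
    proof -
      have "sinh y - y * cosh y \<le> sinh 0 - 0 * cosh (0::real)"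
      proof (rule DERIV_nonpos_imp_nonincreasing[OF that])
        fix t :: real assume t: "0 \<le> t" "t \<le> y"
        have "((\<lambda>y. sinh y - y * cosh y) has_real_derivative - t * sinh t) (at t)"
          by (auto intro!: derivative_eq_intros)
        then show "\<exists>d. ((\<lambda>y. sinh y - y * cosh y) has_real_derivative d) (at t) \<and> d \<le> 0"
          using t by (intro exI[of _ "- t * sinh t"]) auto
      qed
      then show ?thesis by simp
    qed
    have "cosh x * exp (- x\<^sup>2 / 2) \<le> cosh 0 * exp (- 0\<^sup>2 / 2)"
    proof (rule DERIV_nonpos_imp_nonincreasing[OF x])
      fix t :: real assume t: "0 \<le> t" "t \<le> x"
      have "((\<lambda>x. cosh x * exp (- x\<^sup>2 / 2)) has_real_derivative (sinh t - t * cosh t) * exp (- t\<^sup>2 / 2)) (at t)"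
        by (auto intro!: derivative_eq_intros simp: algebra_simps)
      then show "\<exists>d. ((\<lambda>x. cosh x * exp (- x\<^sup>2 / 2)) has_real_derivative d) (at t) \<and> d \<le> 0"
        using s[OF t(1)] by (intro exI[of _ "(sinh t - t * cosh t) * exp (- t\<^sup>2 / 2)"]) (auto intro: mult_nonpos_nonneg)
    qed
    then show ?thesis by (simp add: exp_minus field_simps)
  qed
  show ?thesis using pos[of "\<bar>x\<bar>"] by (cases "0 \<le> x") auto
qed

lemma sum_signs_exp:
  assumes "finite A"
  shows "(\<Sum>B\<in>Pow A. exp (signed_sum A B b)) \<le> 2 ^ card A * exp ((\<Sum>k\<in>A. (b k)\<^sup>2) / 2)"
  using assms
proof (induction A rule: finite_induct)
  case (insert i A)
  have "(\<Sum>B\<in>Pow (insert i A). exp (signed_sum (insert i A) B b)) = 2 * cosh (b i) * (\<Sum>B\<in>Pow A. exp (signed_sum A B b))"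
    unfolding sum_over_signs_insert[OF insert.hyps, where F = exp] sum_distrib_left
    by (intro sum.cong) (auto simp: cosh_field_def exp_add exp_diff exp_minus field_simps)
  also have "\<dots> \<le> 2 * exp ((b i)\<^sup>2 / 2) * (2 ^ card A * exp ((\<Sum>k\<in>A. (b k)\<^sup>2) / 2))"
    using insert.IH cosh_le_exp_square[of "b i"] by (intro mult_mono) (auto intro!: sum_nonneg)
  also have "\<dots> = 2 ^ card (insert i A) * exp ((\<Sum>k\<in>insert i A. (b k)\<^sup>2) / 2)"
    using insert.hyps by (simp add: add_divide_distrib exp_add)
  finally show ?case .
qed (simp add: signed_sum_def)

lemma signed_sum_scale: "signed_sum A B (\<lambda>k. c * b k) = c * signed_sum A B b"
  by (simp add: signed_sum_def sum_distrib_left algebra_simps)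

text \<open>
  After normalizing the sum of squares to 1, the exponential moment of the signed sums is bounded, and
  it dominates every power.
\<close>

lemma khintchine_upper:
  assumes "0 < (p::real)"
  shows "\<exists>C>0. \<forall>A b. finite A \<longrightarrow>
    (\<Sum>B\<in>Pow A. \<bar>signed_sum A B b\<bar> powr p) \<le> C * 2 ^ card A * (\<Sum>k\<in>A. (b k)\<^sup>2) powr (p / 2)"
proof -
  obtain m :: nat where m: "p \<le> real m" using real_arch_simple by blast
  define C where "C = (1 + fact m :: real)"
  have C: "C > 0" by (simp add: C_def add_pos_pos)
  have pt: "\<bar>s\<bar> powr p \<le> C * (exp s + exp (- s))" for s :: real
  proof (cases "\<bar>s\<bar> \<le> 1")
    case True
    have "\<bar>s\<bar> powr p \<le> 1 powr p" using True assms by (intro powr_mono2) auto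
    also have "\<dots> \<le> C * 1" by (simp add: C_def)
    also have "\<dots> \<le> C * (exp s + exp (- s))"
      using C by (intro mult_left_mono) (cases "0 \<le> s", auto intro: add_increasing add_increasing2)
    finally show ?thesis .
  next
    case False
    have "\<bar>s\<bar> powr p \<le> \<bar>s\<bar> powr real m" using False m by (intro powr_mono) auto
    also have "\<dots> = \<bar>s\<bar> ^ m" using False by (subst powr_realpow) auto
    also have "\<dots> \<le> fact m * exp \<bar>s\<bar>"
    proof -
      have "\<bar>s\<bar> ^ m / fact m = (\<Sum>n\<in>{m}. \<bar>s\<bar> ^ n / fact n)" by simp
      also have "\<dots> \<le> (\<Sum>n. \<bar>s\<bar> ^ n / fact n)"
        using summable_exp[of "\<bar>s\<bar>"] by (intro sum_le_suminf) (auto simp: divide_inverse mult.commute)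
      also have "\<dots> = exp \<bar>s\<bar>" by (simp add: exp_def divide_inverse mult.commute)
      finally show ?thesis by (simp add: field_simps)
    qed
    also have "\<dots> \<le> C * (exp s + exp (- s))"
      by (intro mult_mono) (auto simp: C_def abs_if)
    finally show ?thesis .
  qed
  have "(\<Sum>B\<in>Pow A. \<bar>signed_sum A B b\<bar> powr p) \<le> (2 * C * exp (1 / 2)) * 2 ^ card A * (\<Sum>k\<in>A. (b k)\<^sup>2) powr (p / 2)"
    if A: "finite A" for A b
  proof -
    define q where "q = (\<Sum>k\<in>A. (b k)\<^sup>2)"
    have q: "0 \<le> q" by (simp add: q_def sum_nonneg)
    show ?thesis
    proof (cases "q = 0")
      case True
      then have "b k = 0" if "k \<in> A" for k using that A by (auto simp: q_def sum_nonneg_eq_0_iff)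
      then show ?thesis using assms by (simp add: signed_sum_def)
    next
      case False
      define r where "r = sqrt q"
      have r: "0 < r" "r\<^sup>2 = q" using False q by (auto simp: r_def)
      define d where "d = (\<lambda>k. b k / r)"
      have d1: "(\<Sum>k\<in>A. (d k)\<^sup>2) = 1"
        using r False by (simp add: d_def power_divide q_def[symmetric] flip: sum_divide_distrib)
      have neg: "- signed_sum A B d = signed_sum A B (\<lambda>k. - d k)" for B
        by (simp add: signed_sum_def sum_negf)
      have "(\<Sum>B\<in>Pow A. \<bar>signed_sum A B d\<bar> powr p) \<le> (\<Sum>B\<in>Pow A. C * (exp (signed_sum A B d) + exp (signed_sum A B (\<lambda>k. - d k))))"
        unfolding neg[symmetric] by (intro sum_mono pt)
      also have "\<dots> = C * ((\<Sum>B\<in>Pow A. exp (signed_sum A B d)) + (\<Sum>B\<in>Pow A. exp (signed_sum A B (\<lambda>k. - d k))))"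
        by (simp add: sum.distrib flip: sum_distrib_left)
      also have "\<dots> \<le> C * (2 ^ card A * exp (1 / 2) + 2 ^ card A * exp (1 / 2))"
        using sum_signs_exp[OF A, of d] sum_signs_exp[OF A, of "\<lambda>k. - d k"] C d1
        by (intro mult_left_mono add_mono) auto
      finally have n: "(\<Sum>B\<in>Pow A. \<bar>signed_sum A B d\<bar> powr p) \<le> 2 * C * exp (1 / 2) * 2 ^ card A" by (simp add: mult_ac)
      have b: "b = (\<lambda>k. r * d k)" using r by (auto simp: d_def)
      have "(\<Sum>B\<in>Pow A. \<bar>signed_sum A B b\<bar> powr p) = r powr p * (\<Sum>B\<in>Pow A. \<bar>signed_sum A B d\<bar> powr p)"
        using r by (subst b) (simp add: signed_sum_scale abs_mult powr_mult sum_distrib_left)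
      also have "\<dots> \<le> r powr p * (2 * C * exp (1 / 2) * 2 ^ card A)" using n by (intro mult_left_mono) auto
      also have "r powr p = q powr (p / 2)" using r(1) by (simp add: powr_powr flip: r(2) powr_numeral)
      finally show ?thesis by (simp add: q_def mult_ac)
    qed
  qed
  then show ?thesis using C by (intro exI[of _ "2 * C * exp (1 / 2)"]) auto
qed

text \<open>
  After normalizing, the second moment is 1 and the fourth at most 3. Where |s| \<le> 2,
  the power |s|^p is at least 2^(p - 2) s^2, and s^2 - s^4 / 4 is negative elsewhere; so the
  p-th moment is at least 2^(p - 2) (1 - 3/4).
\<close>

lemma khintchine_lower:
  assumes p: "0 < (p::real)" "p \<le> 2" and A: "finite A"
  shows "2 powr (p - 2) / 4 * 2 ^ card A * (\<Sum>k\<in>A. (b k)\<^sup>2) powr (p / 2) \<le> (\<Sum>B\<in>Pow A. \<bar>signed_sum A B b\<bar> powr p)"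
proof -
  define q where "q = (\<Sum>k\<in>A. (b k)\<^sup>2)"
  have q: "0 \<le> q" by (simp add: q_def sum_nonneg)
  have pt: "2 powr (p - 2) * (s\<^sup>2 - s ^ 4 / 4) \<le> \<bar>s\<bar> powr p" for s :: real
  proof (cases "s = 0 \<or> 2 < \<bar>s\<bar>")
    case True
    have "s\<^sup>2 - s ^ 4 / 4 \<le> 0" if "2 < \<bar>s\<bar>"
    proof -
      have "2\<^sup>2 \<le> \<bar>s\<bar>\<^sup>2" using that by (intro power_mono) auto
      then have "s\<^sup>2 * 4 \<le> s\<^sup>2 * s\<^sup>2" by (intro mult_left_mono) auto
      then show ?thesis by (simp add: power4_eq_xxxx power2_eq_square)
    qed
    then have "2 powr (p - 2) * (s\<^sup>2 - s ^ 4 / 4) \<le> 0" using True by (auto intro: mult_nonneg_nonpos)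
    then show ?thesis by (rule order_trans) simp
  next
    case False
    have "2 powr (p - 2) * (s\<^sup>2 - s ^ 4 / 4) \<le> 2 powr (p - 2) * s\<^sup>2"
      by (intro mult_left_mono) auto
    also have "\<dots> \<le> \<bar>s\<bar> powr (p - 2) * s\<^sup>2"
      using False p by (intro mult_right_mono powr_mono2') auto
    also have "\<bar>s\<bar> powr (p - 2) * s\<^sup>2 = \<bar>s\<bar> powr (p - 2) * \<bar>s\<bar> powr 2" using False by simp
    also have "\<bar>s\<bar> powr (p - 2) * \<bar>s\<bar> powr 2 = \<bar>s\<bar> powr p"
      by (simp only: powr_add[symmetric]) simp
    finally show ?thesis .
  qed
  show ?thesis
  proof (cases "q = 0")
    case False
    define r where "r = sqrt q"
    have r: "0 < r" "r\<^sup>2 = q" using False q by (auto simp: r_def)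
    define d where "d = (\<lambda>k. b k / r)"
    have d1: "(\<Sum>k\<in>A. (d k)\<^sup>2) = 1"
      using r False by (simp add: d_def power_divide q_def[symmetric] flip: sum_divide_distrib)
    have "2 powr (p - 2) / 4 * 2 ^ card A = 2 powr (p - 2) * (2 ^ card A * 1 - (3 * 2 ^ card A * 1\<^sup>2) / 4)"
      by simp
    also have "\<dots> \<le> 2 powr (p - 2) * ((\<Sum>B\<in>Pow A. (signed_sum A B d)\<^sup>2) - (\<Sum>B\<in>Pow A. (signed_sum A B d) ^ 4) / 4)"
      using sum_signs_square[OF A, of d] sum_signs_fourth[OF A, of d] d1
      by (intro mult_left_mono diff_mono divide_right_mono) auto
    also have "\<dots> = (\<Sum>B\<in>Pow A. 2 powr (p - 2) * ((signed_sum A B d)\<^sup>2 - (signed_sum A B d) ^ 4 / 4))"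
      by (simp add: sum_subtractf sum_divide_distrib flip: sum_distrib_left)
    also have "\<dots> \<le> (\<Sum>B\<in>Pow A. \<bar>signed_sum A B d\<bar> powr p)" by (intro sum_mono pt)
    finally have n: "2 powr (p - 2) / 4 * 2 ^ card A \<le> (\<Sum>B\<in>Pow A. \<bar>signed_sum A B d\<bar> powr p)" .
    have b: "b = (\<lambda>k. r * d k)" using r by (auto simp: d_def)
    have "q powr (p / 2) = r powr p" using r(1) by (simp add: powr_powr flip: r(2) powr_numeral)
    then have "2 powr (p - 2) / 4 * 2 ^ card A * q powr (p / 2) = r powr p * (2 powr (p - 2) / 4 * 2 ^ card A)"
      by simp
    also have "\<dots> \<le> r powr p * (\<Sum>B\<in>Pow A. \<bar>signed_sum A B d\<bar> powr p)"
      using n by (rule mult_left_mono) simp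
    also have "\<dots> = (\<Sum>B\<in>Pow A. \<bar>signed_sum A B b\<bar> powr p)"
      using r by (subst b) (simp add: signed_sum_scale abs_mult powr_mult sum_distrib_left)
    finally show ?thesis by (simp add: q_def)
  qed (simp add: q_def[symmetric] sum_nonneg)
qed

lemma power_mean:
  assumes "1 \<le> (r::real)" "finite A" "A \<noteq> {}" "\<And>k. k \<in> A \<Longrightarrow> 0 \<le> y k"
  shows "(\<Sum>k\<in>A. y k) powr r \<le> real (card A) powr (r - 1) * (\<Sum>k\<in>A. y k powr r)"
proof -
  define n where "n = real (card A)"
  have n: "0 < n" using assms by (simp add: n_def card_gt_0_iff)
  have "(\<Sum>k\<in>A. (1 / n) *\<^sub>R y k) powr r \<le> (\<Sum>k\<in>A. (1 / n) * y k powr r)"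
    using assms n by (intro convex_on_sum[OF _ _ powr_convex_nonneg]) (auto simp: n_def)
  then have "((\<Sum>k\<in>A. y k) / n) powr r \<le> (\<Sum>k\<in>A. y k powr r) / n"
    by (simp add: sum_divide_distrib)
  moreover have "((\<Sum>k\<in>A. y k) / n) powr r = (\<Sum>k\<in>A. y k) powr r / n powr r"
    by (rule powr_divide)
  ultimately have "(\<Sum>k\<in>A. y k) powr r \<le> n powr r / n * (\<Sum>k\<in>A. y k powr r)"
    using n by (simp add: field_simps)
  also have "n powr r / n = n powr (r - 1)" using n by (simp add: powr_diff)
  finally show ?thesis by (simp add: n_def)
qed

text \<open>
  The average over all signs is bounded by the upper Khintchine inequality and the power mean
  inequality, so some choice of signs is at most the average.
\<close>

lemma exists_small_signed_sum:
  assumes p: "2 \<le> (p::real)"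
  shows "\<exists>C>0. \<forall>(M :: 'a measure) A f. finite A \<longrightarrow> A \<noteq> {} \<longrightarrow>
     (\<forall>k\<in>A. f k \<in> borel_measurable M \<and> integrable M (\<lambda>t. \<bar>f k t\<bar> powr p) \<and> (\<integral>t. \<bar>f k t\<bar> powr p \<partial>M) = 1) \<longrightarrow>
     (\<exists>B\<subseteq>A. (\<integral>t. \<bar>signed_sum A B (\<lambda>k. f k t)\<bar> powr p \<partial>M) \<le> C * real (card A) powr (p / 2))"
proof -
  obtain C where C: "0 < C" "\<And>A b. finite A \<Longrightarrow>
    (\<Sum>B\<in>Pow A. \<bar>signed_sum A B b\<bar> powr p) \<le> C * 2 ^ card A * (\<Sum>k\<in>A. (b k)\<^sup>2) powr (p / 2)"
    using khintchine_upper[of p] p by auto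
  show ?thesis
  proof (intro exI[of _ C] conjI C allI impI)
    fix M :: "'a measure" and A :: "nat set" and f :: "nat \<Rightarrow> 'a \<Rightarrow> real"
    assume A: "finite A" "A \<noteq> {}" and f: "\<forall>k\<in>A. f k \<in> borel_measurable M \<and>
      integrable M (\<lambda>t. \<bar>f k t\<bar> powr p) \<and> (\<integral>t. \<bar>f k t\<bar> powr p \<partial>M) = 1"
    define n where "n = real (card A)"
    have n: "0 < n" using A by (simp add: n_def card_gt_0_iff)
    define h where "h = (\<lambda>t. C * 2 ^ card A * (n powr (p / 2 - 1) * (\<Sum>k\<in>A. \<bar>f k t\<bar> powr p)))"
    have hint: "integrable M h" unfolding h_def using f by auto
    have pt: "(\<Sum>B\<in>Pow A. \<bar>signed_sum A B (\<lambda>k. f k t)\<bar> powr p) \<le> h t" for t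
    proof -
      have "(\<Sum>k\<in>A. (f k t)\<^sup>2) powr (p / 2) \<le> n powr (p / 2 - 1) * (\<Sum>k\<in>A. ((f k t)\<^sup>2) powr (p / 2))"
        unfolding n_def using p A by (intro power_mean) auto
      also have "(\<Sum>k\<in>A. ((f k t)\<^sup>2) powr (p / 2)) = (\<Sum>k\<in>A. \<bar>f k t\<bar> powr p)"
      proof (rule sum.cong[OF refl])
        fix k show "((f k t)\<^sup>2) powr (p / 2) = \<bar>f k t\<bar> powr p"
        proof (cases "f k t = 0")
          case False
          then have "(f k t)\<^sup>2 = \<bar>f k t\<bar> powr 2" by simp
          then show ?thesis by (simp only: powr_powr) simp
        qed simp
      qed
      finally show ?thesis unfolding h_def using C by (intro order_trans[OF C(2)[OF A(1)]] mult_left_mono) auto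
    qed
    have meas: "(\<lambda>t. signed_sum A B (\<lambda>k. f k t)) \<in> borel_measurable M" for B
      unfolding signed_sum_def using f by (intro borel_measurable_sum) auto
    have int: "integrable M (\<lambda>t. \<bar>signed_sum A B (\<lambda>k. f k t)\<bar> powr p)" if "B \<subseteq> A" for B
    proof (rule Bochner_Integration.integrable_bound[OF hint])
      show "AE t in M. norm (\<bar>signed_sum A B (\<lambda>k. f k t)\<bar> powr p) \<le> norm (h t)"
      proof (rule AE_I2)
        fix t
        have "\<bar>signed_sum A B (\<lambda>k. f k t)\<bar> powr p \<le> (\<Sum>B\<in>Pow A. \<bar>signed_sum A B (\<lambda>k. f k t)\<bar> powr p)"
          using A that by (intro member_le_sum) auto
        then show "norm (\<bar>signed_sum A B (\<lambda>k. f k t)\<bar> powr p) \<le> norm (h t)" using pt[of t] by auto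
      qed
    qed (use meas in measurable)
    show "\<exists>B\<subseteq>A. (\<integral>t. \<bar>signed_sum A B (\<lambda>k. f k t)\<bar> powr p \<partial>M) \<le> C * real (card A) powr (p / 2)"
    proof (rule ccontr)
      assume "\<not> ?thesis"
      then have "(\<Sum>B\<in>Pow A. C * n powr (p / 2)) < (\<Sum>B\<in>Pow A. \<integral>t. \<bar>signed_sum A B (\<lambda>k. f k t)\<bar> powr p \<partial>M)"
        using A by (intro sum_strict_mono) (auto simp: n_def not_le)
      also have "\<dots> = (\<integral>t. (\<Sum>B\<in>Pow A. \<bar>signed_sum A B (\<lambda>k. f k t)\<bar> powr p) \<partial>M)"
        using int by (intro Bochner_Integration.integral_sum[symmetric]) auto
      also have "\<dots> \<le> (\<integral>t. h t \<partial>M)"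
        using int hint pt by (intro integral_mono Bochner_Integration.integrable_sum) auto
      also have "\<dots> = C * 2 ^ card A * (n powr (p / 2 - 1) * (\<Sum>k\<in>A. \<integral>t. \<bar>f k t\<bar> powr p \<partial>M))"
        unfolding h_def using f by (simp add: Bochner_Integration.integral_sum)
      also have "\<dots> = C * 2 ^ card A * (n powr (p / 2 - 1) * n)" using f by (simp add: n_def)
      also have "n powr (p / 2 - 1) * n = n powr (p / 2)" using n by (simp add: powr_diff)
      finally show False using A by (simp add: card_Pow)
    qed
  qed
qed

text \<open>
  As in the previous lemma, but with both inequalities reversed: for p \<le> 2 the power mean inequality
  is used with the exponent 2 / p.
\<close>

lemma exists_large_signed_sum:
  assumes p: "0 < (p::real)" "p \<le> 2" and A: "finite A" "A \<noteq> {}"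
    and f: "\<And>k. k \<in> A \<Longrightarrow> f k \<in> borel_measurable M" "\<And>k. k \<in> A \<Longrightarrow> integrable M (\<lambda>t. \<bar>f k t\<bar> powr p)"
      "\<And>k. k \<in> A \<Longrightarrow> (\<integral>t. \<bar>f k t\<bar> powr p \<partial>M) = 1"
    and int: "\<And>B. integrable M (\<lambda>t. \<bar>signed_sum A B (\<lambda>k. f k t)\<bar> powr p)"
  shows "\<exists>B\<subseteq>A. 2 powr (p - 2) / 4 * real (card A) powr (p / 2) \<le> (\<integral>t. \<bar>signed_sum A B (\<lambda>k. f k t)\<bar> powr p \<partial>M)"
proof (rule ccontr)
  define C where "C = 2 powr (p - 2) / 4"
  have C: "0 < C" by (simp add: C_def)
  define n where "n = real (card A)"
  have n: "0 < n" using A by (simp add: n_def card_gt_0_iff)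
  define h where "h = (\<lambda>t. C * 2 ^ card A * (n powr (p / 2 - 1) * (\<Sum>k\<in>A. \<bar>f k t\<bar> powr p)))"
  have hint: "integrable M h" unfolding h_def using f by auto
  have pt: "h t \<le> (\<Sum>B\<in>Pow A. \<bar>signed_sum A B (\<lambda>k. f k t)\<bar> powr p)" for t
  proof -
    define y where "y = (\<lambda>k. \<bar>f k t\<bar> powr p)"
    have sq: "y k powr (2 / p) = (f k t)\<^sup>2" for k
      using p by (cases "f k t = 0") (auto simp: y_def powr_powr powr_numeral)
    have "(\<Sum>k\<in>A. y k) powr (2 / p) \<le> n powr (2 / p - 1) * (\<Sum>k\<in>A. (f k t)\<^sup>2)"
      unfolding n_def sq[symmetric] using p A by (intro power_mean) (auto simp: y_def)
    then have "((\<Sum>k\<in>A. y k) powr (2 / p)) powr (p / 2) \<le> (n powr (2 / p - 1) * (\<Sum>k\<in>A. (f k t)\<^sup>2)) powr (p / 2)"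
      using p by (intro powr_mono2) auto
    then have "(\<Sum>k\<in>A. y k) \<le> n powr ((2 / p - 1) * (p / 2)) * (\<Sum>k\<in>A. (f k t)\<^sup>2) powr (p / 2)"
      using p n by (simp add: powr_powr powr_mult sum_nonneg y_def)
    also have "(2 / p - 1) * (p / 2) = 1 - p / 2" using p by (simp add: field_simps)
    finally have "n powr (p / 2 - 1) * (\<Sum>k\<in>A. y k) \<le> n powr (p / 2 - 1) * (n powr (1 - p / 2) * (\<Sum>k\<in>A. (f k t)\<^sup>2) powr (p / 2))"
      by (rule mult_left_mono) simp
    also have "\<dots> = (\<Sum>k\<in>A. (f k t)\<^sup>2) powr (p / 2)" using n by (simp flip: mult.assoc powr_add)
    finally have "h t \<le> C * 2 ^ card A * (\<Sum>k\<in>A. (f k t)\<^sup>2) powr (p / 2)"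
      unfolding h_def y_def using C by (intro mult_left_mono) auto
    also have "\<dots> \<le> (\<Sum>B\<in>Pow A. \<bar>signed_sum A B (\<lambda>k. f k t)\<bar> powr p)"
      unfolding C_def by (rule khintchine_lower[OF p A(1)])
    finally show ?thesis .
  qed
  assume "\<not> ?thesis"
  then have "(\<Sum>B\<in>Pow A. \<integral>t. \<bar>signed_sum A B (\<lambda>k. f k t)\<bar> powr p \<partial>M) < (\<Sum>B\<in>Pow A. C * n powr (p / 2))"
    using A by (intro sum_strict_mono) (auto simp: n_def not_le C_def)
  also have "\<dots> = C * 2 ^ card A * n powr (p / 2)" using A by (simp add: card_Pow)
  also have "n powr (p / 2) = n powr (p / 2 - 1) * n" using n by (simp add: powr_diff)
  also have "C * 2 ^ card A * (n powr (p / 2 - 1) * n) = (\<integral>t. h t \<partial>M)"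
    unfolding h_def using f by (simp add: Bochner_Integration.integral_sum n_def)
  also have "\<dots> \<le> (\<integral>t. (\<Sum>B\<in>Pow A. \<bar>signed_sum A B (\<lambda>k. f k t)\<bar> powr p) \<partial>M)"
    using int hint pt by (intro integral_mono Bochner_Integration.integrable_sum) auto
  also have "\<dots> = (\<Sum>B\<in>Pow A. \<integral>t. \<bar>signed_sum A B (\<lambda>k. f k t)\<bar> powr p \<partial>M)"
    using int by (intro Bochner_Integration.integral_sum) auto
  finally show False by simp
qed

section \<open>Jacobi polynomials and their differential equation\<close>

definition jacobi_weight :: "real \<Rightarrow> real \<Rightarrow> real \<Rightarrow> real" where
  "jacobi_weight \<alpha> \<beta> x = (1 - x) powr \<alpha> * (1 + x) powr \<beta> * indicator {-1<..<1} x"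

lemma jacobi_weight_nonneg [simp]: "0 \<le> jacobi_weight \<alpha> \<beta> x"
  by (simp add: jacobi_weight_def)

lemma jacobi_weight_measurable [measurable]: "jacobi_weight \<alpha> \<beta> \<in> borel_measurable borel"
  unfolding jacobi_weight_def by measurable

lemma jacobi_measure_density: "jacobi_measure \<alpha> \<beta> = density lborel (jacobi_weight \<alpha> \<beta>)"
  by (simp add: jacobi_measure_def jacobi_weight_def)

lemma sets_jacobi [measurable_cong, simp]: "sets (jacobi_measure \<alpha> \<beta>) = sets borel"
  and space_jacobi [simp]: "space (jacobi_measure \<alpha> \<beta>) = UNIV"
  by (simp_all add: jacobi_measure_def)

lemma integral_jacobi:
  fixes f :: "real \<Rightarrow> 'b::{banach, second_countable_topology}"
  assumes "f \<in> borel_measurable borel"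
  shows "(\<integral>x. f x \<partial>jacobi_measure \<alpha> \<beta>) = (\<integral>x. jacobi_weight \<alpha> \<beta> x *\<^sub>R f x \<partial>lborel)"
  using assms unfolding jacobi_measure_density by (intro integral_density) auto

lemma integrable_jacobi_iff:
  fixes f :: "real \<Rightarrow> 'b::{banach, second_countable_topology}"
  assumes "f \<in> borel_measurable borel"
  shows "integrable (jacobi_measure \<alpha> \<beta>) f \<longleftrightarrow> integrable lborel (\<lambda>x. jacobi_weight \<alpha> \<beta> x *\<^sub>R f x)"
  using assms unfolding jacobi_measure_density by (intro integrable_density) auto

lemma AE_jacobi_bounds: "AE x in jacobi_measure \<alpha> \<beta>. -1 < x \<and> x < 1"
  unfolding jacobi_measure_density
  by (subst AE_density) (auto simp: jacobi_weight_def indicator_def)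

lemma has_bochner_integral_jacobi_weight:
  assumes "-1 < \<alpha>" "-1 < \<beta>"
  shows "has_bochner_integral lborel (jacobi_weight \<alpha> \<beta>) (2 powr (\<alpha> + \<beta> + 1) * Beta (\<alpha> + 1) (\<beta> + 1))"
proof -
  define b where "b = (\<lambda>t::real. indicator {0..1} t * (t powr \<beta> * (1 - t) powr \<alpha>))"
  have int: "integrable lborel b"
    using integrable_Beta[of "\<beta> + 1" "\<alpha> + 1"] assms by (simp add: b_def set_integrable_def)
  have "(b has_integral (LINT x|lborel. b x)) UNIV"
    by (rule has_integral_integral_lborel[OF int])
  moreover have "(b has_integral Beta (\<beta> + 1) (\<alpha> + 1)) UNIV"
  proof -
    have "b = (\<lambda>t. if t \<in> {0..1} then t powr \<beta> * (1 - t) powr \<alpha> else 0)"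
      by (auto simp: b_def)
    then show ?thesis
      using has_integral_Beta_real[of "\<beta> + 1" "\<alpha> + 1"] assms
      by (simp only: has_integral_restrict_UNIV) simp
  qed
  ultimately have val: "(LINT x|lborel. b x) = Beta (\<beta> + 1) (\<alpha> + 1)"
    by (rule has_integral_unique)
  have hb: "has_bochner_integral lborel (\<lambda>t. 2 powr (\<alpha> + \<beta>) * b t) (2 powr (\<alpha> + \<beta>) * Beta (\<beta> + 1) (\<alpha> + 1))"
    using int val by (intro has_bochner_integral_mult_right) (auto simp: has_bochner_integral_iff)
  have eq: "jacobi_weight \<alpha> \<beta> (-1 + 2 * t) = 2 powr (\<alpha> + \<beta>) * b t" if "t \<noteq> 0" "t \<noteq> 1" for t
  proof (cases "0 < t \<and> t < 1")
    case True
    have "(1 - (-1 + 2 * t)) = 2 * (1 - t)" "1 + (-1 + 2 * t) = 2 * t" by auto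
    then have "jacobi_weight \<alpha> \<beta> (-1 + 2 * t) = (2 * (1 - t)) powr \<alpha> * (2 * t) powr \<beta>"
      using True unfolding jacobi_weight_def by (simp only:) simp
    also have "\<dots> = 2 powr (\<alpha> + \<beta>) * b t"
      using True by (simp only: powr_mult) (simp add: b_def powr_add)
    finally show ?thesis .
  qed (use that in \<open>auto simp: jacobi_weight_def b_def indicator_def\<close>)
  have "has_bochner_integral lborel (\<lambda>t. jacobi_weight \<alpha> \<beta> (-1 + 2 * t)) (2 powr (\<alpha> + \<beta>) * Beta (\<beta> + 1) (\<alpha> + 1))"
  proof (rule has_bochner_integralI_AE[OF hb])
    show "AE t in lborel. 2 powr (\<alpha> + \<beta>) * b t = jacobi_weight \<alpha> \<beta> (-1 + 2 * t)"
      using AE_lborel_singleton[of "0::real"] AE_lborel_singleton[of "1::real"]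
      by eventually_elim (use eq in auto)
  qed auto
  then have "has_bochner_integral lborel (\<lambda>t. jacobi_weight \<alpha> \<beta> (-1 + 2 * t))
       ((2 powr (\<alpha> + \<beta> + 1) * Beta (\<alpha> + 1) (\<beta> + 1)) /\<^sub>R \<bar>2\<bar>)"
    by (simp add: powr_add Beta_commute mult.assoc)
  then show ?thesis
    by (subst lborel_has_bochner_integral_real_affine_iff[where c = 2 and t = "-1"]) auto
qed

lemma finite_measure_jacobi:
  assumes "-1 < \<alpha>" "-1 < \<beta>"
  shows "finite_measure (jacobi_measure \<alpha> \<beta>)"
proof
  have "emeasure (jacobi_measure \<alpha> \<beta>) UNIV = (\<integral>\<^sup>+x. ennreal (jacobi_weight \<alpha> \<beta> x) \<partial>lborel)"
    by (simp add: jacobi_measure_density emeasure_density)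
  also have "\<dots> < \<infinity>"
    using has_bochner_integral_jacobi_weight[OF assms]
    by (simp add: has_bochner_integral_iff nn_integral_eq_integral)
  finally show "emeasure (jacobi_measure \<alpha> \<beta>) (space (jacobi_measure \<alpha> \<beta>)) \<noteq> \<infinity>" by simp
qed

lemma integral_const_jacobi:
  assumes "-1 < \<alpha>" "-1 < \<beta>"
  shows "(\<integral>x. c \<partial>jacobi_measure \<alpha> \<beta>) = c * (2 powr (\<alpha> + \<beta> + 1) * Beta (\<alpha> + 1) (\<beta> + 1))"
  using has_bochner_integral_jacobi_weight[OF assms] integral_jacobi[of "\<lambda>x. c" \<alpha> \<beta>]
  by (simp add: has_bochner_integral_iff del: lebesgue_integral_const)

lemma integrable_jacobi_bounded:
  fixes f :: "real \<Rightarrow> 'b::{banach, second_countable_topology}"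
  assumes "-1 < \<alpha>" "-1 < \<beta>" "f \<in> borel_measurable borel" "\<And>x. -1 < x \<Longrightarrow> x < 1 \<Longrightarrow> norm (f x) \<le> B"
  shows "integrable (jacobi_measure \<alpha> \<beta>) f"
proof (rule finite_measure.integrable_const_bound[OF finite_measure_jacobi[OF assms(1,2)]])
  show "AE x in jacobi_measure \<alpha> \<beta>. norm (f x) \<le> B"
    using AE_jacobi_bounds by eventually_elim (use assms in auto)
qed (use assms in simp)

lemma poly_bounded_unit_interval: "\<exists>B. \<forall>x::real. -1 \<le> x \<and> x \<le> 1 \<longrightarrow> \<bar>poly q x\<bar> \<le> B"
proof -
  have "compact (poly q ` {-1..1})"
    by (intro compact_continuous_image continuous_intros) auto
  from compact_imp_bounded[OF this] show ?thesis
    unfolding bounded_iff by (metis (no_types, lifting) atLeastAtMost_iff imageI real_norm_def)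
qed

lemma poly_measurable [measurable]: "poly (q::real poly) \<in> borel_measurable borel"
  by (intro borel_measurable_continuous_onI continuous_intros)

lemma integrable_jacobi_poly:
  assumes "-1 < \<alpha>" "-1 < \<beta>"
  shows "integrable (jacobi_measure \<alpha> \<beta>) (poly q)"
proof -
  obtain B where B: "\<And>x. -1 \<le> x \<Longrightarrow> x \<le> 1 \<Longrightarrow> \<bar>poly q x\<bar> \<le> B"
    using poly_bounded_unit_interval[of q] by blast
  show ?thesis by (rule integrable_jacobi_bounded[OF assms, where B = B]) (use B in auto)
qed

text \<open>
  The integrand is the derivative of (1 - x)^(\<alpha>+1) (1 + x)^(\<beta>+1) s(x) divided by the weight, and
  this function vanishes at both endpoints.
\<close>

lemma jacobi_integral_derivative:
  assumes "-1 < \<alpha>" "-1 < \<beta>"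
  shows "(\<integral>x. poly ([:1, 0, -1:] * pderiv s + [:\<beta> - \<alpha>, -(\<alpha> + \<beta> + 2):] * s) x \<partial>jacobi_measure \<alpha> \<beta>) = 0"
proof -
  define g where "g = poly ([:1, 0, -1:] * pderiv s + [:\<beta> - \<alpha>, -(\<alpha> + \<beta> + 2):] * s)"
  have gm[measurable]: "g \<in> borel_measurable borel" by (simp add: g_def)
  define W where "W = (\<lambda>x. (1 - x) powr (\<alpha> + 1) * (1 + x) powr (\<beta> + 1) * poly s x)"
  have int: "integrable lborel (\<lambda>x. jacobi_weight \<alpha> \<beta> x * g x)"
    using integrable_jacobi_poly[OF assms] integrable_jacobi_iff[OF gm, of \<alpha> \<beta>] by (simp add: g_def)
  have "((\<lambda>x. jacobi_weight \<alpha> \<beta> x * g x) has_integral (W 1 - W (-1))) {-1..1}"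
  proof (rule fundamental_theorem_of_calculus_interior)
    show "continuous_on {-1..1} W"
      unfolding W_def using assms by (intro continuous_intros continuous_on_powr') auto
    fix x :: real assume x: "x \<in> {-1<..<1}"
    have d1: "((\<lambda>x. (1 - x) powr (\<alpha> + 1)) has_real_derivative (\<alpha> + 1) * (1 - x) powr \<alpha> * (-1)) (at x)"
      using x by (intro DERIV_chain2[OF has_real_derivative_powr[THEN DERIV_cong]])
        (auto intro!: derivative_eq_intros)
    have d2: "((\<lambda>x. (1 + x) powr (\<beta> + 1)) has_real_derivative (\<beta> + 1) * (1 + x) powr \<beta> * 1) (at x)"
      using x by (intro DERIV_chain2[OF has_real_derivative_powr[THEN DERIV_cong]])
        (auto intro!: derivative_eq_intros)
    have e: "(1 - x) powr (\<alpha> + 1) = (1 - x) * (1 - x) powr \<alpha>" "(1 + x) powr (\<beta> + 1) = (1 + x) * (1 + x) powr \<beta>"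
      using x by (simp_all add: powr_add)
    have "(W has_real_derivative jacobi_weight \<alpha> \<beta> x * g x) (at x)"
      unfolding W_def
      by (rule DERIV_mult[OF DERIV_mult[OF d1 d2] poly_DERIV, THEN DERIV_cong])
         (simp only: e, use x in \<open>simp add: g_def jacobi_weight_def algebra_simps\<close>)
    then show "(W has_vector_derivative jacobi_weight \<alpha> \<beta> x * g x) (at x)"
      by (simp add: has_real_derivative_iff_has_vector_derivative)
  qed auto
  moreover have "W 1 = 0" "W (-1) = 0" by (auto simp: W_def)
  ultimately have "((\<lambda>x. jacobi_weight \<alpha> \<beta> x * g x) has_integral 0) {-1..1}" by simp
  then have "((\<lambda>x. jacobi_weight \<alpha> \<beta> x * g x) has_integral 0) UNIV"
    by (rule has_integral_on_superset) (auto simp: jacobi_weight_def indicator_def)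
  with has_integral_integral_lborel[OF int] have "(LINT x|lborel. jacobi_weight \<alpha> \<beta> x * g x) = 0"
    by (rule has_integral_unique)
  then show ?thesis using integral_jacobi[OF gm, of \<alpha> \<beta>] by (simp add: g_def)
qed

definition jacobi_inner :: "real \<Rightarrow> real \<Rightarrow> real poly \<Rightarrow> real poly \<Rightarrow> real" where
  "jacobi_inner \<alpha> \<beta> q r = (\<integral>x. poly q x * poly r x \<partial>jacobi_measure \<alpha> \<beta>)"

text \<open>
  The operator w^(-1) ((1 - x^2) w q')', where w is the Jacobi weight.
\<close>

definition jacobi_op :: "real \<Rightarrow> real \<Rightarrow> real poly \<Rightarrow> real poly" where
  "jacobi_op \<alpha> \<beta> q = [:1, 0, -1:] * pderiv (pderiv q) + [:\<beta> - \<alpha>, -(\<alpha> + \<beta> + 2):] * pderiv q"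

definition jacobi_eigenvalue :: "real \<Rightarrow> real \<Rightarrow> nat \<Rightarrow> real" where
  "jacobi_eigenvalue \<alpha> \<beta> n = real n * (real n + \<alpha> + \<beta> + 1)"

lemma jacobi_inner_eq: "jacobi_inner \<alpha> \<beta> q r = (\<integral>x. poly (q * r) x \<partial>jacobi_measure \<alpha> \<beta>)"
  by (simp add: jacobi_inner_def)

lemma jacobi_inner_commute: "jacobi_inner \<alpha> \<beta> q r = jacobi_inner \<alpha> \<beta> r q"
  by (simp add: jacobi_inner_def mult.commute)

context
  fixes \<alpha> \<beta> :: real
  assumes ab: "-1 < \<alpha>" "-1 < \<beta>"
begin

lemma jacobi_inner_add: "jacobi_inner \<alpha> \<beta> (q + q') r = jacobi_inner \<alpha> \<beta> q r + jacobi_inner \<alpha> \<beta> q' r"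
  unfolding jacobi_inner_eq distrib_right poly_add
  by (intro Bochner_Integration.integral_add integrable_jacobi_poly ab)

lemma jacobi_inner_smult: "jacobi_inner \<alpha> \<beta> (smult c q) r = c * jacobi_inner \<alpha> \<beta> q r"
  unfolding jacobi_inner_def by (simp add: mult.assoc)

lemma jacobi_inner_sum: "jacobi_inner \<alpha> \<beta> (\<Sum>i\<in>I. q i) r = (\<Sum>i\<in>I. jacobi_inner \<alpha> \<beta> (q i) r)"
  by (induction I rule: infinite_finite_induct) (auto simp: jacobi_inner_add jacobi_inner_def[of _ _ 0])

text \<open>
  The total derivative in the preceding integral formula, applied to q' r, splits into the two terms.
\<close>

lemma jacobi_op_parts:
  "jacobi_inner \<alpha> \<beta> (jacobi_op \<alpha> \<beta> q) r = - jacobi_inner \<alpha> \<beta> ([:1, 0, -1:] * pderiv q) (pderiv r)"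
proof -
  have "0 = (\<integral>x. poly ([:1, 0, -1:] * pderiv (pderiv q * r) + [:\<beta> - \<alpha>, -(\<alpha> + \<beta> + 2):] * (pderiv q * r)) x
            \<partial>jacobi_measure \<alpha> \<beta>)"
    using jacobi_integral_derivative[OF ab, of "pderiv q * r"] by simp
  also have "[:1, 0, -1:] * pderiv (pderiv q * r) + [:\<beta> - \<alpha>, -(\<alpha> + \<beta> + 2):] * (pderiv q * r)
     = jacobi_op \<alpha> \<beta> q * r + ([:1, 0, -1:] * pderiv q) * pderiv r"
    unfolding jacobi_op_def pderiv_mult by algebra
  also have "(\<integral>x. poly \<dots> x \<partial>jacobi_measure \<alpha> \<beta>)
     = jacobi_inner \<alpha> \<beta> (jacobi_op \<alpha> \<beta> q) r + jacobi_inner \<alpha> \<beta> ([:1, 0, -1:] * pderiv q) (pderiv r)"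
    unfolding jacobi_inner_eq poly_add
    by (intro Bochner_Integration.integral_add integrable_jacobi_poly ab)
  finally show ?thesis by simp
qed

lemma jacobi_op_symmetric: "jacobi_inner \<alpha> \<beta> (jacobi_op \<alpha> \<beta> q) r = jacobi_inner \<alpha> \<beta> q (jacobi_op \<alpha> \<beta> r)"
  unfolding jacobi_op_parts jacobi_inner_commute[of _ _ q] by (simp add: jacobi_inner_def algebra_simps)

lemma jacobi_op_degree:
  assumes "degree q \<le> n"
  shows "degree (jacobi_op \<alpha> \<beta> q) \<le> n"
    and "coeff (jacobi_op \<alpha> \<beta> q) n = - jacobi_eigenvalue \<alpha> \<beta> n * coeff q n"
proof -
  have c: "coeff q i = 0" if "i > n" for i using that assms by (intro coeff_eq_0) simp
  have *: "coeff (jacobi_op \<alpha> \<beta> q) m =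
      (real m + 1) * (real m + 2) * coeff q (m + 2) + (\<beta> - \<alpha>) * (real m + 1) * coeff q (m + 1)
      - jacobi_eigenvalue \<alpha> \<beta> m * coeff q m" for m
  proof (cases m)
    case 0
    then show ?thesis by (simp add: jacobi_op_def coeff_pderiv jacobi_eigenvalue_def numeral_2_eq_2)
  next
    case (Suc k)
    show ?thesis
    proof (cases k)
      case 0
      then show ?thesis using Suc
        by (simp add: jacobi_op_def coeff_pderiv jacobi_eigenvalue_def numeral_2_eq_2 algebra_simps)
    next
      case (Suc l)
      then show ?thesis using \<open>m = Suc k\<close>
        by (simp add: jacobi_op_def coeff_pderiv jacobi_eigenvalue_def algebra_simps)
    qed
  qed
  show "degree (jacobi_op \<alpha> \<beta> q) \<le> n"
    by (rule degree_le) (auto simp: * c)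
  show "coeff (jacobi_op \<alpha> \<beta> q) n = - jacobi_eigenvalue \<alpha> \<beta> n * coeff q n"
    by (simp add: * c)
qed

lemma AE_jacobi_poly_zero:
  assumes "AE x in jacobi_measure \<alpha> \<beta>. poly q x = 0"
  shows "q = 0"
proof (rule ccontr)
  assume "q \<noteq> 0"
  then have fin: "finite {x. poly q x = 0}" by (rule poly_roots_finite)
  have "AE x in lborel. x \<notin> {x. poly q x = 0}"
    using finite_imp_null_set_lborel[OF fin] by (rule AE_not_in)
  moreover have "AE x in lborel. -1 < x \<and> x < 1 \<longrightarrow> poly q x = 0"
    using assms unfolding jacobi_measure_density
    by (subst (asm) AE_density) (auto simp: jacobi_weight_def indicator_def elim!: eventually_mono)
  ultimately have "AE x in lborel. x \<notin> {-1<..<1::real}"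
    by eventually_elim auto
  then have "emeasure lborel {-1<..<1::real} = 0"
    by (subst (asm) AE_iff_measurable[where N = "{-1<..<1}"]) auto
  then show False by simp
qed

lemma jacobi_inner_self_zero:
  assumes "jacobi_inner \<alpha> \<beta> q q = 0"
  shows "q = 0"
proof (rule AE_jacobi_poly_zero)
  have "AE x in jacobi_measure \<alpha> \<beta>. poly (q * q) x = 0"
  proof (subst integral_nonneg_eq_0_iff_AE[symmetric])
    show "integral\<^sup>L (jacobi_measure \<alpha> \<beta>) (poly (q * q)) = 0"
      using assms by (simp only: jacobi_inner_eq)
  qed (auto intro: integrable_jacobi_poly ab)
  then show "AE x in jacobi_measure \<alpha> \<beta>. poly q x = 0" by (auto elim: eventually_mono)
qed

context
  fixes P :: "nat \<Rightarrow> real poly"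
  assumes P: "orthonormal_jacobi \<alpha> \<beta> P"
begin

lemma jacobi_degree: "degree (P n) = n" and jacobi_lead_pos: "lead_coeff (P n) > 0"
  using P unfolding orthonormal_jacobi_def by blast+

lemma jacobi_inner_P: "jacobi_inner \<alpha> \<beta> (P n) (P m) = (if n = m then 1 else 0)"
  using P unfolding orthonormal_jacobi_def jacobi_inner_def by auto

lemma poly_in_span_jacobi: "degree q < n \<Longrightarrow> \<exists>c. q = (\<Sum>k<n. smult (c k) (P k))"
proof (induction n arbitrary: q)
  case (Suc n)
  define c where "c = coeff q n / coeff (P n) n"
  define r where "r = q - smult c (P n)"
  have lc: "coeff (P n) n > 0" using jacobi_lead_pos[of n] jacobi_degree[of n] by simp
  have dr: "degree r \<le> n" unfolding r_def using Suc.prems jacobi_degree[of n]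
    by (intro degree_diff_le) (auto intro: order_trans[OF degree_smult_le])
  have cr: "coeff r n = 0" using lc by (simp add: r_def c_def)
  have "\<exists>d. r = (\<Sum>k<n. smult (d k) (P k))"
  proof (cases "r = 0")
    case True
    then show ?thesis by (intro exI[of _ "\<lambda>_. 0"]) simp
  next
    case False
    then have "degree r \<noteq> n" using cr by (metis leading_coeff_0_iff)
    then show ?thesis using dr by (intro Suc.IH) simp
  qed
  then obtain d where d: "r = (\<Sum>k<n. smult (d k) (P k))" ..
  have "q = (\<Sum>k<Suc n. smult ((d(n := c)) k) (P k))"
    using d by (simp add: r_def algebra_simps)
  then show ?case by blast
qed simp

lemma jacobi_orthogonal_lower:
  assumes "degree q < n"
  shows "jacobi_inner \<alpha> \<beta> q (P n) = 0"
proof -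
  obtain c where "q = (\<Sum>k<n. smult (c k) (P k))" using poly_in_span_jacobi[OF assms] ..
  then show ?thesis by (simp add: jacobi_inner_sum jacobi_inner_smult jacobi_inner_P)
qed

text \<open>
  The operator preserves the polynomials of degree at most n and is symmetric. So the image of P n plus
  the eigenvalue times P n has degree less than n and is orthogonal to all
  such polynomials, in particular to itself.
\<close>

lemma jacobi_differential_equation:
  "jacobi_op \<alpha> \<beta> (P n) = smult (- jacobi_eigenvalue \<alpha> \<beta> n) (P n)"
proof -
  define r where "r = jacobi_op \<alpha> \<beta> (P n) + smult (jacobi_eigenvalue \<alpha> \<beta> n) (P n)"
  have "r = 0"
  proof (rule ccontr)
    assume "r \<noteq> 0"
    have "degree r \<le> n" unfolding r_def using jacobi_op_degree(1)[of "P n" n] jacobi_degree[of n]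
      by (intro degree_add_le) (auto intro: order_trans[OF degree_smult_le])
    moreover have "coeff r n = 0"
      unfolding r_def using jacobi_op_degree(2)[of "P n" n] jacobi_degree[of n] by simp
    ultimately have dr: "degree r < n"
      using \<open>r \<noteq> 0\<close> by (metis leading_coeff_0_iff order_le_less)
    have "degree (jacobi_op \<alpha> \<beta> r) < n"
      using jacobi_op_degree(1)[of r "degree r"] dr by simp
    then have "jacobi_inner \<alpha> \<beta> r r = 0"
      using jacobi_orthogonal_lower[OF dr] jacobi_orthogonal_lower[of "jacobi_op \<alpha> \<beta> r" n]
        jacobi_op_symmetric[of "P n" r]
      by (subst (1) r_def) (simp add: jacobi_inner_add jacobi_inner_smult jacobi_inner_commute[of _ _ "P n"])
    then show False using jacobi_inner_self_zero \<open>r \<noteq> 0\<close> by blast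
  qed
  then show ?thesis by (simp add: r_def eq_neg_iff_add_eq_0)
qed

end
end

section \<open>Values at the endpoints\<close>

lemma jacobi_eigenvalue_nonneg: "-1 < \<alpha> + \<beta> + 1 \<Longrightarrow> 0 \<le> jacobi_eigenvalue \<alpha> \<beta> n"
  by (cases n) (auto simp: jacobi_eigenvalue_def intro!: mult_nonneg_nonneg)

lemma jacobi_eigenvalue_Suc_pos: "-1 < \<alpha> + \<beta> + 1 \<Longrightarrow> 0 < jacobi_eigenvalue \<alpha> \<beta> (Suc n)"
  by (auto simp: jacobi_eigenvalue_def)

lemma jacobi_weight_shift: "jacobi_weight (\<alpha> + 1) (\<beta> + 1) x = (1 - x\<^sup>2) * jacobi_weight \<alpha> \<beta> x"
  by (auto simp: jacobi_weight_def indicator_def powr_add power2_eq_square algebra_simps)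

lemma jacobi_inner_shift:
  "jacobi_inner (\<alpha> + 1) (\<beta> + 1) q r = jacobi_inner \<alpha> \<beta> ([:1, 0, -1:] * q) r"
proof -
  have *: "poly [:1, 0, -1:] x = 1 - x\<^sup>2" for x :: real by (simp add: power2_eq_square)
  show ?thesis
    unfolding jacobi_inner_eq integral_jacobi[OF poly_measurable] jacobi_weight_shift
    by (simp only: poly_mult * real_scaleR_def mult_ac)
qed

text \<open>
  Integration by parts turns the inner product of the derivatives for the weight with indices \<alpha> + 1
  and \<beta> + 1 into the inner product of P n and its image under the differential operator.
\<close>

lemma jacobi_derivative_orthonormal:
  assumes ab: "-1 < \<alpha>" "-1 < \<beta>" and P: "orthonormal_jacobi \<alpha> \<beta> P"
  shows "orthonormal_jacobi (\<alpha> + 1) (\<beta> + 1)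
           (\<lambda>n. smult (1 / sqrt (jacobi_eigenvalue \<alpha> \<beta> (Suc n))) (pderiv (P (Suc n))))"
proof -
  let ?l = "\<lambda>n. jacobi_eigenvalue \<alpha> \<beta> (Suc n)"
  have ab': "-1 < \<alpha> + 1" "-1 < \<beta> + 1" using ab by auto
  have l: "0 < ?l n" for n using ab by (intro jacobi_eigenvalue_Suc_pos) auto
  have "jacobi_inner (\<alpha> + 1) (\<beta> + 1) (pderiv (P (Suc n))) (pderiv (P (Suc m))) = (if n = m then ?l n else 0)" for n m
    using jacobi_op_parts[OF ab, of "P (Suc n)" "P (Suc m)"]
    by (simp add: jacobi_differential_equation[OF ab P] jacobi_inner_smult[OF ab] jacobi_inner_P[OF ab P]
        jacobi_inner_shift del: smult_minus_left split: if_splits)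
  moreover have sr: "jacobi_inner (\<alpha> + 1) (\<beta> + 1) q (smult c r) = c * jacobi_inner (\<alpha> + 1) (\<beta> + 1) q r" for c q r
    using jacobi_inner_smult[OF ab', of c r q] by (simp add: jacobi_inner_commute)
  ultimately have "jacobi_inner (\<alpha> + 1) (\<beta> + 1) (smult (1 / sqrt (?l n)) (pderiv (P (Suc n))))
      (smult (1 / sqrt (?l m)) (pderiv (P (Suc m)))) = (if n = m then 1 else 0)" for n m
    using l[of n]
    by (cases "n = m") (simp_all add: jacobi_inner_smult[OF ab'] sr)
  moreover have "degree (smult (1 / sqrt (?l n)) (pderiv (P (Suc n)))) = n" for n
    using l[of n] by (simp add: degree_pderiv jacobi_degree[OF ab P])
  moreover have "coeff (P (Suc n)) (Suc n) > 0" for n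
    using jacobi_lead_pos[OF ab P, of "Suc n"] jacobi_degree[OF ab P, of "Suc n"] by simp
  then have "lead_coeff (smult (1 / sqrt (?l n)) (pderiv (P (Suc n)))) > 0" for n
    using l[of n] by (simp add: degree_pderiv jacobi_degree[OF ab P] coeff_pderiv)
  ultimately show ?thesis
    unfolding orthonormal_jacobi_def jacobi_inner_def by blast
qed

text \<open>
  The square of the value at 1 of the orthonormal Jacobi polynomial of degree n.
\<close>

definition jacobi_endpoint_square :: "real \<Rightarrow> real \<Rightarrow> nat \<Rightarrow> real" where
  "jacobi_endpoint_square \<alpha> \<beta> n =
     (2 * real n + (\<alpha> + \<beta> + 1)) / 2 powr (\<alpha> + \<beta> + 1) * Gamma (real n + (\<alpha> + 1)) * Gamma (real n + (\<alpha> + \<beta> + 1))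
       / (fact n * Gamma (real n + (\<beta> + 1)) * (Gamma (\<alpha> + 1))\<^sup>2)"

lemma jacobi_derivative_at_one:
  assumes ab: "-1 < \<alpha>" "-1 < \<beta>" and P: "orthonormal_jacobi \<alpha> \<beta> P"
  shows "2 * (\<alpha> + 1) * poly (pderiv (P n)) 1 = jacobi_eigenvalue \<alpha> \<beta> n * poly (P n) 1"
  using arg_cong[OF jacobi_differential_equation[OF ab P, of n], of "\<lambda>q. poly q 1"]
  by (simp add: jacobi_op_def algebra_simps)

text \<open>
  The differential equation at the point 1 expresses the value there by the value of the derivative,
  which is a multiple of the orthonormal polynomial of degree n - 1 for the indices \<alpha> + 1 and
  \<beta> + 1. This reduces the claim to degree 0, where the value is determined by the total mass, a Beta
  integral.
\<close>

lemma jacobi_at_one: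
  assumes "-1 < \<alpha>" "-1 < \<beta>" "0 < \<alpha> + \<beta> + 1" "orthonormal_jacobi \<alpha> \<beta> P"
  shows "0 < poly (P n) 1" and "(poly (P n) 1)\<^sup>2 = jacobi_endpoint_square \<alpha> \<beta> n"
proof -
  have "0 < poly (P n) 1 \<and> (poly (P n) 1)\<^sup>2 = jacobi_endpoint_square \<alpha> \<beta> n"
    using assms
  proof (induction n arbitrary: \<alpha> \<beta> P)
    case 0
    note ab = 0(1,2) and P = 0(4)
    obtain c where c: "P 0 = [:c:]"
      using jacobi_degree[OF ab P, of 0] by (metis degree_eq_zeroE)
    have cpos: "0 < c" using jacobi_lead_pos[OF ab P, of 0] c by simp
    have "c\<^sup>2 * (2 powr (\<alpha> + \<beta> + 1) * Beta (\<alpha> + 1) (\<beta> + 1)) = jacobi_inner \<alpha> \<beta> (P 0) (P 0)"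
      using integral_const_jacobi[OF ab, of "c * c"] by (auto simp: jacobi_inner_def c power2_eq_square)
    also have "\<dots> = 1" using jacobi_inner_P[OF ab P, of 0 0] by simp
    finally have eq: "c\<^sup>2 * (2 powr (\<alpha> + \<beta> + 1) * Beta (\<alpha> + 1) (\<beta> + 1)) = 1" .
    have g: "Gamma (\<alpha> + 1) > 0" "Gamma (\<beta> + 1) > 0" "Gamma (\<alpha> + \<beta> + 1) > 0"
      using 0 by (auto intro!: Gamma_real_pos)
    have "Gamma (\<alpha> + 1 + (\<beta> + 1)) = (\<alpha> + \<beta> + 1) * Gamma (\<alpha> + \<beta> + 1)"
      using Gamma_plus1[of "\<alpha> + \<beta> + 1"] 0(3)
      by (simp add: algebra_simps) (metis add.commute add_cancel_left_left less_irrefl nonpos_Ints_nonpos not_le)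
    moreover have "c\<^sup>2 = G / (T * (A * B))" if "c\<^sup>2 * (T * (A * B / G)) = 1" for G T A B :: real
      using that by (cases "T = 0 \<or> A = 0 \<or> B = 0 \<or> G = 0") (auto simp: field_simps)
    note this[OF eq[unfolded Beta_def]]
    ultimately have "c\<^sup>2 = (\<alpha> + \<beta> + 1) * Gamma (\<alpha> + \<beta> + 1) / (2 powr (\<alpha> + \<beta> + 1) * (Gamma (\<alpha> + 1) * Gamma (\<beta> + 1)))"
      by simp
    also have "\<dots> = jacobi_endpoint_square \<alpha> \<beta> 0"
      using g(1) by (simp add: jacobi_endpoint_square_def power2_eq_square)
    finally have "c\<^sup>2 = jacobi_endpoint_square \<alpha> \<beta> 0" .
    then show ?case using cpos by (simp add: c)
  next
    case (Suc n)
    note ab = Suc.prems(1,2) and P = Suc.prems(4)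
    define l where "l = jacobi_eigenvalue \<alpha> \<beta> (Suc n)"
    have l: "0 < l" unfolding l_def using ab by (intro jacobi_eigenvalue_Suc_pos) auto
    define y where "y = poly (smult (1 / sqrt l) (pderiv (P (Suc n)))) 1"
    have IH: "0 < y" "y\<^sup>2 = jacobi_endpoint_square (\<alpha> + 1) (\<beta> + 1) n"
      using Suc.IH[OF _ _ _ jacobi_derivative_orthonormal[OF ab P]] Suc.prems by (auto simp: y_def l_def)
    have eq: "poly (P (Suc n)) 1 = 2 * (\<alpha> + 1) / sqrt l * y"
      using jacobi_derivative_at_one[OF ab P, of "Suc n"] l
      by (simp add: y_def field_simps flip: l_def)
    have pos: "0 < poly (P (Suc n)) 1" unfolding eq using IH l ab by simp
    have "(poly (P (Suc n)) 1)\<^sup>2 = 4 * (\<alpha> + 1)\<^sup>2 / l * jacobi_endpoint_square (\<alpha> + 1) (\<beta> + 1) n"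
      unfolding eq using l by (simp only: power_mult_distrib power_divide IH) simp
    also have "\<dots> = jacobi_endpoint_square \<alpha> \<beta> (Suc n)"
    proof -
      define G1 where "G1 = Gamma (real n + (\<alpha> + 1) + 1)"
      define G2 where "G2 = Gamma (real n + (\<alpha> + \<beta> + 2))"
      define G3 where "G3 = Gamma (real n + (\<beta> + 1) + 1)"
      define G4 where "G4 = Gamma (\<alpha> + 1)"
      define T where "T = 2 powr (\<alpha> + \<beta> + 1)"
      have g: "G3 > 0" "G4 > 0" "T > 0" using ab by (auto simp: G3_def G4_def T_def intro!: Gamma_real_pos)
      have e1: "Gamma (real n + (\<alpha> + 1 + 1)) = G1" "Gamma (real n + (\<beta> + 1 + 1)) = G3"
        "Gamma (real (Suc n) + (\<alpha> + 1)) = G1" "Gamma (real (Suc n) + (\<beta> + 1)) = G3"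
        "Gamma (real (Suc n) + (\<alpha> + \<beta> + 1)) = G2"
        by (simp_all add: G1_def G3_def G2_def algebra_simps)
      have "real n + (\<alpha> + \<beta> + 2) > 0" using Suc.prems by simp
      then have "real n + (\<alpha> + \<beta> + 2) \<notin> \<int>\<^sub>\<le>\<^sub>0" using nonpos_Ints_nonpos by force
      then have e2: "Gamma (real n + (\<alpha> + 1 + (\<beta> + 1) + 1)) = (real n + (\<alpha> + \<beta> + 2)) * G2"
        using Gamma_plus1[of "real n + (\<alpha> + \<beta> + 2)"] by (simp add: G2_def algebra_simps)
      have "\<alpha> + 1 \<notin> \<int>\<^sub>\<le>\<^sub>0" using ab nonpos_Ints_nonpos by force
      then have e3: "Gamma (\<alpha> + 1 + 1) = (\<alpha> + 1) * G4"
        using Gamma_plus1[of "\<alpha> + 1"] by (simp add: G4_def)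
      have "(2::real) powr (\<alpha> + 1 + (\<beta> + 1) + 1) = 2 powr ((\<alpha> + \<beta> + 1) + 2)" by (simp add: algebra_simps)
      then have e4: "(2::real) powr (\<alpha> + 1 + (\<beta> + 1) + 1) = 4 * T"
        using powr_add[of 2 "\<alpha> + \<beta> + 1" 2] by (simp add: T_def)
      have e5: "l = (real n + 1) * (real n + (\<alpha> + \<beta> + 2))" by (simp add: l_def jacobi_eigenvalue_def algebra_simps)
      have e6: "2 * real (Suc n) + (\<alpha> + \<beta> + 1) = 2 * real n + (\<alpha> + 1 + (\<beta> + 1) + 1)" by simp
      have nz: "real n + 1 \<noteq> 0" "real n + (\<alpha> + \<beta> + 2) \<noteq> 0" "\<alpha> + 1 \<noteq> 0" using Suc.prems by auto
      have gen: "4 * a\<^sup>2 / (m * s) * (K / (4 * T) * G1 * (s * G2) / (f * G3 * (a * G4)\<^sup>2))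
          = K / T * G1 * G2 / (m * f * G3 * G4\<^sup>2)"
        if "a \<noteq> 0" "m \<noteq> 0" "s \<noteq> 0" "f \<noteq> 0" for a m s f K :: real
        using that g by (simp add: field_simps power2_eq_square)
      show ?thesis
        unfolding jacobi_endpoint_square_def e1 e2 e3 e4 e5 e6 fact_Suc T_def[symmetric] G4_def[symmetric]
        using gen[OF nz(3,1,2), of "fact n" "2 * real n + (\<alpha> + 1 + (\<beta> + 1) + 1)"] by (simp add: add.commute)
    qed
    finally show ?case using pos by blast
  qed
  then show "0 < poly (P n) 1" and "(poly (P n) 1)\<^sup>2 = jacobi_endpoint_square \<alpha> \<beta> n" by auto
qed

text \<open>
  Gauss' product formula for the Gamma function gives the limit for positive z; the remaining z
  follow by one step of the functional equation.
\<close>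

lemma Gamma_ratio_tendsto:
  assumes "-1 < (z::real)"
  shows "(\<lambda>n. Gamma (real n + (z + 1)) / (fact n * real n powr z)) \<longlonglongrightarrow> 1"
proof -
  have *: "(\<lambda>n. Gamma (real n + (w + 1)) / (fact n * real n powr w)) \<longlonglongrightarrow> 1" if "0 < w" for w
  proof -
    have nw: "w \<notin> \<int>\<^sub>\<le>\<^sub>0" using that nonpos_Ints_nonpos by force
    have G: "Gamma w > 0" using that by (rule Gamma_real_pos)
    have "(\<lambda>n. Gamma w / Gamma_series w n) \<longlonglongrightarrow> Gamma w / Gamma w"
      using G by (intro tendsto_intros) auto
    then have "(\<lambda>n. Gamma w / Gamma_series w n) \<longlonglongrightarrow> 1" using G by simp
    then show ?thesis
    proof (rule Lim_transform_eventually)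
      show "eventually (\<lambda>n. Gamma w / Gamma_series w n = Gamma (real n + (w + 1)) / (fact n * real n powr w)) sequentially"
        using eventually_gt_at_top[of 0]
      proof eventually_elim
        case (elim n)
        have "Gamma_series w n = fact n * real n powr w / (Gamma (real n + (w + 1)) / Gamma w)"
          using elim pochhammer_Gamma[OF nw, of "n + 1"]
          by (simp add: Gamma_series_def powr_def add_ac)
        moreover have "Gamma (real n + (w + 1)) > 0" using that by (intro Gamma_real_pos) auto
        ultimately show ?case using G elim by simp
      qed
    qed
  qed
  have "(\<lambda>n. Gamma (real n + (z + 1 + 1)) / (fact n * real n powr (z + 1)) * (real n / (real n + (z + 1)))) \<longlonglongrightarrow> 1 * 1"
  proof (intro tendsto_mult *)
    show "(\<lambda>n. real n / (real n + (z + 1))) \<longlonglongrightarrow> 1" by real_asymp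
  qed (use assms in auto)
  then have "(\<lambda>n. Gamma (real n + (z + 1 + 1)) / (fact n * real n powr (z + 1)) * (real n / (real n + (z + 1)))) \<longlonglongrightarrow> 1" by simp
  then show ?thesis
  proof (rule Lim_transform_eventually)
    show "eventually (\<lambda>n. Gamma (real n + (z + 1 + 1)) / (fact n * real n powr (z + 1)) * (real n / (real n + (z + 1)))
        = Gamma (real n + (z + 1)) / (fact n * real n powr z)) sequentially"
      using eventually_gt_at_top[of 0]
    proof eventually_elim
      case (elim n)
      have p: "real n + (z + 1) > 0" using assms by simp
      then have "real n + (z + 1) \<notin> \<int>\<^sub>\<le>\<^sub>0" using nonpos_Ints_nonpos by force
      then have "Gamma (real n + (z + 1 + 1)) = (real n + (z + 1)) * Gamma (real n + (z + 1))"
        using Gamma_plus1[of "real n + (z + 1)"] by (simp add: add_ac)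
      then show ?case using elim p by (simp add: powr_add)
    qed
  qed
qed

lemma positive_sequence_bounded_below:
  fixes f :: "nat \<Rightarrow> real"
  assumes "f \<longlonglongrightarrow> l" "0 < l" "\<And>n. n \<ge> 1 \<Longrightarrow> 0 < f n"
  shows "\<exists>c>0. \<forall>n\<ge>1. c \<le> f n"
proof -
  have "eventually (\<lambda>n. l / 2 < f n) sequentially"
    using assms by (intro order_tendstoD(1)[OF assms(1)]) auto
  then obtain N where N: "\<And>n. n \<ge> N \<Longrightarrow> l / 2 < f n" unfolding eventually_sequentially by auto
  define c where "c = Min (insert (l / 2) (f ` {1..N}))"
  have "0 < c" using assms by (auto simp: c_def)
  moreover have "c \<le> f n" if "n \<ge> 1" for n
  proof (cases "n \<le> N")
    case True
    then show ?thesis unfolding c_def using that by (intro Min_le) auto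
  next
    case False
    have "c \<le> l / 2" unfolding c_def by (intro Min_le) auto
    then show ?thesis using N[of n] False by simp
  qed
  ultimately show ?thesis by blast
qed

lemma jacobi_endpoint_square_growth:
  assumes "-1 < \<alpha>" "-1 < \<beta>" "0 < \<alpha> + \<beta> + 1"
  shows "\<exists>c>0. \<forall>n\<ge>1. c * real n powr (2 * \<alpha> + 1) \<le> jacobi_endpoint_square \<alpha> \<beta> n"
proof -
  define s where "s = \<alpha> + \<beta>"
  define u where "u = (\<lambda>z n. Gamma (real n + (z + 1)) / (fact n * real n powr z))"
  have G: "Gamma (\<alpha> + 1) > 0" using assms by (intro Gamma_real_pos) auto
  define r where "r = (\<lambda>n. (2 + (s + 1) / real n) / 2 powr (s + 1) * u \<alpha> n * u s n / u \<beta> n / (Gamma (\<alpha> + 1))\<^sup>2)"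
  from G have Gsq: "0 < (Gamma (\<alpha> + 1))\<^sup>2" by simp
  then have G2: "(Gamma (\<alpha> + 1))\<^sup>2 \<noteq> 0" by simp
  have lim0: "(\<lambda>n. (s + 1) / real n) \<longlonglongrightarrow> 0" by real_asymp
  have "r \<longlonglongrightarrow> (2 + 0) / 2 powr (s + 1) * 1 * 1 / 1 / (Gamma (\<alpha> + 1))\<^sup>2"
    unfolding r_def u_def using assms
    by (intro tendsto_intros Gamma_ratio_tendsto lim0 G2) (auto simp: s_def)
  moreover have upos: "0 < u z n" if "-1 < z" "n \<ge> 1" for z n
    using that by (auto simp: u_def intro!: divide_pos_pos Gamma_real_pos)
  have "0 < r n" if "n \<ge> 1" for n
    unfolding r_def using upos[OF _ that] assms that
    by (intro divide_pos_pos mult_pos_pos Gsq) (auto simp: s_def intro!: add_pos_nonneg)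
  ultimately obtain c where c: "c > 0" "\<And>n. n \<ge> 1 \<Longrightarrow> c \<le> r n"
    using positive_sequence_bounded_below[of r "(2 + 0) / 2 powr (s + 1) * 1 * 1 / 1 / (Gamma (\<alpha> + 1))\<^sup>2"] Gsq
    by (auto simp: zero_less_divide_iff simp del: zero_less_power2)
  have "jacobi_endpoint_square \<alpha> \<beta> n = r n * real n powr (2 * \<alpha> + 1)" if "n \<ge> 1" for n
  proof -
    have n: "real n > 0" using that by simp
    have Gu: "Gamma (real n + (z + 1)) = u z n * (fact n * real n powr z)" for z
      using n by (simp add: u_def)
    have "2 * real n + (s + 1) = (2 + (s + 1) / real n) * real n" using n by (simp add: field_simps)
    moreover have "X * m / T * (a * (f * A)) * (b * (f * B)) / (f * (c * (f * C)) * g)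
        = X / T * a * b / c / g * (m * (A * B / C))" if "f \<noteq> 0" for X m T a b c f g A B C :: real
      using that by (simp add: mult_ac)
    ultimately have "jacobi_endpoint_square \<alpha> \<beta> n = r n * (real n * (real n powr \<alpha> * real n powr s / real n powr \<beta>))"
      unfolding jacobi_endpoint_square_def r_def s_def[symmetric] Gu
      by (simp only: fact_nonzero not_False_eq_True)
    also have "real n * (real n powr \<alpha> * real n powr s / real n powr \<beta>) = real n powr (2 * \<alpha> + 1)"
    proof -
      have "real n powr (2 * \<alpha> + 1) = real n powr (1 + (\<alpha> + s - \<beta>))" by (simp add: s_def add.commute)
      also have "\<dots> = real n powr 1 * (real n powr \<alpha> * real n powr s / real n powr \<beta>)"
        by (simp only: powr_add powr_diff)
      finally show ?thesis using n by simp
    qed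
    finally show ?thesis .
  qed
  then show ?thesis using c by (intro exI[of _ c]) (auto intro!: mult_right_mono)
qed

lemma jacobi_endpoint_square_mono:
  assumes "-1 < \<beta>" "\<beta> \<le> \<alpha>" "0 < \<alpha> + \<beta> + 1"
  shows "jacobi_endpoint_square \<beta> \<alpha> n \<le> jacobi_endpoint_square \<alpha> \<beta> n"
proof -
  have pos: "Gamma (real n + (\<alpha> + 1)) > 0" "Gamma (real n + (\<beta> + 1)) > 0" "Gamma (\<alpha> + 1) > 0" "Gamma (\<beta> + 1) > 0"
    "Gamma (real n + (\<alpha> + \<beta> + 1)) > 0"
    using assms by (auto intro!: Gamma_real_pos)
  have nz: "\<alpha> + 1 \<notin> \<int>\<^sub>\<le>\<^sub>0" "\<beta> + 1 \<notin> \<int>\<^sub>\<le>\<^sub>0" using assms nonpos_Ints_nonpos by force+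
  have "pochhammer (\<beta> + 1) n \<le> pochhammer (\<alpha> + 1) n"
    unfolding pochhammer_prod using assms by (intro prod_mono) auto
  then have le: "Gamma (real n + (\<beta> + 1)) / Gamma (\<beta> + 1) \<le> Gamma (real n + (\<alpha> + 1)) / Gamma (\<alpha> + 1)"
    unfolding pochhammer_Gamma[OF nz(1)] pochhammer_Gamma[OF nz(2)] by (simp only: add.commute)
  define K where "K = (2 * real n + (\<alpha> + \<beta> + 1)) / 2 powr (\<alpha> + \<beta> + 1) * Gamma (real n + (\<alpha> + \<beta> + 1))
      / (fact n * Gamma (real n + (\<alpha> + 1)) * Gamma (real n + (\<beta> + 1)))"
  have K: "K \<ge> 0" unfolding K_def using pos assms by auto
  have "jacobi_endpoint_square \<alpha> \<beta> n = K * (Gamma (real n + (\<alpha> + 1)) / Gamma (\<alpha> + 1))\<^sup>2"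
    "jacobi_endpoint_square \<beta> \<alpha> n = K * (Gamma (real n + (\<beta> + 1)) / Gamma (\<beta> + 1))\<^sup>2"
    unfolding jacobi_endpoint_square_def K_def add.commute[of \<beta> \<alpha>] using pos
    by (simp_all add: field_simps power2_eq_square)
  then show ?thesis using K le pos by (auto intro!: mult_left_mono power_mono)
qed

section \<open>Concentration near an endpoint\<close>

context
  fixes \<alpha> \<beta> :: real and P :: "nat \<Rightarrow> real poly" and n :: nat
  assumes ab: "-1/2 < \<alpha>" "-1/2 < \<beta>" and P: "orthonormal_jacobi \<alpha> \<beta> P"
    and max: "\<bar>poly (P n) (-1)\<bar> \<le> poly (P n) 1"
begin

text \<open>
  By the differential equation, the derivative of S = l y^2 + (1 - x^2) y'^2 is 2 y'^2 times the linear
  function (\<alpha> + \<beta> + 1) x + \<alpha> - \<beta>, which has positive slope. So S decreases and then increases, and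
  is at most the larger of its endpoint values l y(1)^2 and l y(-1)^2.
\<close>

lemma jacobi_sonin_bound:
  assumes x: "-1 \<le> x" "x \<le> 1"
  shows "jacobi_eigenvalue \<alpha> \<beta> n * (poly (P n) x)\<^sup>2 + (1 - x\<^sup>2) * (poly (pderiv (P n)) x)\<^sup>2
     \<le> jacobi_eigenvalue \<alpha> \<beta> n * (poly (P n) 1)\<^sup>2"
proof -
  define l where "l = jacobi_eigenvalue \<alpha> \<beta> n"
  define y y1 y2 where "y = poly (P n)" and "y1 = poly (pderiv (P n))" and "y2 = poly (pderiv (pderiv (P n)))"
  have l: "0 \<le> l" unfolding l_def using ab by (intro jacobi_eigenvalue_nonneg) auto
  define S where "S = (\<lambda>x. l * (y x)\<^sup>2 + (1 - x\<^sup>2) * (y1 x)\<^sup>2)"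
  define d where "d = (\<lambda>x. 2 * (y1 x)\<^sup>2 * ((\<alpha> + \<beta> + 1) * x + (\<alpha> - \<beta>)))"
  have ode: "(1 - t\<^sup>2) * y2 t + (\<beta> - \<alpha> - (\<alpha> + \<beta> + 2) * t) * y1 t = - l * y t" for t
    using arg_cong[OF jacobi_differential_equation[OF _ _ P, of n], of "\<lambda>q. poly q t"] ab
    by (simp add: jacobi_op_def l_def y_def y1_def y2_def power2_eq_square algebra_simps)
  have S': "(S has_real_derivative d t) (at t)" for t
  proof -
    have "(S has_real_derivative (2 * l * y t * y1 t + ((1 - t\<^sup>2) * (2 * y1 t * y2 t) - 2 * t * (y1 t)\<^sup>2))) (at t)"
      unfolding S_def y_def y1_def y2_def
      by (auto intro!: derivative_eq_intros poly_DERIV simp: power2_eq_square algebra_simps)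
    moreover have "(1 - t\<^sup>2) * (2 * y1 t * y2 t) = 2 * y1 t * (- l * y t - (\<beta> - \<alpha> - (\<alpha> + \<beta> + 2) * t) * y1 t)"
      unfolding ode[symmetric] by (simp add: algebra_simps)
    then have "2 * l * y t * y1 t + ((1 - t\<^sup>2) * (2 * y1 t * y2 t) - 2 * t * (y1 t)\<^sup>2) = d t"
      by (simp add: d_def algebra_simps power2_eq_square)
    ultimately show ?thesis by simp
  qed
  define x0 where "x0 = (\<beta> - \<alpha>) / (\<alpha> + \<beta> + 1)"
  have s: "\<alpha> + \<beta> + 1 > 0" using ab by simp
  have "0 \<le> (\<alpha> + \<beta> + 1) * t + (\<alpha> - \<beta>)" if "x0 \<le> t" for t
    using that s by (simp add: x0_def field_simps)
  moreover have "(\<alpha> + \<beta> + 1) * t + (\<alpha> - \<beta>) \<le> 0" if "t \<le> x0" for t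
    using that s by (simp add: x0_def field_simps)
  ultimately have sgn: "x0 \<le> t \<Longrightarrow> 0 \<le> d t" "t \<le> x0 \<Longrightarrow> d t \<le> 0" for t
    unfolding d_def by (auto intro!: mult_nonneg_nonneg mult_nonneg_nonpos)
  have "S x \<le> max (S 1) (S (-1))"
  proof (cases "x0 \<le> x")
    case True
    have "S x \<le> S 1"
      by (rule DERIV_nonneg_imp_nondecreasing) (use True x S' sgn in \<open>force+\<close>)
    then show ?thesis by simp
  next
    case False
    have "S (-1) \<ge> S x"
      by (rule DERIV_nonpos_imp_nonincreasing) (use False x S' sgn in \<open>force+\<close>)
    then show ?thesis by simp
  qed
  also have "\<dots> = l * (y 1)\<^sup>2"
  proof -
    have "(y (-1))\<^sup>2 \<le> (y 1)\<^sup>2" using max by (intro abs_le_square_iff[THEN iffD1]) (auto simp: y_def)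
    then show ?thesis using l by (auto simp: S_def intro!: max_absorb1 mult_left_mono)
  qed
  finally show ?thesis by (simp add: S_def l_def y_def y1_def)
qed

lemma jacobi_max_at_one:
  assumes x: "-1 \<le> x" "x \<le> 1"
  shows "\<bar>poly (P n) x\<bar> \<le> poly (P n) 1"
proof (cases n)
  case 0
  then have "degree (P n) = 0" using jacobi_degree[OF _ _ P, of n] ab by simp
  then obtain c where "P n = [:c:]" by (metis degree_eq_zeroE)
  then show ?thesis using max by simp
next
  case (Suc m)
  have l: "0 < jacobi_eigenvalue \<alpha> \<beta> n" unfolding Suc using ab by (intro jacobi_eigenvalue_Suc_pos) auto
  have "x\<^sup>2 \<le> 1" using x by (simp add: abs_square_le_1 abs_le_iff)
  then have "jacobi_eigenvalue \<alpha> \<beta> n * (poly (P n) x)\<^sup>2 \<le> jacobi_eigenvalue \<alpha> \<beta> n * (poly (P n) 1)\<^sup>2"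
    using jacobi_sonin_bound[OF x] by (smt (verit) mult_nonneg_nonneg zero_le_power2)
  then have "(poly (P n) x)\<^sup>2 \<le> (poly (P n) 1)\<^sup>2" using l by simp
  then show ?thesis using max by (simp add: abs_le_square_iff[symmetric])
qed

text \<open>
  The Sonin bound gives |y'| \<le> sqrt(l) M / sqrt(1 - x) on [0, 1], where M is the value at 1.
  Integrated from x to 1 it shows that y falls by at most 2 M sqrt(l (1 - x)), that is by at most M / 2.
\<close>

lemma jacobi_large_near_one:
  assumes d: "0 \<le> x" "x \<le> 1" "16 * jacobi_eigenvalue \<alpha> \<beta> n * (1 - x) \<le> 1"
  shows "poly (P n) 1 / 2 \<le> poly (P n) x"
proof -
  define l where "l = jacobi_eigenvalue \<alpha> \<beta> n"
  define M where "M = poly (P n) 1"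
  have M: "0 \<le> M" using max by (simp add: M_def)
  have l: "0 \<le> l" unfolding l_def using ab by (intro jacobi_eigenvalue_nonneg) auto
  \<comment> \<open>Comparison with an antiderivative replaces the integration.\<close>
  define f where "f = (\<lambda>t. poly (P n) t + 2 * (sqrt l * M) * sqrt (1 - t))"
  have "f 1 \<le> f x"
  proof (rule DERIV_nonpos_imp_decreasing_open[OF d(2)])
    fix t assume t: "x < t" "t < 1"
    have "(1 - t\<^sup>2) * (poly (pderiv (P n)) t)\<^sup>2 \<le> l * M\<^sup>2"
      using jacobi_sonin_bound[of t] t d l
      by (smt (verit) M_def l_def mult_nonneg_nonneg zero_le_power2)
    moreover have "(1 - t) \<le> 1 - t\<^sup>2" using t d by (simp add: power2_eq_square mult_left_le)
    ultimately have "(1 - t) * (poly (pderiv (P n)) t)\<^sup>2 \<le> l * M\<^sup>2"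
      by (meson mult_right_mono order_trans zero_le_power2)
    then have "sqrt ((1 - t) * (poly (pderiv (P n)) t)\<^sup>2) \<le> sqrt (l * M\<^sup>2)" by simp
    then have "sqrt (1 - t) * \<bar>poly (pderiv (P n)) t\<bar> \<le> sqrt l * M" using M by (simp add: real_sqrt_mult)
    then have "poly (pderiv (P n)) t - sqrt l * M / sqrt (1 - t) \<le> 0"
      using t by (simp add: field_simps) (smt (verit) mult_left_mono real_sqrt_ge_zero)
    moreover have "DERIV f t :> poly (pderiv (P n)) t - sqrt l * M / sqrt (1 - t)"
      unfolding f_def using t
      by (auto intro!: derivative_eq_intros poly_DERIV simp: field_simps)
    ultimately show "\<exists>y. DERIV f t :> y \<and> y \<le> 0" by blast
  next
    show "continuous_on {x..1} f" unfolding f_def by (intro continuous_intros)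
  qed
  then have "M \<le> poly (P n) x + 2 * M * sqrt (l * (1 - x))"
    using d by (simp add: f_def M_def real_sqrt_mult mult_ac)
  also have "sqrt (l * (1 - x)) \<le> 1 / 4"
    using d by (intro real_le_lsqrt) (auto simp: l_def power2_eq_square)
  then have "2 * M * sqrt (l * (1 - x)) \<le> 2 * M * (1 / 4)" using M by (intro mult_left_mono) auto
  finally show ?thesis by (simp add: M_def)
qed

end

text \<open>
  Between the distances \<delta> / 2 and \<delta> from the endpoint the weight is comparable to \<delta>^\<alpha>, and this
  part alone is large enough.
\<close>

lemma measure_jacobi_near_one:
  assumes "-1 < \<alpha>" "-1 < \<beta>"
  shows "\<exists>c>0. \<forall>\<delta>. 0 < \<delta> \<and> \<delta> \<le> 1 \<longrightarrow> c * \<delta> powr (\<alpha> + 1) \<le> measure (jacobi_measure \<alpha> \<beta>) {1-\<delta><..<1}"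
proof (intro exI[of _ "min 1 (2 powr - \<alpha>) * min 1 (2 powr \<beta>) / 2"] conjI allI impI)
  show "0 < min 1 (2 powr - \<alpha>) * min 1 (2 powr \<beta>) / 2" by (simp add: min_def)
  fix \<delta> :: real assume d: "0 < \<delta> \<and> \<delta> \<le> 1"
  interpret finite_measure "jacobi_measure \<alpha> \<beta>" by (rule finite_measure_jacobi[OF assms])
  define K where "K = \<delta> powr \<alpha> * (min 1 (2 powr - \<alpha>) * min 1 (2 powr \<beta>))"
  have K: "0 \<le> K" by (simp add: K_def min_def)
  have low: "K \<le> jacobi_weight \<alpha> \<beta> x" if x: "1 - \<delta> < x" "x < 1 - \<delta> / 2" for x
  proof -
    have "\<delta> powr \<alpha> * min 1 (2 powr - \<alpha>) \<le> (1 - x) powr \<alpha>"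
    proof (cases "0 \<le> \<alpha>")
      case True
      have "\<delta> powr \<alpha> * min 1 (2 powr - \<alpha>) \<le> \<delta> powr \<alpha> * (2 powr - \<alpha>)" by (intro mult_left_mono) auto
      also have "\<dots> = (\<delta> / 2) powr \<alpha>" using d by (simp add: powr_divide powr_minus field_simps)
      also have "\<dots> \<le> (1 - x) powr \<alpha>" using x d True by (intro powr_mono2) auto
      finally show ?thesis .
    next
      case False
      have "\<delta> powr \<alpha> * min 1 (2 powr - \<alpha>) \<le> \<delta> powr \<alpha> * 1" by (intro mult_left_mono) auto
      also have "\<dots> \<le> (1 - x) powr \<alpha>" using x d False by (simp add: powr_mono2')
      finally show ?thesis .
    qed
    moreover have "min 1 (2 powr \<beta>) \<le> (1 + x) powr \<beta>"
    proof (cases "0 \<le> \<beta>")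
      case True
      have "1 \<le> (1 + x) powr \<beta>" using True x d by (intro ge_one_powr_ge_zero) auto
      then show ?thesis by simp
    next
      case False
      have "2 powr \<beta> \<le> (1 + x) powr \<beta>" using False x d by (intro powr_mono2') auto
      then show ?thesis by simp
    qed
    ultimately have "\<delta> powr \<alpha> * min 1 (2 powr - \<alpha>) * min 1 (2 powr \<beta>) \<le> (1 - x) powr \<alpha> * (1 + x) powr \<beta>"
      by (intro mult_mono) (auto simp: min_def)
    then show ?thesis using x d by (simp add: K_def jacobi_weight_def mult_ac)
  qed
  have "ennreal (K * (\<delta> / 2)) = (\<integral>\<^sup>+x. ennreal K * indicator {1-\<delta><..<1-\<delta>/2} x \<partial>lborel)"
    using d ennreal_mult[OF K, of "\<delta> / 2"] by (simp add: nn_integral_cmult_indicator)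
  also have "\<dots> \<le> (\<integral>\<^sup>+x. ennreal (jacobi_weight \<alpha> \<beta> x) * indicator {1-\<delta><..<1} x \<partial>lborel)"
    using d low by (intro nn_integral_mono) (auto simp: indicator_def intro!: ennreal_leI)
  also have "\<dots> = emeasure (jacobi_measure \<alpha> \<beta>) {1-\<delta><..<1}"
    by (simp add: jacobi_measure_density emeasure_density)
  also have "\<dots> = ennreal (measure (jacobi_measure \<alpha> \<beta>) {1-\<delta><..<1})"
    by (rule emeasure_eq_measure)
  finally have "K * (\<delta> / 2) \<le> measure (jacobi_measure \<alpha> \<beta>) {1-\<delta><..<1}"
    by (simp add: ennreal_le_iff)
  also have "K * (\<delta> / 2) = min 1 (2 powr - \<alpha>) * min 1 (2 powr \<beta>) / 2 * \<delta> powr (\<alpha> + 1)"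
    using d by (simp add: K_def powr_add)
  finally show "min 1 (2 powr - \<alpha>) * min 1 (2 powr \<beta>) / 2 * \<delta> powr (\<alpha> + 1)
      \<le> measure (jacobi_measure \<alpha> \<beta>) {1-\<delta><..<1}" .
qed

lemma jacobi_measure_reflect: "jacobi_measure \<beta> \<alpha> = distr (jacobi_measure \<alpha> \<beta>) borel uminus"
proof -
  have "jacobi_measure \<beta> \<alpha> = density (distr lborel borel uminus) (jacobi_weight \<beta> \<alpha>)"
    by (simp add: jacobi_measure_density lborel_distr_uminus)
  also have "\<dots> = distr (density lborel (\<lambda>x. ennreal (jacobi_weight \<beta> \<alpha> (- x)))) borel uminus"
    by (subst density_distr) auto
  also have "(\<lambda>x. ennreal (jacobi_weight \<beta> \<alpha> (- x))) = jacobi_weight \<alpha> \<beta>"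
    by (auto simp: jacobi_weight_def fun_eq_iff indicator_def)
  finally show ?thesis by (simp add: jacobi_measure_density)
qed

lemma orthonormal_jacobi_reflect:
  assumes "orthonormal_jacobi \<alpha> \<beta> P"
  shows "orthonormal_jacobi \<beta> \<alpha> (\<lambda>n. smult ((-1) ^ n) (pcompose (P n) [:0, -1:]))"
proof -
  have deg: "degree (P n) = n" and lead: "lead_coeff (P n) > 0" for n
    using assms unfolding orthonormal_jacobi_def by blast+
  have inner: "(\<integral>x. poly (P n) x * poly (P m) x \<partial>jacobi_measure \<alpha> \<beta>) = (if n = m then 1 else 0)" for n m
    using assms unfolding orthonormal_jacobi_def by blast
  let ?Q = "\<lambda>n. smult ((-1) ^ n) (pcompose (P n) [:0, -1:])"
  have "degree (?Q n) = n" for n using deg[of n] by (simp add: degree_pcompose)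
  moreover have "lead_coeff (?Q n) = lead_coeff (P n)" for n
  proof -
    have "lead_coeff (?Q n) = (-1) ^ n * lead_coeff (pcompose (P n) [:0, -1:])" by (rule lead_coeff_smult)
    also have "\<dots> = (-1) ^ n * (lead_coeff (P n) * (-1) ^ n)" 
      by (subst lead_coeff_comp) (auto simp: deg)
    also have "\<dots> = lead_coeff (P n)" by (simp add: power_mult_distrib[symmetric] mult.commute mult.left_commute)
    finally show ?thesis .
  qed
  moreover have "(\<integral>x. poly (?Q n) x * poly (?Q m) x \<partial>jacobi_measure \<beta> \<alpha>) = (if n = m then 1 else 0)" for n m
  proof -
    have "(\<integral>x. poly (?Q n) x * poly (?Q m) x \<partial>jacobi_measure \<beta> \<alpha>)
      = (\<integral>x. poly (?Q n) (-x) * poly (?Q m) (-x) \<partial>jacobi_measure \<alpha> \<beta>)"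
      unfolding jacobi_measure_reflect[of \<beta> \<alpha>] by (rule integral_distr) auto
    also have "\<dots> = (\<integral>x. ((-1) ^ n * (-1) ^ m) * (poly (P n) x * poly (P m) x) \<partial>jacobi_measure \<alpha> \<beta>)"
      by (simp add: poly_pcompose mult_ac)
    also have "\<dots> = ((-1) ^ n * (-1) ^ m) * (if n = m then 1 else 0)"
      by (simp only: inner integral_mult_right_zero)
    also have "\<dots> = (if n = m then 1 else 0)" by (simp flip: power_mult_distrib)
    finally show ?thesis .
  qed
  ultimately show ?thesis unfolding orthonormal_jacobi_def using lead by presburger
qed

definition concentrated :: "real measure \<Rightarrow> (nat \<Rightarrow> real poly) \<Rightarrow> real \<Rightarrow> nat \<Rightarrow> real set \<Rightarrow> (nat \<Rightarrow> real) \<Rightarrow> bool" where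
  "concentrated \<mu> P c n E M \<longleftrightarrow> E \<in> sets borel \<and> 0 < measure \<mu> E \<and>
     (\<forall>k\<in>{n..<2*n}. 0 < M k \<and> (\<forall>x. -1 < x \<and> x < 1 \<longrightarrow> \<bar>poly (P k) x\<bar> \<le> M k) \<and>
        (\<exists>\<sigma>\<in>{-1, 1}. \<forall>x\<in>E. M k / 2 \<le> \<sigma> * poly (P k) x) \<and>
        c / real n \<le> (M k)\<^sup>2 * measure \<mu> E)"

text \<open>
  If \<beta> \<le> \<alpha>, the maximum is attained at 1. Its square grows like n^(2 \<alpha> + 1), while an interval of length
  \<delta> at 1 has measure at least a multiple of \<delta>^(\<alpha> + 1); the eigenvalues for degrees below 2n are
  at most a multiple of n^2, which allows \<delta> to be a multiple of n^(-2).
\<close>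

lemma jacobi_concentration_aux:
  assumes ab: "-1/2 < \<alpha>" "-1/2 < \<beta>" "\<beta> \<le> \<alpha>" and P: "orthonormal_jacobi \<alpha> \<beta> P"
  shows "\<exists>c>0. \<forall>n\<ge>1. \<exists>E M. concentrated (jacobi_measure \<alpha> \<beta>) P c n E M"
proof -
  have ab1: "-1 < \<alpha>" "-1 < \<beta>" "0 < \<alpha> + \<beta> + 1" using ab by auto
  obtain c1 where c1: "c1 > 0" "\<And>n. n \<ge> 1 \<Longrightarrow> c1 * real n powr (2 * \<alpha> + 1) \<le> jacobi_endpoint_square \<alpha> \<beta> n"
    using jacobi_endpoint_square_growth[OF ab1] by blast
  obtain c2 where c2: "c2 > 0"
    "\<And>\<delta>. 0 < \<delta> \<Longrightarrow> \<delta> \<le> 1 \<Longrightarrow> c2 * \<delta> powr (\<alpha> + 1) \<le> measure (jacobi_measure \<alpha> \<beta>) {1-\<delta><..<1}"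
    using measure_jacobi_near_one[OF ab1(1,2)] by blast
  define L where "L = 16 * (4 + 2 * (\<alpha> + \<beta> + 1))"
  have L: "L \<ge> 1" using ab1 by (simp add: L_def)
  define c where "c = c1 * (c2 * L powr - (\<alpha> + 1))"
  have "c > 0" using c1 c2 L by (simp add: c_def)
  moreover have "\<exists>E M. concentrated (jacobi_measure \<alpha> \<beta>) P c n E M" if n: "n \<ge> 1" for n
  proof -
    \<comment> \<open>The factor L n^2 bounds 16 times the eigenvalue for every degree below 2n.\<close>
    define \<delta> where "\<delta> = 1 / (L * (real n)\<^sup>2)"
    have n2: "(real n)\<^sup>2 \<ge> 1" using n by (simp add: one_le_power)
    then have "L * (real n)\<^sup>2 \<ge> 1" using L mult_mono[of 1 L 1 "(real n)\<^sup>2"] by simp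
    then have d: "0 < \<delta>" "\<delta> \<le> 1" by (auto simp: \<delta>_def)
    define E where "E = {1-\<delta><..<1}"
    define w where "w = measure (jacobi_measure \<alpha> \<beta>) E"
    have w: "c2 * \<delta> powr (\<alpha> + 1) \<le> w" unfolding w_def E_def by (rule c2(2)[OF d])
    have wpos: "0 < w" using w c2(1) d by (smt (verit) mult_pos_pos powr_gt_zero)
    have "0 < poly (P k) 1 \<and> (\<forall>x. -1 < x \<and> x < 1 \<longrightarrow> \<bar>poly (P k) x\<bar> \<le> poly (P k) 1) \<and>
        (\<forall>x\<in>E. poly (P k) 1 / 2 \<le> poly (P k) x) \<and> c / real n \<le> (poly (P k) 1)\<^sup>2 * w"
      if k: "k \<in> {n..<2*n}" for k
    proof -
      have pos: "0 < poly (P k) 1" and sq: "(poly (P k) 1)\<^sup>2 = jacobi_endpoint_square \<alpha> \<beta> k"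
        using jacobi_at_one[OF ab1 P] by auto
      have "(poly (P k) (-1))\<^sup>2 = jacobi_endpoint_square \<beta> \<alpha> k"
        using jacobi_at_one(2)[OF ab1(2,1) _ orthonormal_jacobi_reflect[OF P], of k] ab1
        by (simp add: poly_pcompose power_mult_distrib add_ac flip: power_mult)
      also have "\<dots> \<le> (poly (P k) 1)\<^sup>2"
        unfolding sq using ab ab1 by (intro jacobi_endpoint_square_mono) auto
      finally have max: "\<bar>poly (P k) (-1)\<bar> \<le> poly (P k) 1"
        using pos by (simp add: abs_le_square_iff[symmetric])
      have lam: "16 * jacobi_eigenvalue \<alpha> \<beta> k \<le> L * (real n)\<^sup>2"
      proof -
        have "real k * (real k + \<alpha> + \<beta> + 1) \<le> (2 * real n) * (2 * real n + (\<alpha> + \<beta> + 1) * real n)"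
        proof (intro mult_mono)
          have "(\<alpha> + \<beta> + 1) * 1 \<le> (\<alpha> + \<beta> + 1) * real n"
            using n ab1 by (intro mult_left_mono) auto
          moreover have "real k \<le> 2 * real n" using k by simp
          ultimately show "real k + \<alpha> + \<beta> + 1 \<le> 2 * real n + (\<alpha> + \<beta> + 1) * real n" by argo
        qed (use k ab1 in auto)
        then show ?thesis by (simp add: jacobi_eigenvalue_def L_def power2_eq_square algebra_simps)
      qed
      have "poly (P k) 1 / 2 \<le> poly (P k) x" if x: "x \<in> E" for x
      proof (rule jacobi_large_near_one[OF ab(1,2) P max])
        show "0 \<le> x" "x \<le> 1" using x d by (auto simp: E_def)
        have "16 * jacobi_eigenvalue \<alpha> \<beta> k * (1 - x) \<le> L * (real n)\<^sup>2 * \<delta>"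
          using x n2 L by (intro mult_mono[OF lam]) (auto simp: E_def)
        also have "\<dots> = 1" using n L by (simp add: \<delta>_def)
        finally show "16 * jacobi_eigenvalue \<alpha> \<beta> k * (1 - x) \<le> 1" .
      qed
      moreover have "c / real n \<le> (poly (P k) 1)\<^sup>2 * w"
      proof -
        have "real n powr (2 * \<alpha> + 1) \<le> real k powr (2 * \<alpha> + 1)"
          using k ab by (intro powr_mono2) auto
        then have "c1 * real n powr (2 * \<alpha> + 1) \<le> (poly (P k) 1)\<^sup>2"
          unfolding sq using c1(2)[of k] c1(1) k n by (smt (verit) atLeastLessThan_iff mult_left_mono order_trans)
        then have "(c1 * real n powr (2 * \<alpha> + 1)) * (c2 * \<delta> powr (\<alpha> + 1)) \<le> (poly (P k) 1)\<^sup>2 * w"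
          using w c1 c2 by (intro mult_mono) auto
        moreover have "\<delta> powr (\<alpha> + 1) = L powr - (\<alpha> + 1) * real n powr (- 2 * (\<alpha> + 1))"
        proof -
          have "\<delta> = L powr (-1) * real n powr (- 2)"
            using L n by (simp add: \<delta>_def powr_minus powr_numeral field_simps)
          then have "\<delta> powr (\<alpha> + 1) = (L powr (-1)) powr (\<alpha> + 1) * (real n powr (- 2)) powr (\<alpha> + 1)"
            by (simp only: powr_mult)
          then show ?thesis by (simp only: powr_powr) simp
        qed
        moreover have "real n powr (2 * \<alpha> + 1) * real n powr (- 2 * (\<alpha> + 1)) = 1 / real n"
        proof -
          have "real n powr (2 * \<alpha> + 1) * real n powr (- 2 * (\<alpha> + 1)) = real n powr (-1)"
            by (simp flip: powr_add)
          then show ?thesis using n by (simp add: powr_minus field_simps)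
        qed
        ultimately show ?thesis by (simp add: c_def mult_ac)
      qed
      moreover have "\<bar>poly (P k) x\<bar> \<le> poly (P k) 1" if "-1 < x" "x < 1" for x
        using jacobi_max_at_one[OF ab(1,2) P max] that by simp
      ultimately show ?thesis using pos by blast
    qed
    then show ?thesis using wpos
      by (intro exI[of _ E] exI[of _ "\<lambda>k. poly (P k) 1"]) (auto simp: concentrated_def w_def E_def)
  qed
  ultimately show ?thesis by blast
qed

text \<open>
  The case \<alpha> < \<beta> is reduced to the previous one by the reflection x \<mapsto> -x; the polynomials of odd
  degree then are negative near the endpoint -1, whence the signs.
\<close>

lemma jacobi_concentration:
  assumes ab: "-1/2 < \<alpha>" "-1/2 < \<beta>" and P: "orthonormal_jacobi \<alpha> \<beta> P"
  shows "\<exists>c>0. \<forall>n\<ge>1. \<exists>E M. concentrated (jacobi_measure \<alpha> \<beta>) P c n E M"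
proof (cases "\<beta> \<le> \<alpha>")
  case True
  then show ?thesis using jacobi_concentration_aux[OF ab _ P] by blast
next
  case False
  define Q where "Q = (\<lambda>n. smult ((-1) ^ n) (pcompose (P n) [:0, -1:]))"
  have Q: "orthonormal_jacobi \<beta> \<alpha> Q" unfolding Q_def by (rule orthonormal_jacobi_reflect[OF P])
  have polyP: "poly (P k) x = (-1) ^ k * poly (Q k) (- x)" for k x
    by (simp add: Q_def poly_pcompose flip: mult.assoc power_mult_distrib)
  have "\<alpha> \<le> \<beta>" using False by simp
  then obtain c where c: "c > 0" and H: "\<forall>n\<ge>1. \<exists>E M. concentrated (jacobi_measure \<beta> \<alpha>) Q c n E M"
    using jacobi_concentration_aux[OF ab(2,1) _ Q] by blast
  show ?thesis
  proof (intro exI[of _ c] conjI c allI impI)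
    fix n :: nat assume "n \<ge> 1"
    then obtain E M where con: "concentrated (jacobi_measure \<beta> \<alpha>) Q c n E M" using H by blast
    have E: "E \<in> sets borel" "0 < measure (jacobi_measure \<beta> \<alpha>) E"
      and M: "\<And>k. k \<in> {n..<2*n} \<Longrightarrow> 0 < M k \<and> (\<forall>x. -1 < x \<and> x < 1 \<longrightarrow> \<bar>poly (Q k) x\<bar> \<le> M k) \<and>
        (\<exists>\<sigma>\<in>{-1, 1}. \<forall>x\<in>E. M k / 2 \<le> \<sigma> * poly (Q k) x) \<and>
        c / real n \<le> (M k)\<^sup>2 * measure (jacobi_measure \<beta> \<alpha>) E"
      using con unfolding concentrated_def by blast+
    define E' where "E' = uminus -` E"
    have E': "E' \<in> sets borel" unfolding E'_def using measurable_sets[of uminus borel borel E] E by simp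
    have m: "measure (jacobi_measure \<alpha> \<beta>) E' = measure (jacobi_measure \<beta> \<alpha>) E"
      unfolding jacobi_measure_reflect[of \<beta> \<alpha>] using E by (simp add: measure_distr E'_def)
    have "\<exists>\<sigma>\<in>{-1, 1}. \<forall>x\<in>E'. M k / 2 \<le> \<sigma> * poly (P k) x" if k: "k \<in> {n..<2*n}" for k
    proof -
      obtain \<sigma> :: real where s: "\<sigma> \<in> {-1, 1}" "\<forall>x\<in>E. M k / 2 \<le> \<sigma> * poly (Q k) x" using M[OF k] by blast
      have sq: "(-1) ^ k * ((-1) ^ k * y) = y" for y :: real by (simp flip: mult.assoc power_mult_distrib)
      show ?thesis
      proof (rule bexI)
        show "(-1) ^ k * \<sigma> \<in> {-1, 1}" using s(1) by (cases "even k") auto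
        show "\<forall>x\<in>E'. M k / 2 \<le> ((-1) ^ k * \<sigma>) * poly (P k) x"
          using s(2) by (simp add: polyP E'_def mult.left_commute[of \<sigma>] mult.assoc sq)
      qed
    qed
    moreover have "\<bar>poly (P k) x\<bar> \<le> M k" if "k \<in> {n..<2*n}" "-1 < x" "x < 1" for k x
      using M[OF that(1)] that(2,3) by (auto simp: polyP abs_mult power_abs)
    ultimately show "\<exists>E M. concentrated (jacobi_measure \<alpha> \<beta>) P c n E M"
      using E E' M unfolding concentrated_def m by (intro exI[of _ E'] exI[of _ M]) (simp only: m, blast)
  qed
qed

section \<open>Failure of quasi-greediness for exponents other than 2\<close>

lemma unbounded_powr_contradiction:
  assumes "0 < (a::real)" "0 < e" "\<And>n::nat. 1 \<le> n \<Longrightarrow> a * real n powr e \<le> C"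
  shows False
proof -
  have "filterlim (\<lambda>n. a * real n powr e) at_top sequentially"
    using assms(1,2) by real_asymp
  then have "eventually (\<lambda>n. C < a * real n powr e) sequentially"
    by (simp add: filterlim_at_top_dense)
  then obtain N where "\<And>n. n \<ge> N \<Longrightarrow> C < a * real n powr e" unfolding eventually_sequentially by auto
  from this[of "max N 1"] assms(3)[of "max N 1"] show False by simp
qed

locale quasi_greedy_jacobi =
  fixes p \<alpha> \<beta> :: real and P :: "nat \<Rightarrow> real poly" and \<tau> :: "nat \<Rightarrow> nat"
  assumes p: "1 \<le> p" and ab: "-1/2 < \<alpha>" "-1/2 < \<beta>" and P: "orthonormal_jacobi \<alpha> \<beta> P" and bij_tau: "bij \<tau>"
    and qg: "quasi_greedy_basis (fun_scale :: 'k::{real_normed_field, banach, second_countable_topology} \<Rightarrow> (real \<Rightarrow> 'k) \<Rightarrow> real \<Rightarrow> 'k) (Lp_space p (jacobi_measure \<alpha> \<beta>))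
      (Lp_norm p (jacobi_measure \<alpha> \<beta>)) \<tau> (jacobi_system p (jacobi_measure \<alpha> \<beta>) P) (jacobi_functionals p (jacobi_measure \<alpha> \<beta>) P)"
begin

abbreviation \<mu> :: "real measure" where "\<mu> \<equiv> jacobi_measure \<alpha> \<beta>"

lemma ab1: "-1 < \<alpha>" "-1 < \<beta>" using ab by auto

sublocale finite_measure \<mu> by (rule finite_measure_jacobi[OF ab1])

sublocale quasi_greedy "fun_scale :: 'k \<Rightarrow> (real \<Rightarrow> 'k) \<Rightarrow> real \<Rightarrow> 'k" "Lp_space p \<mu>" "Lp_norm p \<mu>" \<tau>
  "jacobi_system p \<mu> P" "jacobi_functionals p \<mu> P"
  by (intro quasi_greedy.intro complete_seminormed_space_Lp p quasi_greedy_axioms.intro bij_tau qg)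

definition P_norm :: "nat \<Rightarrow> real" where "P_norm k = Lp_norm p \<mu> (poly (P k))"

definition normalized_P :: "nat \<Rightarrow> real \<Rightarrow> real" where "normalized_P k t = poly (P k) t / P_norm k"

lemma integrable_poly_powr: "0 < q \<Longrightarrow> integrable \<mu> (\<lambda>t. \<bar>poly r t\<bar> powr q)"
proof -
  assume q: "0 < q"
  obtain B where B: "\<And>x. -1 \<le> x \<Longrightarrow> x \<le> 1 \<Longrightarrow> \<bar>poly r x\<bar> \<le> B" using poly_bounded_unit_interval[of r] by blast
  show ?thesis
  proof (rule integrable_jacobi_bounded[OF ab1, where B = "B powr q"])
    show "norm (\<bar>poly r x\<bar> powr q) \<le> B powr q" if "-1 < x" "x < 1" for x
      using B[of x] that q by (auto intro: powr_mono2)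
  qed measurable
qed

lemma P_norm_powr: "P_norm k powr p = (\<integral>t. \<bar>poly (P k) t\<bar> powr p \<partial>\<mu>)"
  using p by (simp add: P_norm_def Lp_norm_powr)

lemma integral_square: "(\<integral>t. (poly (P k) t)\<^sup>2 \<partial>\<mu>) = 1"
  using jacobi_inner_P[OF ab1 P, of k k] by (simp add: jacobi_inner_def power2_eq_square)

lemma integrable_square: "integrable \<mu> (\<lambda>t. (poly (P k) t)\<^sup>2)"
proof -
  have "poly (P k * P k) = (\<lambda>t. (poly (P k) t)\<^sup>2)" by (auto simp: power2_eq_square)
  then show ?thesis using integrable_jacobi_poly[OF ab1, of "P k * P k"] by simp
qed

lemma P_norm_pos: "0 < P_norm k"
proof (rule ccontr)
  assume "\<not> 0 < P_norm k"
  then have "P_norm k = 0" using Lp_norm_nonneg[of p \<mu> "poly (P k)"] by (simp add: P_norm_def)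
  then have "(\<integral>t. \<bar>poly (P k) t\<bar> powr p \<partial>\<mu>) = 0" using P_norm_powr[of k] p by simp
  then have "AE t in \<mu>. \<bar>poly (P k) t\<bar> powr p = 0"
    using integrable_poly_powr[of p "P k"] p by (subst (asm) integral_nonneg_eq_0_iff_AE) auto
  then have "P k = 0" by (intro AE_jacobi_poly_zero[OF ab1]) auto
  then show False using jacobi_lead_pos[OF ab1 P, of k] by simp
qed

lemma normalized_P_measurable [measurable]: "normalized_P k \<in> borel_measurable borel"
  unfolding normalized_P_def[abs_def] by measurable

lemma normalized_P_integrable: "integrable \<mu> (\<lambda>t. \<bar>normalized_P k t\<bar> powr p)"
  and normalized_P_integral: "(\<integral>t. \<bar>normalized_P k t\<bar> powr p \<partial>\<mu>) = 1"
proof -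
  have *: "\<bar>normalized_P k t\<bar> powr p = \<bar>poly (P k) t\<bar> powr p / P_norm k powr p" for t
    using P_norm_pos[of k] by (simp add: normalized_P_def abs_divide powr_divide)
  show "integrable \<mu> (\<lambda>t. \<bar>normalized_P k t\<bar> powr p)" unfolding * using integrable_poly_powr[of p "P k"] p by auto
  show "(\<integral>t. \<bar>normalized_P k t\<bar> powr p \<partial>\<mu>) = 1"
    unfolding * using P_norm_pos[of k] by (simp flip: P_norm_powr)
qed

lemma comb_real: "comb A (\<lambda>k. of_real (c k)) = (\<lambda>t. of_real (\<Sum>k\<in>A. c k * normalized_P k t))"
proof
  fix t
  have "comb A (\<lambda>k. of_real (c k)) t = (\<Sum>k\<in>A. of_real (c k * normalized_P k t))"
    unfolding comb_def
    by (induction A rule: infinite_finite_induct)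
       (auto simp: fun_scale_def jacobi_system_def normalized_P_def P_norm_def divide_inverse mult_ac)
  then show "comb A (\<lambda>k. of_real (c k)) t = of_real (\<Sum>k\<in>A. c k * normalized_P k t)" by simp
qed

lemma integrable_times_poly:
  assumes [measurable]: "h \<in> borel_measurable borel" and h: "integrable \<mu> (\<lambda>t. \<bar>h t\<bar> powr p)"
  shows "integrable \<mu> (\<lambda>t. h t * poly r t)"
proof -
  obtain B where B: "\<And>x. -1 \<le> x \<Longrightarrow> x \<le> 1 \<Longrightarrow> \<bar>poly r x\<bar> \<le> B" using poly_bounded_unit_interval[of r] by blast
  have B0: "0 \<le> B" using order_trans[OF abs_ge_zero B[of 0]] by simp
  have le: "\<bar>y\<bar> \<le> 1 + \<bar>y\<bar> powr p" for y :: real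
  proof (cases "\<bar>y\<bar> \<le> 1")
    case False
    then have "\<bar>y\<bar> powr 1 \<le> \<bar>y\<bar> powr p" using p by (intro powr_mono) auto
    then show ?thesis using False by simp
  qed (simp add: add_increasing2)
  have "integrable \<mu> (\<lambda>t. (1 + \<bar>h t\<bar> powr p) * B)" using h by auto
  then show ?thesis
  proof (rule Bochner_Integration.integrable_bound)
    show "AE t in \<mu>. norm (h t * poly r t) \<le> norm ((1 + \<bar>h t\<bar> powr p) * B)"
      using AE_jacobi_bounds
    proof eventually_elim
      case (elim t)
      have "\<bar>h t\<bar> * \<bar>poly r t\<bar> \<le> (1 + \<bar>h t\<bar> powr p) * B" using le B[of t] elim B0 by (intro mult_mono) auto
      then show ?case using B0 by (simp add: abs_mult)
    qed
  qed measurable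
qed

lemma coefficient_real:
  assumes "h \<in> borel_measurable borel" "integrable \<mu> (\<lambda>t. \<bar>h t\<bar> powr p)"
  shows "jacobi_functionals p \<mu> P k (\<lambda>t. of_real (h t) :: 'k) = of_real (P_norm k * (\<integral>t. h t * poly (P k) t \<partial>\<mu>))"
proof -
  have "(\<integral>t. of_real (h t) * of_real (poly (P k) t) \<partial>\<mu>) = (of_real (\<integral>t. h t * poly (P k) t \<partial>\<mu>) :: 'k)"
  proof -
    have "(\<lambda>t. of_real (h t) * of_real (poly (P k) t)) = (\<lambda>t. (h t * poly (P k) t) *\<^sub>R (1 :: 'k))"
      by (auto simp: of_real_def[symmetric])
    then show ?thesis
      using integrable_times_poly[OF assms, of "P k"] by (simp only: integral_scaleR_left of_real_def)
  qed
  then show ?thesis by (simp add: jacobi_functionals_def P_norm_def)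
qed

lemma Lp_norm_real: "Lp_norm p \<mu> (\<lambda>t. of_real (h t) :: 'k) powr p = (\<integral>t. \<bar>h t\<bar> powr p \<partial>\<mu>)"
  using p by (subst Lp_norm_powr) auto

lemma real_comb_integrable: "integrable \<mu> (\<lambda>t. \<bar>\<Sum>k\<in>A. c k * normalized_P k t\<bar> powr p)"
proof -
  have "comb A (\<lambda>k. of_real (c k) :: 'k) \<in> Lp_space p \<mu>" by simp
  then show ?thesis unfolding comb_real Lp_space_def mem_Collect_eq norm_of_real by blast
qed

text \<open>
  The estimate for signed sums, for real functions h in place of g. The signs of the coefficients of h
  are real and can be absorbed into the arbitrary signs \<eta>. Powers of norms are stated as integrals.
\<close>

lemma ex_sign_bound:
  "\<exists>C\<ge>0. \<forall>h A t \<eta>. h \<in> borel_measurable borel \<longrightarrow> integrable \<mu> (\<lambda>t. \<bar>h t\<bar> powr p) \<longrightarrow> finite A \<longrightarrow> 0 < t \<longrightarrow>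
     (\<forall>k\<in>A. t \<le> \<bar>P_norm k * (\<integral>s. h s * poly (P k) s \<partial>\<mu>)\<bar>) \<longrightarrow> (\<forall>k\<in>A. \<eta> k \<in> {-1, 1::real}) \<longrightarrow>
     t powr p * (\<integral>s. \<bar>\<Sum>k\<in>A. \<eta> k * normalized_P k s\<bar> powr p \<partial>\<mu>) \<le> C powr p * (\<integral>s. \<bar>h s\<bar> powr p \<partial>\<mu>)"
proof -
  obtain C where C: "0 \<le> C \<and> (\<forall>g\<in>Lp_space p \<mu>. \<forall>A t \<eta>. finite A \<longrightarrow> 0 < t \<longrightarrow>
     (\<forall>k\<in>A. t \<le> norm (jacobi_functionals p \<mu> P k g :: 'k)) \<longrightarrow> (\<forall>k\<in>A. \<eta> k \<in> {-1, 1::real}) \<longrightarrow>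
     t * Lp_norm p \<mu> (comb A (\<lambda>k. of_real (\<eta> k) * sgn (jacobi_functionals p \<mu> P k g))) \<le> C * Lp_norm p \<mu> g)"
    using sign_combination_bounded by (elim exE) (rule that)
  show ?thesis
  proof (intro exI[of _ C] conjI conjunct1[OF C] allI impI)
    fix h A t and \<eta> :: "nat \<Rightarrow> real"
    assume h: "h \<in> borel_measurable borel" "integrable \<mu> (\<lambda>t. \<bar>h t\<bar> powr p)" and A: "finite A" and t: "0 < t"
      and low: "\<forall>k\<in>A. t \<le> \<bar>P_norm k * (\<integral>s. h s * poly (P k) s \<partial>\<mu>)\<bar>" and eta: "\<forall>k\<in>A. \<eta> k \<in> {-1, 1::real}"
    define g where "g = (\<lambda>t. of_real (h t) :: 'k)"
    define c where "c = (\<lambda>k. P_norm k * (\<integral>s. h s * poly (P k) s \<partial>\<mu>))"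
    have co: "jacobi_functionals p \<mu> P k g = of_real (c k)" for k unfolding g_def c_def by (rule coefficient_real[OF h])
    have sg: "sgn (of_real a :: 'k) = of_real (sgn a)" for a
    proof -
      have "sgn (of_real a :: 'k) = of_real (inverse \<bar>a\<bar> * a)"
        unfolding sgn_div_norm norm_of_real scaleR_conv_of_real of_real_mult ..
      also have "inverse \<bar>a\<bar> * a = sgn a" by (simp add: sgn_if)
      finally show ?thesis .
    qed
    have g: "g \<in> Lp_space p \<mu>" using h by (auto simp: g_def Lp_space_def)
    define \<eta>' where "\<eta>' = (\<lambda>k. \<eta> k * sgn (c k))"
    have eta': "\<forall>k\<in>A. \<eta>' k \<in> {-1, 1::real}"
    proof
      fix k assume k: "k \<in> A"
      then have "c k \<noteq> 0" using low t by (force simp: c_def)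
      then show "\<eta>' k \<in> {-1, 1}" using eta k by (auto simp: \<eta>'_def sgn_if)
    qed
    have same: "comb A (\<lambda>k. of_real (\<eta>' k) * sgn (jacobi_functionals p \<mu> P k g)) = comb A (\<lambda>k. of_real (\<eta> k))"
    proof (rule comb_cong[OF refl])
      fix k assume k: "k \<in> A"
      then have "c k \<noteq> 0" using low t by (force simp: c_def)
      then show "of_real (\<eta>' k) * sgn (jacobi_functionals p \<mu> P k g) = (of_real (\<eta> k) :: 'k)"
        unfolding co sg by (simp add: \<eta>'_def sgn_if)
    qed
    have low': "t \<le> norm (jacobi_functionals p \<mu> P k g :: 'k)" if "k \<in> A" for k
      unfolding co norm_of_real using low that by (simp add: c_def)
    have "t * Lp_norm p \<mu> (comb A (\<lambda>k. of_real (\<eta>' k) * sgn (jacobi_functionals p \<mu> P k g))) \<le> C * Lp_norm p \<mu> g"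
      by (intro conjunct2[OF C, rule_format] g A t eta'[rule_format] low')
    then have "t * Lp_norm p \<mu> (\<lambda>s. of_real (\<Sum>k\<in>A. \<eta> k * normalized_P k s) :: 'k) \<le> C * Lp_norm p \<mu> g"
      unfolding same comb_real .
    then have "(t * Lp_norm p \<mu> (\<lambda>s. of_real (\<Sum>k\<in>A. \<eta> k * normalized_P k s) :: 'k)) powr p \<le> (C * Lp_norm p \<mu> g) powr p"
      using t p by (intro powr_mono2) (auto simp: Lp_norm_nonneg)
    then show "t powr p * (\<integral>s. \<bar>\<Sum>k\<in>A. \<eta> k * normalized_P k s\<bar> powr p \<partial>\<mu>) \<le> C powr p * (\<integral>s. \<bar>h s\<bar> powr p \<partial>\<mu>)"
      unfolding powr_mult Lp_norm_real g_def .
  qed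
qed

text \<open>
  The L_2 norm of P k is 1, and |y|^p compares with M^(p - 2) y^2 for |y| \<le> M.
\<close>

lemma P_norm_interpolation:
  assumes M: "\<And>x. -1 < x \<Longrightarrow> x < 1 \<Longrightarrow> \<bar>poly (P k) x\<bar> \<le> M" "0 < M"
  shows "p \<le> 2 \<Longrightarrow> M powr (p - 2) \<le> P_norm k powr p" and "2 \<le> p \<Longrightarrow> P_norm k powr p \<le> M powr (p - 2)"
proof -
  have int: "integrable \<mu> (\<lambda>t. \<bar>poly (P k) t\<bar> powr p)" using p by (intro integrable_poly_powr) auto
  have split: "\<bar>y\<bar> powr p = \<bar>y\<bar> powr (p - 2) * y\<^sup>2" if "y \<noteq> 0" for y :: real
  proof -
    have "\<bar>y\<bar> powr p = \<bar>y\<bar> powr (p - 2) * \<bar>y\<bar> powr 2" by (simp only: powr_add[symmetric]) simp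
    then show ?thesis using that by simp
  qed
  have pt: "M powr (p - 2) * y\<^sup>2 \<le> \<bar>y\<bar> powr p" if "p \<le> 2" "\<bar>y\<bar> \<le> M" for y
  proof (cases "y = 0")
    case False
    then show ?thesis unfolding split[OF False] using that by (intro mult_right_mono powr_mono2') auto
  qed simp
  have pt': "\<bar>y\<bar> powr p \<le> M powr (p - 2) * y\<^sup>2" if "2 \<le> p" "\<bar>y\<bar> \<le> M" for y
  proof (cases "y = 0")
    case False
    then show ?thesis unfolding split[OF False] using that by (intro mult_right_mono powr_mono2) auto
  qed simp
  show "M powr (p - 2) \<le> P_norm k powr p" if "p \<le> 2"
  proof -
    have "(\<integral>t. M powr (p - 2) * (poly (P k) t)\<^sup>2 \<partial>\<mu>) \<le> (\<integral>t. \<bar>poly (P k) t\<bar> powr p \<partial>\<mu>)"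
    proof (rule integral_mono_AE)
      show "AE t in \<mu>. M powr (p - 2) * (poly (P k) t)\<^sup>2 \<le> \<bar>poly (P k) t\<bar> powr p"
        using AE_jacobi_bounds by eventually_elim (use pt[OF that] M in auto)
    qed (use int integrable_square in auto)
    then show ?thesis by (simp add: P_norm_powr integral_square)
  qed
  show "P_norm k powr p \<le> M powr (p - 2)" if "2 \<le> p"
  proof -
    have "(\<integral>t. \<bar>poly (P k) t\<bar> powr p \<partial>\<mu>) \<le> (\<integral>t. M powr (p - 2) * (poly (P k) t)\<^sup>2 \<partial>\<mu>)"
    proof (rule integral_mono_AE)
      show "AE t in \<mu>. \<bar>poly (P k) t\<bar> powr p \<le> M powr (p - 2) * (poly (P k) t)\<^sup>2"
        using AE_jacobi_bounds by eventually_elim (use pt'[OF that] M in auto)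
    qed (use int integrable_square in auto)
    then show ?thesis by (simp add: P_norm_powr integral_square)
  qed
qed

lemma signed_sum_normalized_P:
  "signed_sum A B (\<lambda>k. normalized_P k s) = (\<Sum>k\<in>A. (if k \<in> B then 1 else -1) * normalized_P k s)"
  by (simp add: signed_sum_def)

text \<open>
  Here g is the indicator of the concentration set.
\<close>

lemma not_p_less_2:
  assumes "p < 2" shows False
proof -
  obtain C where C': "0 \<le> C \<and> (\<forall>h A t \<eta>. h \<in> borel_measurable borel \<longrightarrow> integrable \<mu> (\<lambda>t. \<bar>h t\<bar> powr p) \<longrightarrow> finite A \<longrightarrow> 0 < t \<longrightarrow>
     (\<forall>k\<in>A. t \<le> \<bar>P_norm k * (\<integral>s. h s * poly (P k) s \<partial>\<mu>)\<bar>) \<longrightarrow> (\<forall>k\<in>A. \<eta> k \<in> {-1, 1::real}) \<longrightarrow>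
     t powr p * (\<integral>s. \<bar>\<Sum>k\<in>A. \<eta> k * normalized_P k s\<bar> powr p \<partial>\<mu>) \<le> C powr p * (\<integral>s. \<bar>h s\<bar> powr p \<partial>\<mu>))"
    using ex_sign_bound by (elim exE) (rule that)
  note C = conjunct2[OF C', rule_format]
  obtain c where c: "0 < c" and conc: "\<And>n. 1 \<le> n \<Longrightarrow> \<exists>E M. concentrated \<mu> P c n E M"
    using jacobi_concentration[OF ab P] by blast
  define c2 where "c2 = 2 powr (p - 2) / 4"
  have "(1 / 2) powr p * c powr (p - 1) * c2 * real n powr (1 - p / 2) \<le> C powr p" if n: "1 \<le> n" for n
  proof -
    obtain E M where E: "E \<in> sets borel" "0 < measure \<mu> E"
      and M: "\<And>k. k \<in> {n..<2*n} \<Longrightarrow> 0 < M k \<and> (\<forall>x. -1 < x \<and> x < 1 \<longrightarrow> \<bar>poly (P k) x\<bar> \<le> M k) \<and>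
        (\<exists>\<sigma>\<in>{-1, 1}. \<forall>x\<in>E. M k / 2 \<le> \<sigma> * poly (P k) x) \<and> c / real n \<le> (M k)\<^sup>2 * measure \<mu> E"
      using conc[OF n] unfolding concentrated_def by blast
    define A where "A = {n..<2*n}"
    define w where "w = measure \<mu> E"
    have A: "finite A" "A \<noteq> {}" "card A = n" using n by (auto simp: A_def)
    have w: "0 < w" using E by (simp add: w_def)
    have npos: "0 < real n" using n by simp
    have hm: "(indicator E :: real \<Rightarrow> real) \<in> borel_measurable borel" using E by simp
    have hp: "\<bar>indicator E t\<bar> powr p = (indicator E t :: real)" for t :: real by (auto simp: indicator_def)
    have hi: "integrable \<mu> (\<lambda>t. \<bar>indicator E t :: real\<bar> powr p)"
      and hv: "(\<integral>t. \<bar>indicator E t :: real\<bar> powr p \<partial>\<mu>) = w"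
      unfolding hp using E by (auto simp: w_def less_top[symmetric])
    \<comment> \<open>A lower bound for the coefficients of the indicator that does not depend on k; by interpolation they are at least M^(2 - 2/p) w / 2, where M^2 \<ge> c / (n w).\<close>
    define t where "t = (1 / 2 powr p * (c / (real n * w)) powr (p - 1)) powr (1 / p) * w"
    have tp: "t powr p = 1 / 2 powr p * (c / (real n * w)) powr (p - 1) * w powr p"
      using p w c npos by (simp add: t_def powr_mult powr_powr)
    have t0: "0 < t" using w c npos by (simp add: t_def)
    have low: "t \<le> \<bar>P_norm k * (\<integral>s. indicator E s * poly (P k) s \<partial>\<mu>)\<bar>" if k: "k \<in> A" for k
    proof -
      have Mk: "0 < M k" "\<And>x. -1 < x \<Longrightarrow> x < 1 \<Longrightarrow> \<bar>poly (P k) x\<bar> \<le> M k" "c / real n \<le> (M k)\<^sup>2 * w"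
        using M[of k] k by (auto simp: A_def w_def)
      obtain \<sigma> where sg: "\<sigma> \<in> {-1, 1}" "\<And>x. x \<in> E \<Longrightarrow> M k / 2 \<le> \<sigma> * poly (P k) x"
        using M[OF k[unfolded A_def]] by blast
      have I: "integrable \<mu> (\<lambda>s. indicator E s * poly (P k) s)" by (rule integrable_times_poly[OF hm hi])
      have "M k / 2 * w = (\<integral>s. M k / 2 * indicator E s \<partial>\<mu>)" using E by (simp add: w_def)
      also have "\<dots> \<le> (\<integral>s. \<sigma> * (indicator E s * poly (P k) s) \<partial>\<mu>)"
      proof (rule integral_mono)
        show "integrable \<mu> (\<lambda>s. M k / 2 * indicator E s)" using E by (auto simp: less_top[symmetric])
        show "integrable \<mu> (\<lambda>s. \<sigma> * (indicator E s * poly (P k) s))" using I by simp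
        show "M k / 2 * indicator E s \<le> \<sigma> * (indicator E s * poly (P k) s)" for s
          using sg(2)[of s] by (auto simp: indicator_def)
      qed
      also have "\<dots> = \<sigma> * (\<integral>s. indicator E s * poly (P k) s \<partial>\<mu>)" by simp
      also have "\<dots> \<le> \<bar>\<integral>s. indicator E s * poly (P k) s \<partial>\<mu>\<bar>" using sg(1) by auto
      finally have "P_norm k * (M k / 2 * w) \<le> \<bar>P_norm k * (\<integral>s. indicator E s * poly (P k) s \<partial>\<mu>)\<bar>"
        using P_norm_pos[of k] by (simp add: abs_mult)
      moreover have "t \<le> P_norm k * (M k / 2 * w)"
      proof -
        have "c / (real n * w) \<le> (M k)\<^sup>2" using Mk(3) w npos by (simp add: field_simps)
        then have "(c / (real n * w)) powr (p - 1) \<le> ((M k)\<^sup>2) powr (p - 1)"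
          using c w npos p by (intro powr_mono2) auto
        also have "((M k)\<^sup>2) powr (p - 1) = M k powr (p - 2) * M k powr p"
        proof -
          have "(M k)\<^sup>2 = M k powr 2" using Mk(1) by simp
          then have "((M k)\<^sup>2) powr (p - 1) = M k powr (2 * (p - 1))" by (simp only: powr_powr)
          also have "\<dots> = M k powr ((p - 2) + p)" by (simp add: algebra_simps)
          finally show ?thesis by (simp only: powr_add)
        qed
        also have "\<dots> \<le> P_norm k powr p * M k powr p"
          using P_norm_interpolation(1)[of k "M k"] Mk assms by (intro mult_right_mono) auto
        finally have "t powr p \<le> 1 / 2 powr p * (P_norm k powr p * M k powr p) * w powr p"
          unfolding tp by (intro mult_right_mono mult_left_mono) auto
        also have "\<dots> = (P_norm k * (M k / 2 * w)) powr p"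
          by (simp add: powr_mult powr_divide)
        finally have tle: "t powr p \<le> (P_norm k * (M k / 2 * w)) powr p" .
        have "0 \<le> P_norm k * (M k / 2 * w)" using P_norm_pos[of k] Mk(1) w by simp
        then show ?thesis using tle t0 p powr_less_mono2[of p "P_norm k * (M k / 2 * w)" t] by fastforce
      qed
      ultimately show ?thesis by linarith
    qed
    obtain B where B: "c2 * real n powr (p / 2) \<le> (\<integral>s. \<bar>signed_sum A B (\<lambda>k. normalized_P k s)\<bar> powr p \<partial>\<mu>)"
      using exists_large_signed_sum[of p A normalized_P \<mu>] p assms A normalized_P_integrable normalized_P_integral real_comb_integrable
      unfolding signed_sum_normalized_P c2_def by auto
    have "t powr p * (c2 * real n powr (p / 2)) \<le> t powr p * (\<integral>s. \<bar>\<Sum>k\<in>A. (if k \<in> B then 1 else -1) * normalized_P k s\<bar> powr p \<partial>\<mu>)"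
      using B unfolding signed_sum_normalized_P by (rule mult_left_mono) simp
    also have "\<dots> \<le> C powr p * (\<integral>s. \<bar>indicator E s :: real\<bar> powr p \<partial>\<mu>)"
      by (intro C hm hi A t0 low) auto
    finally have fin: "t powr p * (c2 * real n powr (p / 2)) \<le> C powr p * w" unfolding hv .
    have "t powr p = (1 / 2) powr p * c powr (p - 1) * real n powr (1 - p) * w"
    proof -
      have "w powr p = w powr ((p - 1) + 1)" by simp
      then have e: "w powr p = w powr (p - 1) * w" using w by (simp only: powr_add) simp
      have e2: "real n powr (1 - p) = 1 / real n powr (p - 1)"
        using powr_minus_divide[of "real n" "p - 1"] by simp
      show ?thesis unfolding tp e e2 using w by (simp add: powr_divide powr_mult)
    qed
    then have "((1 / 2) powr p * c powr (p - 1) * c2 * (real n powr (1 - p) * real n powr (p / 2))) * w \<le> C powr p * w"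
      using fin by (simp add: mult_ac)
    then have "(1 / 2) powr p * c powr (p - 1) * c2 * (real n powr (1 - p) * real n powr (p / 2)) \<le> C powr p"
      using w by simp
    also have "real n powr (1 - p) * real n powr (p / 2) = real n powr (1 - p / 2)"
      by (simp only: powr_add[symmetric]) (simp add: field_simps)
    finally show ?thesis .
  qed
  moreover have "0 < (1 / 2) powr p * c powr (p - 1) * c2" using c by (simp add: c2_def)
  moreover have "0 < 1 - p / 2" using assms by simp
  ultimately show False by (metis unbounded_powr_contradiction)
qed

text \<open>
  Here g is a signed sum of small norm, and the large signed sum has the signs that make all its terms
  positive on the concentration set.
\<close>

lemma not_p_greater_2:
  assumes "2 < p" shows False
proof -
  obtain C where C': "0 \<le> C \<and> (\<forall>h A t \<eta>. h \<in> borel_measurable borel \<longrightarrow> integrable \<mu> (\<lambda>t. \<bar>h t\<bar> powr p) \<longrightarrow> finite A \<longrightarrow> 0 < t \<longrightarrow>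
     (\<forall>k\<in>A. t \<le> \<bar>P_norm k * (\<integral>s. h s * poly (P k) s \<partial>\<mu>)\<bar>) \<longrightarrow> (\<forall>k\<in>A. \<eta> k \<in> {-1, 1::real}) \<longrightarrow>
     t powr p * (\<integral>s. \<bar>\<Sum>k\<in>A. \<eta> k * normalized_P k s\<bar> powr p \<partial>\<mu>) \<le> C powr p * (\<integral>s. \<bar>h s\<bar> powr p \<partial>\<mu>))"
    using ex_sign_bound by (elim exE) (rule that)
  note C = conjunct2[OF C', rule_format]
  obtain c where c: "0 < c" and conc: "\<And>n. 1 \<le> n \<Longrightarrow> \<exists>E M. concentrated \<mu> P c n E M"
    using jacobi_concentration[OF ab P] by blast
  obtain D where D': "0 < D \<and> (\<forall>(M :: real measure) A f. finite A \<longrightarrow> A \<noteq> {} \<longrightarrow>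
     (\<forall>k\<in>A. f k \<in> borel_measurable M \<and> integrable M (\<lambda>t. \<bar>f k t\<bar> powr p) \<and> (\<integral>t. \<bar>f k t\<bar> powr p \<partial>M) = 1) \<longrightarrow>
     (\<exists>B\<subseteq>A. (\<integral>t. \<bar>signed_sum A B (\<lambda>k. f k t)\<bar> powr p \<partial>M) \<le> D * real (card A) powr (p / 2)))"
    using exists_small_signed_sum[OF less_imp_le[OF assms]] by (elim exE) (rule that)
  note D = conjunct2[OF D', rule_format]
  have "(1 / 2) powr p * c * real n powr (p / 2 - 1) \<le> C powr p * D" if n: "1 \<le> n" for n
  proof -
    obtain E M where E: "E \<in> sets borel" "0 < measure \<mu> E"
      and M: "\<And>k. k \<in> {n..<2*n} \<Longrightarrow> 0 < M k \<and> (\<forall>x. -1 < x \<and> x < 1 \<longrightarrow> \<bar>poly (P k) x\<bar> \<le> M k) \<and>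
        (\<exists>\<sigma>\<in>{-1, 1}. \<forall>x\<in>E. M k / 2 \<le> \<sigma> * poly (P k) x) \<and> c / real n \<le> (M k)\<^sup>2 * measure \<mu> E"
      using conc[OF n] unfolding concentrated_def by blast
    define A where "A = {n..<2*n}"
    define w where "w = measure \<mu> E"
    have A: "finite A" "A \<noteq> {}" "card A = n" using n by (auto simp: A_def)
    have w: "0 < w" using E by (simp add: w_def)
    have npos: "0 < real n" using n by simp
    have "\<forall>k\<in>A. \<exists>\<sigma>. \<sigma> \<in> {-1, 1} \<and> (\<forall>x\<in>E. M k / 2 \<le> \<sigma> * poly (P k) x)"
    proof
      fix k assume "k \<in> A"
      then show "\<exists>\<sigma>. \<sigma> \<in> {-1, 1} \<and> (\<forall>x\<in>E. M k / 2 \<le> \<sigma> * poly (P k) x)"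
        using M[of k] unfolding A_def by blast
    qed
    then obtain \<sigma> where sg: "\<And>k. k \<in> A \<Longrightarrow> \<sigma> k \<in> {-1, 1}"
      "\<And>k x. k \<in> A \<Longrightarrow> x \<in> E \<Longrightarrow> M k / 2 \<le> \<sigma> k * poly (P k) x"
      by metis
    obtain B where B: "(\<integral>s. \<bar>signed_sum A B (\<lambda>k. normalized_P k s)\<bar> powr p \<partial>\<mu>) \<le> D * real n powr (p / 2)"
      using D[of A normalized_P \<mu>] A normalized_P_integrable normalized_P_integral by auto
    define e where "e = (\<lambda>k. if k \<in> B then 1 else -1 :: real)"
    define h where "h = (\<lambda>s. \<Sum>k\<in>A. e k * normalized_P k s)"
    have hm: "h \<in> borel_measurable borel" unfolding h_def by measurable
    have hi: "integrable \<mu> (\<lambda>s. \<bar>h s\<bar> powr p)" unfolding h_def by (rule real_comb_integrable)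
    have hv: "(\<integral>s. \<bar>h s\<bar> powr p \<partial>\<mu>) \<le> D * real n powr (p / 2)"
      using B by (simp add: h_def e_def signed_sum_normalized_P)
    have coef: "P_norm k * (\<integral>s. h s * poly (P k) s \<partial>\<mu>) = e k" if k: "k \<in> A" for k
    proof -
      have pp: "integrable \<mu> (\<lambda>s. normalized_P j s * poly (P k) s)" for j
        by (rule integrable_times_poly[OF normalized_P_measurable normalized_P_integrable])
      have v: "(\<integral>s. normalized_P j s * poly (P k) s \<partial>\<mu>) = (if j = k then 1 else 0) / P_norm j" for j
        using jacobi_inner_P[OF ab1 P, of j k] unfolding jacobi_inner_def normalized_P_def by simp
      have "(\<integral>s. h s * poly (P k) s \<partial>\<mu>) = (\<integral>s. (\<Sum>j\<in>A. e j * (normalized_P j s * poly (P k) s)) \<partial>\<mu>)"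
        by (simp add: h_def sum_distrib_right mult.assoc)
      also have "\<dots> = (\<Sum>j\<in>A. e j * ((if j = k then 1 else 0) / P_norm j))"
        using pp by (subst Bochner_Integration.integral_sum) (auto simp: v)
      also have "\<dots> = (\<Sum>j\<in>A. if j = k then e k / P_norm k else 0)" by (intro sum.cong) auto
      also have "\<dots> = e k / P_norm k" using A k by simp
      finally show ?thesis using P_norm_pos[of k] by simp
    qed
    have up: "(\<integral>s. \<bar>\<Sum>k\<in>A. \<sigma> k * normalized_P k s\<bar> powr p \<partial>\<mu>) \<le> C powr p * (D * real n powr (p / 2))"
    proof -
      have "1 powr p * (\<integral>s. \<bar>\<Sum>k\<in>A. \<sigma> k * normalized_P k s\<bar> powr p \<partial>\<mu>) \<le> C powr p * (\<integral>s. \<bar>h s\<bar> powr p \<partial>\<mu>)"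
      proof (rule C[OF hm hi A(1)])
        show "1 \<le> \<bar>P_norm k * (\<integral>s. h s * poly (P k) s \<partial>\<mu>)\<bar>" if "k \<in> A" for k
          unfolding coef[OF that] by (simp add: e_def)
      qed (use sg in auto)
      also have "\<dots> \<le> C powr p * (D * real n powr (p / 2))" using hv by (intro mult_left_mono) auto
      finally show ?thesis by simp
    qed
    define v where "v = (c / (real n * w)) powr (1 / p)"
    have v0: "0 \<le> v" by (simp add: v_def)
    have low: "1 / 2 * v \<le> \<sigma> k * normalized_P k x" if k: "k \<in> A" and x: "x \<in> E" for k x
    proof -
      have Mk: "0 < M k" "\<And>x. -1 < x \<Longrightarrow> x < 1 \<Longrightarrow> \<bar>poly (P k) x\<bar> \<le> M k" "c / real n \<le> (M k)\<^sup>2 * w"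
        using M[of k] k by (auto simp: A_def w_def)
      have "v * P_norm k \<le> M k"
      proof -
        have "c / (real n * w) \<le> (M k)\<^sup>2" using Mk(3) w npos by (simp add: field_simps)
        moreover have "v powr p = c / (real n * w)" using p c w npos by (simp add: v_def powr_powr)
        ultimately have "(v * P_norm k) powr p \<le> (M k)\<^sup>2 * M k powr (p - 2)"
          unfolding powr_mult using P_norm_interpolation(2)[of k "M k"] Mk assms by (intro mult_mono) auto
        also have "\<dots> = M k powr 2 * M k powr (p - 2)" using Mk(1) by simp
        also have "\<dots> = M k powr p" by (simp only: powr_add[symmetric]) simp
        finally show ?thesis
          using Mk(1) p powr_less_mono2[of p "M k" "v * P_norm k"] by fastforce
      qed
      then have "1 / 2 * v \<le> M k / 2 / P_norm k" using P_norm_pos[of k] by (simp add: field_simps)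
      also have "\<dots> \<le> \<sigma> k * poly (P k) x / P_norm k" using sg(2)[OF k x] P_norm_pos[of k] by (intro divide_right_mono) auto
      finally show ?thesis by (simp add: normalized_P_def)
    qed
    have "(1 / 2) powr p * c * real n powr (p - 1) \<le> (\<integral>s. \<bar>\<Sum>k\<in>A. \<sigma> k * normalized_P k s\<bar> powr p \<partial>\<mu>)"
    proof -
      have "(real n * (1 / 2 * v)) powr p * w = (\<integral>s. (real n * (1 / 2 * v)) powr p * indicator E s \<partial>\<mu>)"
        using E by (simp add: w_def)
      also have "\<dots> \<le> (\<integral>s. \<bar>\<Sum>k\<in>A. \<sigma> k * normalized_P k s\<bar> powr p \<partial>\<mu>)"
      proof (rule integral_mono)
        show "integrable \<mu> (\<lambda>s. (real n * (1 / 2 * v)) powr p * indicator E s)" using E by (auto simp: less_top[symmetric])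
        show "integrable \<mu> (\<lambda>s. \<bar>\<Sum>k\<in>A. \<sigma> k * normalized_P k s\<bar> powr p)" by (rule real_comb_integrable)
        show "(real n * (1 / 2 * v)) powr p * indicator E s \<le> \<bar>\<Sum>k\<in>A. \<sigma> k * normalized_P k s\<bar> powr p" for s
        proof (cases "s \<in> E")
          case True
          have "real n * (1 / 2 * v) = (\<Sum>k\<in>A. 1 / 2 * v)" using A by simp
          also have "\<dots> \<le> (\<Sum>k\<in>A. \<sigma> k * normalized_P k s)" using True by (intro sum_mono low)
          finally have "real n * (1 / 2 * v) \<le> \<bar>\<Sum>k\<in>A. \<sigma> k * normalized_P k s\<bar>" by linarith
          then show ?thesis using True p v0 by (auto intro!: powr_mono2)
        qed simp
      qed
      finally have "(real n * (1 / 2 * v)) powr p * w \<le> (\<integral>s. \<bar>\<Sum>k\<in>A. \<sigma> k * normalized_P k s\<bar> powr p \<partial>\<mu>)" .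
      moreover have "(real n * (1 / 2 * v)) powr p * w = (1 / 2) powr p * c * real n powr (p - 1)"
      proof -
        have "v powr p = c / (real n * w)" using p c w npos by (simp add: v_def powr_powr)
        moreover have "real n powr p = real n powr (p - 1) * real n"
        proof -
          have "real n powr p = real n powr ((p - 1) + 1)" by simp
          then show ?thesis using npos by (simp only: powr_add) simp
        qed
        ultimately show ?thesis using w npos by (simp only: powr_mult) simp
      qed
      ultimately show ?thesis by simp
    qed
    then have "(1 / 2) powr p * c * real n powr (p - 1) \<le> C powr p * (D * real n powr (p / 2))" using up by simp
    moreover have "real n powr (p - 1) = real n powr (p / 2 - 1) * real n powr (p / 2)"
      by (simp only: powr_add[symmetric]) simp
    ultimately have "((1 / 2) powr p * c * real n powr (p / 2 - 1)) * real n powr (p / 2) \<le> (C powr p * D) * real n powr (p / 2)"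
      by (simp add: mult_ac)
    then show ?thesis using npos by (simp only: mult_le_cancel_right) simp
  qed
  moreover have "0 < (1 / 2) powr p * c" using c by simp
  moreover have "0 < p / 2 - 1" using assms by simp
  ultimately show False by (metis unbounded_powr_contradiction)
qed

theorem p_eq_2: "p = 2"
  using not_p_less_2 not_p_greater_2 by fastforce

end

section \<open>Convergence for the exponent 2\<close>

lemma Lp_norm_tendsto_0:
  fixes f :: "'a \<Rightarrow> 'k::{real_normed_field, banach, second_countable_topology}"
  assumes p: "1 \<le> p" and [measurable]: "f \<in> borel_measurable M" "\<And>i. g i \<in> borel_measurable M"
    and h: "h \<in> borel_measurable M" "integrable M (\<lambda>t. h t powr p)"
    and lim: "AE t in M. (\<lambda>i. g i t) \<longlonglongrightarrow> f t"
    and bound: "\<And>i. AE t in M. norm (f t - g i t) \<le> h t"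
  shows "(\<lambda>i::nat. Lp_norm p M (f - g i)) \<longlonglongrightarrow> 0"
proof -
  have "(\<lambda>i. \<integral>t. norm (f t - g i t) powr p \<partial>M) \<longlonglongrightarrow> (\<integral>t. 0 \<partial>M)"
  proof (rule integral_dominated_convergence[where w = "\<lambda>t. h t powr p"])
    show "AE t in M. (\<lambda>i. norm (f t - g i t) powr p) \<longlonglongrightarrow> 0"
      using lim
    proof eventually_elim
      case (elim t)
      have "(\<lambda>i. norm (f t - g i t)) \<longlonglongrightarrow> norm (f t - f t)" by (intro tendsto_intros elim)
      then have "(\<lambda>i. norm (f t - g i t) powr p) \<longlonglongrightarrow> 0 powr p"
        using p by (intro tendsto_powr2[OF _ tendsto_const] tendsto_intros) auto
      then show ?case by simp
    qed
    show "AE t in M. norm (norm (f t - g i t) powr p) \<le> h t powr p" for i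
      using bound[of i] by eventually_elim (use p in \<open>auto intro: powr_mono2\<close>)
  qed (use h in auto)
  then have "(\<lambda>i. (\<integral>t. norm (f t - g i t) powr p \<partial>M) powr (1 / p)) \<longlonglongrightarrow> 0 powr (1 / p)"
    using p by (intro tendsto_powr2[OF _ tendsto_const]) auto
  then show ?thesis by (simp add: Lp_norm_def)
qed

lemma jacobi_bounded_Lp:
  fixes f :: "real \<Rightarrow> 'k::{real_normed_field, banach, second_countable_topology}"
  assumes ab: "-1 < \<alpha>" "-1 < \<beta>" and p: "1 \<le> p"
    and [measurable]: "f \<in> borel_measurable borel" and B: "\<And>x. -1 < x \<Longrightarrow> x < 1 \<Longrightarrow> norm (f x) \<le> B"
  shows "f \<in> Lp_space p (jacobi_measure \<alpha> \<beta>)"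
proof -
  have "integrable (jacobi_measure \<alpha> \<beta>) (\<lambda>t. norm (f t) powr p)"
  proof (rule integrable_jacobi_bounded[OF ab, where B = "B powr p"])
    show "norm (norm (f x) powr p) \<le> B powr p" if "-1 < x" "x < 1" for x
      using B[OF that] p by (auto intro: powr_mono2)
  qed measurable
  then show ?thesis by (simp add: Lp_space_def)
qed

text \<open>
  By the Weierstrass theorem the closed span contains the continuous functions, hence the
  indicators of half-lines, hence by a Dynkin system argument those of all Borel sets, and finally all
  functions by approximation with simple functions.
\<close>

lemma jacobi_polynomials_dense:
  assumes ab: "-1 < \<alpha>" "-1 < \<beta>" and P: "orthonormal_jacobi \<alpha> \<beta> P" and p: "1 \<le> p"
  shows "closed_span (fun_scale :: 'k::{real_normed_field, banach, second_countable_topology} \<Rightarrow> (real \<Rightarrow> 'k) \<Rightarrow> real \<Rightarrow> 'k)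
     (Lp_space p (jacobi_measure \<alpha> \<beta>)) (Lp_norm p (jacobi_measure \<alpha> \<beta>)) (range (\<lambda>n t. of_real (poly (P n) t)))
   = Lp_space p (jacobi_measure \<alpha> \<beta>)"
proof -
  let ?\<mu> = "jacobi_measure \<alpha> \<beta>"
  interpret finite_measure ?\<mu> by (rule finite_measure_jacobi[OF ab])
  interpret seminormed_space "fun_scale :: 'k \<Rightarrow> (real \<Rightarrow> 'k) \<Rightarrow> real \<Rightarrow> 'k" "Lp_space p ?\<mu>" "Lp_norm p ?\<mu>"
    by (rule seminormed_space_Lp[OF p])
  define S where "S = range (\<lambda>n t. of_real (poly (P n) t) :: 'k)"
  define V where "V = closed_span (fun_scale :: 'k \<Rightarrow> (real \<Rightarrow> 'k) \<Rightarrow> real \<Rightarrow> 'k) (Lp_space p ?\<mu>) (Lp_norm p ?\<mu>) S"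
  have poly_Lp: "(\<lambda>t. of_real (poly q t) :: 'k) \<in> Lp_space p ?\<mu>" for q
  proof -
    obtain B where "\<And>x. -1 \<le> x \<Longrightarrow> x \<le> 1 \<Longrightarrow> \<bar>poly q x\<bar> \<le> B" using poly_bounded_unit_interval[of q] by blast
    then show ?thesis by (intro jacobi_bounded_Lp[OF ab p, where B = B]) auto
  qed
  have S: "S \<subseteq> Lp_space p ?\<mu>" using poly_Lp by (auto simp: S_def)
  have limV: "f \<in> V"
    if "f \<in> borel_measurable borel" "\<And>i. g i \<in> V" "AE t in ?\<mu>. (\<lambda>i::nat. g i t) \<longlonglongrightarrow> f t"
      "\<And>t. -1 < t \<Longrightarrow> t < 1 \<Longrightarrow> norm (f t) \<le> B" "\<And>i t. -1 < t \<Longrightarrow> t < 1 \<Longrightarrow> norm (g i t) \<le> B" for f g B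
    unfolding V_def
  proof (rule closed_span_limit[OF S])
    show "g i \<in> closed_span fun_scale (Lp_space p ?\<mu>) (Lp_norm p ?\<mu>) S" for i using that(2) by (simp add: V_def)
    then have gm: "g i \<in> borel_measurable ?\<mu>" for i by (auto simp: closed_span_def Lp_space_def)
    show "f \<in> Lp_space p ?\<mu>" using that(1,4) by (rule jacobi_bounded_Lp[OF ab p])
    show "(\<lambda>i. Lp_norm p ?\<mu> (f - g i)) \<longlonglongrightarrow> 0"
    proof (rule Lp_norm_tendsto_0[OF p, where h = "\<lambda>_. 2 * B"])
      show "AE t in ?\<mu>. norm (f t - g i t) \<le> 2 * B" for i
        using AE_jacobi_bounds
      proof eventually_elim
        case (elim t)
        then show ?case using norm_triangle_ineq4[of "f t" "g i t"] that(4)[of t] that(5)[of t i] by linarith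
      qed
    qed (use that gm in auto)
  qed
  have polyV: "(\<lambda>t. of_real (poly q t)) \<in> V" for q
  proof -
    obtain c where c: "q = (\<Sum>k<Suc (degree q). smult (c k) (P k))"
      using poly_in_span_jacobi[OF ab P, of q "Suc (degree q)"] by blast
    have "(\<lambda>t. of_real (poly q t) :: 'k) = (\<Sum>k<Suc (degree q). fun_scale (of_real (c k)) (\<lambda>t. of_real (poly (P k) t)))"
    proof
      fix t
      have "(\<Sum>k<n. fun_scale (of_real (c k)) (\<lambda>t. of_real (poly (P k) t) :: 'k)) t = of_real (\<Sum>k<n. c k * poly (P k) t)" for n
        by (induction n) (auto simp: fun_scale_def)
      then show "of_real (poly q t) = (\<Sum>k<Suc (degree q). fun_scale (of_real (c k)) (\<lambda>t. of_real (poly (P k) t) :: 'k)) t"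
        by (subst c) (simp only: poly_sum poly_smult)
    qed
    also have "\<dots> \<in> span S" by (intro span_sum span_scale span_base) (auto simp: S_def)
    finally show ?thesis using closed_span_superset[OF S] by (auto simp: V_def)
  qed
  have contV: "(\<lambda>t. of_real (h t)) \<in> V" if h: "continuous_on UNIV h" for h :: "real \<Rightarrow> real"
  proof -
    have "\<exists>q. \<forall>x\<in>{-1..1}. \<bar>h x - poly q x\<bar> < 1 / real (Suc i)" for i
    proof -
      obtain g where g: "real_polynomial_function g" "\<And>x. x \<in> {-1..1} \<Longrightarrow> \<bar>h x - g x\<bar> < 1 / real (Suc i)"
        using Stone_Weierstrass_real_polynomial_function[of "{-1..1}" h "1 / real (Suc i)"] continuous_on_subset[OF h] by auto
      obtain a n where a: "g = (\<lambda>x. \<Sum>i\<le>n. a i * x ^ i)" using g(1) unfolding real_polynomial_function_iff_sum by blast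
      have "poly (\<Sum>i\<le>n. monom (a i) i) x = g x" for x by (simp add: a poly_sum poly_monom)
      then show ?thesis using g(2) by metis
    qed
    then obtain q where q: "\<And>i x. x \<in> {-1..1} \<Longrightarrow> \<bar>h x - poly (q i) x\<bar> < 1 / real (Suc i)" by metis
    have "compact (h ` {-1..1})" using continuous_on_subset[OF h] by (intro compact_continuous_image) auto
    from compact_imp_bounded[OF this] obtain B where "\<forall>y\<in>h ` {-1..1}. norm y \<le> B"
      unfolding bounded_iff by blast
    then have B: "\<bar>h x\<bar> \<le> B" if "x \<in> {-1..1}" for x using that by simp
    show ?thesis
    proof (rule limV[where g = "\<lambda>i t. of_real (poly (q i) t)" and B = "B + 1"])
      show "(\<lambda>t. of_real (h t) :: 'k) \<in> borel_measurable borel" using borel_measurable_continuous_onI[OF h] by measurable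
      show "(\<lambda>t. of_real (poly (q i) t)) \<in> V" for i by (rule polyV)
      show "AE t in ?\<mu>. (\<lambda>i. of_real (poly (q i) t) :: 'k) \<longlonglongrightarrow> of_real (h t)"
        using AE_jacobi_bounds
      proof eventually_elim
        case (elim t)
        have "(\<lambda>i. h t - poly (q i) t) \<longlonglongrightarrow> 0"
        proof (rule Lim_null_comparison)
          show "eventually (\<lambda>i. norm (h t - poly (q i) t) \<le> 1 / real (Suc i)) sequentially"
            using q[of t] elim by (intro always_eventually allI) (auto intro: less_imp_le)
          show "(\<lambda>i. 1 / real (Suc i)) \<longlonglongrightarrow> 0" by (rule LIMSEQ_Suc[OF lim_1_over_n])
        qed
        from tendsto_diff[OF tendsto_const[of "h t"] this] have "(\<lambda>i. poly (q i) t) \<longlonglongrightarrow> h t" by simp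
        then show ?case by (rule tendsto_of_real)
      qed
      show "norm (of_real (h t) :: 'k) \<le> B + 1" if "-1 < t" "t < 1" for t using B[of t] that by simp
      show "norm (of_real (poly (q i) t) :: 'k) \<le> B + 1" if "-1 < t" "t < 1" for i t
      proof -
        have "1 / real (Suc i) \<le> 1" by simp
        then have "\<bar>h t - poly (q i) t\<bar> < 1" using that by (intro less_le_trans[OF q]) auto
        then have "\<bar>poly (q i) t\<bar> \<le> B + 1" using B[of t] that by simp
        then show ?thesis by simp
      qed
    qed
  qed
  have indV: "(\<lambda>t. of_real (indicator A t)) \<in> V" if "A \<in> sets borel" for A :: "real set"
  proof -
    have Aset: "A \<in> sigma_sets UNIV (range (\<lambda>a. {..a::real}))"
      using that by (subst (asm) borel_eq_atMost) simp
    have sub: "range (\<lambda>a. {..a::real}) \<subseteq> Pow UNIV" by simp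
    have meas: "B \<in> sets borel" if "B \<in> sigma_sets UNIV (range (\<lambda>a. {..a::real}))" for B
      using that by (subst borel_eq_atMost) simp
    have IS: "Int_stable (range (\<lambda>a. {..a::real}))"
      by (auto simp: Int_stable_def intro: exI[of _ "min _ _"])
    show ?thesis
    proof (induction rule: sigma_sets_induct_disjoint[OF IS sub Aset])
      case (1 A)
      then obtain a where a: "A = {..a}" by auto
      define h where "h = (\<lambda>i::nat. \<lambda>t. max 0 (min 1 (1 - real i * (t - a))))"
      show ?case
      proof (rule limV[where g = "\<lambda>i t. of_real (h i t)" and B = 1])
        show "(\<lambda>t. of_real (indicator A t) :: 'k) \<in> borel_measurable borel" unfolding a by measurable
        show "(\<lambda>t. of_real (h i t)) \<in> V" for i unfolding h_def by (intro contV continuous_intros)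
        have "(\<lambda>i. h i t) \<longlonglongrightarrow> indicator A t" for t
        proof (cases "t \<le> a")
          case True
          then have "h i t = 1" for i
            using mult_nonneg_nonpos[of "real i" "t - a"] by (simp add: h_def min_def max_def)
          then show ?thesis using True by (simp add: a)
        next
          case False
          have "filterlim (\<lambda>i. real i * (t - a)) at_top sequentially"
            using False by real_asymp
          then have "eventually (\<lambda>i. 1 \<le> real i * (t - a)) sequentially" by (simp add: filterlim_at_top)
          then have "eventually (\<lambda>i. h i t = 0) sequentially" by eventually_elim (simp add: h_def)
          then show ?thesis using False by (simp add: a tendsto_eventually)
        qed
        then show "AE t in ?\<mu>. (\<lambda>i. of_real (h i t) :: 'k) \<longlonglongrightarrow> of_real (indicator A t)"
          by (intro AE_I2 tendsto_of_real)
      qed (auto simp: h_def indicator_def)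
    next
      case 2
      show ?case using contV[of "\<lambda>_. 0"] by simp
    next
      case (3 A)
      have "(\<lambda>t. of_real (indicator (UNIV - A) t) :: 'k) = (\<lambda>t. of_real 1) + fun_scale (-1) (\<lambda>t. of_real (indicator A t))"
        by (auto simp: fun_scale_def indicator_def)
      also have "\<dots> \<in> V" unfolding V_def
        by (intro closed_span_add[OF S] closed_span_scale[OF S]) (use 3 contV[of "\<lambda>_. 1"] in \<open>auto simp: V_def\<close>)
      finally show ?case .
    next
      case (4 A)
      define g where "g = (\<lambda>i::nat. \<Sum>j<i. (\<lambda>t. of_real (indicator (A j) t) :: 'k))"
      have g: "g i t = of_real (indicator (\<Union>j<i. A j) t)" for i t
      proof -
        have "g i t = of_real (\<Sum>j<i. indicator (A j) t)" unfolding g_def by (induction i) auto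
        also have "(\<Sum>j<i. indicator (A j) t) = (indicator (\<Union>j<i. A j) t :: real)"
          using 4(1) by (intro indicator_UN_disjoint[symmetric]) (auto intro: disjoint_family_on_mono)
        finally show ?thesis .
      qed
      show ?case
      proof (rule limV[where g = g and B = 1])
        show "(\<lambda>t. of_real (indicator (\<Union>i. A i) t) :: 'k) \<in> borel_measurable borel"
          using meas 4(2) by (intro measurable_compose[OF borel_measurable_indicator] borel_measurable_of_real sets.countable_UN) auto
        show "g i \<in> V" for i unfolding g_def V_def using 4(3) by (intro closed_span_sum[OF S]) (auto simp: V_def)
        show "AE t in ?\<mu>. (\<lambda>i. g i t) \<longlonglongrightarrow> of_real (indicator (\<Union>i. A i) t)"
          unfolding g by (intro AE_I2 tendsto_of_real LIMSEQ_indicator_UN)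
      qed (auto simp: g indicator_def)
    qed
  qed
  have "Lp_space p ?\<mu> \<subseteq> V"
  proof
    fix f :: "real \<Rightarrow> 'k" assume f: "f \<in> Lp_space p ?\<mu>"
    then have fm: "f \<in> borel_measurable ?\<mu>" and fi: "integrable ?\<mu> (\<lambda>t. norm (f t) powr p)" by (auto simp: Lp_space_def)
    obtain F where F: "\<And>i. simple_function ?\<mu> (F i)" "\<And>x. (\<lambda>i. F i x) \<longlonglongrightarrow> f x" "\<And>i x. norm (F i x) \<le> 2 * norm (f x)"
      using borel_measurable_implies_sequence_metric[OF fm, of 0] by (auto simp: dist_norm)
    have FV: "F i \<in> V" for i
    proof -
      have fin: "finite (range (F i))" using F(1)[of i] by (simp add: simple_function_def)
      have "F i = (\<Sum>y\<in>range (F i). fun_scale y (\<lambda>t. of_real (indicator (F i -` {y}) t)))"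
      proof
        fix t
        have app: "(\<Sum>y\<in>I. fun_scale y (\<lambda>t. of_real (indicator (F i -` {y}) t))) t = (\<Sum>y\<in>I. if y = F i t then y else 0)" for I
          by (induction I rule: infinite_finite_induct) (auto simp: fun_scale_def indicator_def)
        show "F i t = (\<Sum>y\<in>range (F i). fun_scale y (\<lambda>t. of_real (indicator (F i -` {y}) t))) t"
          unfolding app using fin by simp
      qed
      also have "\<dots> \<in> V"
        unfolding V_def
      proof (intro closed_span_sum[OF S] closed_span_scale[OF S])
        fix y
        have "F i -` {y} \<in> sets borel" using simple_functionD(2)[OF F(1)[of i], of "{y}"] by simp
        then show "(\<lambda>t. of_real (indicator (F i -` {y}) t)) \<in> closed_span fun_scale (Lp_space p ?\<mu>) (Lp_norm p ?\<mu>) S"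
          using indV by (simp add: V_def)
      qed
      finally show ?thesis .
    qed
    have Fm: "F i \<in> borel_measurable ?\<mu>" for i using F(1) by (rule borel_measurable_simple_function)
    have "(\<lambda>i. Lp_norm p ?\<mu> (f - F i)) \<longlonglongrightarrow> 0"
    proof (rule Lp_norm_tendsto_0[OF p, where h = "\<lambda>t. 3 * norm (f t)"])
      show "integrable ?\<mu> (\<lambda>t. (3 * norm (f t)) powr p)" using fi by (simp add: powr_mult)
      show "AE t in ?\<mu>. norm (f t - F i t) \<le> 3 * norm (f t)" for i
      proof (rule AE_I2)
        fix t show "norm (f t - F i t) \<le> 3 * norm (f t)"
          using norm_triangle_ineq4[of "f t" "F i t"] F(3)[of i t] by simp
      qed
    qed (use fm F(2) Fm in auto)
    then show "f \<in> V" unfolding V_def using FV by (intro closed_span_limit[OF S f]) (auto simp: V_def)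
  qed
  then show ?thesis by (auto simp: V_def S_def closed_span_def)
qed

lemma Lp_norm_2_square: "(Lp_norm 2 M f)\<^sup>2 = (\<integral>t. (norm (f t))\<^sup>2 \<partial>M)"
  using Lp_norm_powr[of 2 M f] Lp_norm_nonneg[of 2 M f] by simp

text \<open>
  The scalars carry a real inner product that induces their norm, which covers the real and the
  complex case at once; the parameter ty fixes the type of scalars.
\<close>

locale jacobi_L2 =
  fixes \<alpha> \<beta> :: real and P :: "nat \<Rightarrow> real poly" and \<tau> :: "nat \<Rightarrow> nat"
    and ty :: "'k::{real_normed_field, banach, second_countable_topology, real_inner} itself"
  assumes ab: "-1 < \<alpha>" "-1 < \<beta>" and P: "orthonormal_jacobi \<alpha> \<beta> P" and bij_tau: "bij \<tau>"
begin

abbreviation \<mu> :: "real measure" where "\<mu> \<equiv> jacobi_measure \<alpha> \<beta>"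
abbreviation L2 :: "(real \<Rightarrow> 'k) set" where "L2 \<equiv> Lp_space 2 \<mu>"
abbreviation N2 :: "(real \<Rightarrow> 'k) \<Rightarrow> real" where "N2 \<equiv> Lp_norm 2 \<mu>"

sublocale finite_measure \<mu> by (rule finite_measure_jacobi[OF ab])

sublocale seminormed_space "fun_scale :: 'k \<Rightarrow> (real \<Rightarrow> 'k) \<Rightarrow> real \<Rightarrow> 'k" L2 N2
  by (rule seminormed_space_Lp) simp

definition unit_P :: "nat \<Rightarrow> real \<Rightarrow> 'k" where "unit_P n t = of_real (poly (P n) t)"

definition coef :: "nat \<Rightarrow> (real \<Rightarrow> 'k) \<Rightarrow> 'k" where "coef n f = (\<integral>t. f t * of_real (poly (P n) t) \<partial>\<mu>)"

lemma norm_P: "Lp_norm 2 \<mu> (poly (P n)) = 1"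
proof -
  have "(Lp_norm 2 \<mu> (poly (P n)))\<^sup>2 = 1"
    using jacobi_inner_P[OF ab P, of n n] unfolding Lp_norm_2_square by (simp add: jacobi_inner_def power2_eq_square)
  then show ?thesis using Lp_norm_nonneg[of 2 \<mu> "poly (P n)"] by (simp add: power2_eq_1_iff)
qed

lemma system_eq: "jacobi_system 2 \<mu> P = unit_P"
  by (auto simp: fun_eq_iff jacobi_system_def norm_P fun_scale_def unit_P_def)

lemma functionals_eq: "jacobi_functionals 2 \<mu> P = coef"
  by (auto simp: fun_eq_iff jacobi_functionals_def norm_P coef_def)

lemma unit_P_mem: "unit_P n \<in> L2"
proof -
  obtain B where "\<And>x. -1 \<le> x \<Longrightarrow> x \<le> 1 \<Longrightarrow> \<bar>poly (P n) x\<bar> \<le> B" using poly_bounded_unit_interval[of "P n"] by blast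
  then show ?thesis unfolding unit_P_def[abs_def] by (intro jacobi_bounded_Lp[OF ab, where B = B]) auto
qed

lemma unit_P_norm: "N2 (unit_P n) = 1"
  using norm_P[of n] by (simp add: Lp_norm_def unit_P_def)

lemma L2_times_poly:
  assumes f: "f \<in> L2" shows "integrable \<mu> (\<lambda>t. poly q t *\<^sub>R f t)"
proof -
  have [measurable]: "f \<in> borel_measurable borel" and fi: "integrable \<mu> (\<lambda>t. (norm (f t))\<^sup>2)"
    using f by (auto simp: Lp_space_def)
  have "integrable \<mu> (\<lambda>t. (norm (f t))\<^sup>2 + poly (q * q) t)"
    using fi integrable_jacobi_poly[OF ab] by (rule Bochner_Integration.integrable_add)
  then show ?thesis
  proof (rule Bochner_Integration.integrable_bound)
    show "AE t in \<mu>. norm (poly q t *\<^sub>R f t) \<le> norm ((norm (f t))\<^sup>2 + poly (q * q) t)"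
    proof (rule AE_I2)
      fix t
      have nn: "0 \<le> \<bar>poly q t\<bar> * norm (f t)" by simp
      have "0 \<le> (\<bar>poly q t\<bar> - norm (f t))\<^sup>2" by simp
      then have "2 * (\<bar>poly q t\<bar> * norm (f t)) \<le> (norm (f t))\<^sup>2 + (poly q t)\<^sup>2"
        unfolding power2_diff by (simp add: mult.assoc)
      then have "\<bar>poly q t\<bar> * norm (f t) \<le> (norm (f t))\<^sup>2 + (poly q t)\<^sup>2" using nn by linarith
      also have "\<dots> = (norm (f t))\<^sup>2 + poly (q * q) t" by (simp add: power2_eq_square)
      finally show "norm (poly q t *\<^sub>R f t) \<le> norm ((norm (f t))\<^sup>2 + poly (q * q) t)" by simp
    qed
  qed measurable
qed

lemma coef_scaleR: "coef n f = (\<integral>t. poly (P n) t *\<^sub>R f t \<partial>\<mu>)"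
  by (simp add: coef_def scaleR_conv_of_real mult.commute)

definition comb :: "nat set \<Rightarrow> (nat \<Rightarrow> 'k) \<Rightarrow> real \<Rightarrow> 'k" where
  "comb A c = (\<Sum>n\<in>A. fun_scale (c n) (unit_P n))"

lemma comb_apply: "comb A c t = (\<Sum>n\<in>A. poly (P n) t *\<^sub>R c n)"
  unfolding comb_def
  by (induction A rule: infinite_finite_induct) (auto simp: fun_scale_def unit_P_def scaleR_conv_of_real mult.commute)

lemma comb_mem: "comb A c \<in> L2"
  unfolding comb_def by (intro sum_mem scale_mem unit_P_mem)

text \<open>
  The Pythagorean identity, with an explicit error term for coefficients other than the Fourier
  coefficients. It implies Bessel's inequality and the best approximation property.
\<close>

lemma norm_diff_comb:
  assumes f: "f \<in> L2" and A: "finite A"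
  shows "(N2 (f - comb A c))\<^sup>2 = (N2 f)\<^sup>2 - (\<Sum>n\<in>A. (norm (coef n f))\<^sup>2) + (\<Sum>n\<in>A. (norm (coef n f - c n))\<^sup>2)"
proof -
  have fi: "integrable \<mu> (\<lambda>t. (norm (f t))\<^sup>2)" using f by (auto simp: Lp_space_def)
  have i1: "integrable \<mu> (\<lambda>t. (poly (P n) t *\<^sub>R f t) \<bullet> c n)" for n
    using L2_times_poly[OF f] by (intro integrable_inner_left) auto
  have i2: "integrable \<mu> (\<lambda>t. poly (P n * P m) t * (c n \<bullet> c m))" for n m
    using integrable_jacobi_poly[OF ab, of "P n * P m"] by (intro integrable_mult_left) (simp del: poly_mult)
  have v1: "(\<integral>t. (poly (P n) t *\<^sub>R f t) \<bullet> c n \<partial>\<mu>) = coef n f \<bullet> c n" for n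
    unfolding coef_scaleR using L2_times_poly[OF f] by (intro integral_inner_left) auto
  have v2: "(\<integral>t. poly (P n * P m) t * (c n \<bullet> c m) \<partial>\<mu>) = (if n = m then 1 else 0) * (c n \<bullet> c m)" for n m
    using jacobi_inner_P[OF ab P, of n m] by (simp add: jacobi_inner_def)
  have pt: "(norm ((f - comb A c) t))\<^sup>2 = (norm (f t))\<^sup>2 - 2 * (\<Sum>n\<in>A. (poly (P n) t *\<^sub>R f t) \<bullet> c n)
      + (\<Sum>n\<in>A. \<Sum>m\<in>A. poly (P n * P m) t * (c n \<bullet> c m))" for t
  proof -
    have "(norm ((f - comb A c) t))\<^sup>2 = (f t - comb A c t) \<bullet> (f t - comb A c t)"
      by (simp add: power2_norm_eq_inner)
    also have "\<dots> = f t \<bullet> f t - 2 * (f t \<bullet> comb A c t) + comb A c t \<bullet> comb A c t"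
      by (simp add: inner_diff_left inner_diff_right inner_commute)
    also have "f t \<bullet> comb A c t = (\<Sum>n\<in>A. (poly (P n) t *\<^sub>R f t) \<bullet> c n)"
      by (simp add: comb_apply inner_sum_right)
    also have "comb A c t \<bullet> comb A c t = (\<Sum>n\<in>A. \<Sum>m\<in>A. poly (P n * P m) t * (c n \<bullet> c m))"
      by (simp add: comb_apply inner_sum_right inner_sum_left sum_distrib_left mult_ac)
         (simp add: inner_commute)
    finally show ?thesis by (simp add: power2_norm_eq_inner)
  qed
  have "(N2 (f - comb A c))\<^sup>2 = (\<integral>t. (norm (f t))\<^sup>2 - 2 * (\<Sum>n\<in>A. (poly (P n) t *\<^sub>R f t) \<bullet> c n)
      + (\<Sum>n\<in>A. \<Sum>m\<in>A. poly (P n * P m) t * (c n \<bullet> c m)) \<partial>\<mu>)"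
    unfolding Lp_norm_2_square pt ..
  also have "\<dots> = (\<integral>t. (norm (f t))\<^sup>2 \<partial>\<mu>) - 2 * (\<Sum>n\<in>A. \<integral>t. (poly (P n) t *\<^sub>R f t) \<bullet> c n \<partial>\<mu>)
      + (\<Sum>n\<in>A. \<Sum>m\<in>A. \<integral>t. poly (P n * P m) t * (c n \<bullet> c m) \<partial>\<mu>)"
    using fi i1 i2 by (simp only: Bochner_Integration.integral_add Bochner_Integration.integral_diff
        Bochner_Integration.integral_sum integral_mult_right_zero Bochner_Integration.integrable_sum
        Bochner_Integration.integrable_diff integrable_mult_right)
  also have "\<dots> = (N2 f)\<^sup>2 - 2 * (\<Sum>n\<in>A. coef n f \<bullet> c n) + (\<Sum>n\<in>A. \<Sum>m\<in>A. (if n = m then 1 else 0) * (c n \<bullet> c m))"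
    unfolding v1 v2 Lp_norm_2_square ..
  also have "(\<Sum>n\<in>A. \<Sum>m\<in>A. (if n = m then 1 else 0) * (c n \<bullet> c m)) = (\<Sum>n\<in>A. c n \<bullet> c n)"
  proof (rule sum.cong[OF refl])
    fix n assume "n \<in> A"
    have "(\<Sum>m\<in>A. (if n = m then 1 else 0) * (c n \<bullet> c m)) = (\<Sum>m\<in>A. if n = m then c n \<bullet> c n else 0)"
      by (intro sum.cong) auto
    then show "(\<Sum>m\<in>A. (if n = m then 1 else 0) * (c n \<bullet> c m)) = c n \<bullet> c n" using A \<open>n \<in> A\<close> by simp
  qed
  also have "(\<Sum>n\<in>A. (norm (coef n f - c n))\<^sup>2) = (\<Sum>n\<in>A. (norm (coef n f))\<^sup>2 - 2 * (coef n f \<bullet> c n) + c n \<bullet> c n)"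
    by (intro sum.cong refl) (simp add: power2_norm_eq_inner inner_diff_left inner_diff_right inner_commute)
  then have "(\<Sum>n\<in>A. c n \<bullet> c n) = (\<Sum>n\<in>A. (norm (coef n f - c n))\<^sup>2) - (\<Sum>n\<in>A. (norm (coef n f))\<^sup>2) + 2 * (\<Sum>n\<in>A. coef n f \<bullet> c n)"
    by (simp add: sum.distrib sum_subtractf sum_distrib_left)
  finally show ?thesis by linarith
qed

lemma bessel: "f \<in> L2 \<Longrightarrow> finite A \<Longrightarrow> (\<Sum>n\<in>A. (norm (coef n f))\<^sup>2) \<le> (N2 f)\<^sup>2"
  using norm_diff_comb[of f A "\<lambda>n. coef n f"] zero_le_power2[of "N2 (f - comb A (\<lambda>n. coef n f))"] by simp

lemma coef_bound:
  assumes "f \<in> L2" shows "norm (coef n f) \<le> N2 f"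
proof -
  have "(norm (coef n f))\<^sup>2 \<le> (N2 f)\<^sup>2" using bessel[OF assms, of "{n}"] by simp
  then show ?thesis by (rule power2_le_imp_le) (simp add: Lp_norm_nonneg)
qed

lemma best_approximation:
  assumes f: "f \<in> L2" and "finite A" "finite B" "A \<subseteq> B"
  shows "N2 (f - comb B (\<lambda>n. coef n f)) \<le> N2 (f - comb A c)"
proof -
  have "(\<Sum>n\<in>A. (norm (coef n f))\<^sup>2) \<le> (\<Sum>n\<in>B. (norm (coef n f))\<^sup>2)" using assms by (intro sum_mono2) auto
  moreover have "0 \<le> (\<Sum>n\<in>A. (norm (coef n f - c n))\<^sup>2)" by (intro sum_nonneg) auto
  ultimately have "(N2 (f - comb B (\<lambda>n. coef n f)))\<^sup>2 \<le> (N2 (f - comb A c))\<^sup>2"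
    using norm_diff_comb[OF f assms(2), of c] norm_diff_comb[OF f assms(3), of "\<lambda>n. coef n f"] by simp
  then show ?thesis by (rule power2_le_imp_le) (simp add: Lp_norm_nonneg)
qed

lemma dense: "closed_span fun_scale L2 N2 (range unit_P) = L2"
  using jacobi_polynomials_dense[OF ab P, of 2] by (simp add: unit_P_def[abs_def])

lemma coef_unit_P: "coef n (unit_P m) = (if n = m then 1 else 0)"
proof -
  have "coef n (unit_P m) = (\<integral>t. poly (P n * P m) t *\<^sub>R (1::'k) \<partial>\<mu>)"
    unfolding coef_def unit_P_def by (simp add: scaleR_conv_of_real mult.commute)
  also have "\<dots> = (\<integral>t. poly (P n * P m) t \<partial>\<mu>) *\<^sub>R 1"
    using integrable_jacobi_poly[OF ab, of "P n * P m"] by (intro integral_scaleR_left) (simp del: poly_mult)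
  also have "(\<integral>t. poly (P n * P m) t \<partial>\<mu>) = (if n = m then 1 else 0)"
    using jacobi_inner_P[OF ab P, of n m] by (simp add: jacobi_inner_def)
  finally show ?thesis by simp
qed

text \<open>
  Once an arbitrary combination over A is close to f, the Fourier sum over any larger finite set is at least as close.
\<close>

lemma unconditional_approximation:
  assumes f: "f \<in> L2" and "0 < \<epsilon>"
  shows "\<exists>A. finite A \<and> (\<forall>B. finite B \<longrightarrow> A \<subseteq> B \<longrightarrow> N2 (f - comb B (\<lambda>n. coef n f)) < \<epsilon>)"
proof -
  have "f \<in> closed_span fun_scale L2 N2 (range unit_P)" using f dense by simp
  then obtain g where g: "g \<in> span (range unit_P)" "N2 (f - g) < \<epsilon>" using assms(2) unfolding closed_span_def by blast
  then obtain t r where t: "finite t" "t \<subseteq> range unit_P" "g = (\<Sum>v\<in>t. fun_scale (r v) v)" unfolding span_explicit by auto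
  have inj: "inj unit_P"
  proof (rule injI)
    fix i j assume "unit_P i = unit_P j"
    then show "i = j" using coef_unit_P[of i i] coef_unit_P[of i j] by (auto split: if_splits)
  qed
  obtain A where A: "finite A" "t = unit_P ` A" using t(1,2) finite_subset_image by metis
  have "g = comb A (\<lambda>j. r (unit_P j))"
    unfolding comb_def t(3) A(2) using inj by (subst sum.reindex) (auto intro: inj_on_subset)
  then have "N2 (f - comb B (\<lambda>n. coef n f)) < \<epsilon>" if "finite B" "A \<subseteq> B" for B
    using best_approximation[OF f A(1) that, of "\<lambda>j. r (unit_P j)"] g(2) by simp
  then show ?thesis using A by blast
qed

lemma coef_tendsto_0:
  assumes f: "f \<in> L2" shows "(\<lambda>n. coef n f) \<longlonglongrightarrow> 0"
proof -
  have "summable (\<lambda>n. (norm (coef n f))\<^sup>2)"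
    by (rule bounded_imp_summable[where B = "(N2 f)\<^sup>2"]) (use bessel[OF f] in auto)
  then have "(\<lambda>n. sqrt ((norm (coef n f))\<^sup>2)) \<longlonglongrightarrow> sqrt 0" by (intro tendsto_real_sqrt summable_LIMSEQ_zero)
  then show ?thesis by (simp add: tendsto_norm_zero_iff)
qed

text \<open>
  Only indices with coefficient zero are missing from the range of the greedy ordering, so its initial
  segments eventually contain any given finite set as far as it matters.
\<close>

lemma greedy_converges:
  assumes f: "f \<in> L2"
  shows "(\<lambda>m. N2 (greedy_sum fun_scale \<tau> unit_P coef m f - f)) \<longlonglongrightarrow> 0"
proof (rule LIMSEQ_I)
  define \<rho> where "\<rho> = greedy_ordering \<tau> (\<lambda>n. coef n f)"
  have "is_greedy_ordering \<tau> (\<lambda>n. coef n f) \<rho>"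
    unfolding \<rho>_def by (rule greedy_ordering_is_greedy[OF bij_tau coef_tendsto_0[OF f]])
  then have inj: "inj \<rho>" and supp: "{n. coef n f \<noteq> 0} \<subseteq> range \<rho>"
    unfolding is_greedy_ordering_def by auto
  have gs: "greedy_sum fun_scale \<tau> unit_P coef m f = comb (\<rho> ` {..<m}) (\<lambda>n. coef n f)" for m
    unfolding greedy_sum_def Let_def \<rho>_def[symmetric] comb_def
    using inj by (subst sum.reindex) (auto intro: inj_on_subset)
  fix \<epsilon> :: real assume "0 < \<epsilon>"
  then obtain A where A: "finite A" "\<And>B. finite B \<Longrightarrow> A \<subseteq> B \<Longrightarrow> N2 (f - comb B (\<lambda>n. coef n f)) < \<epsilon>"
    using unconditional_approximation[OF f] by blast
  have "finite (\<rho> -` A)" using A(1) inj by (rule finite_vimageI)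
  then obtain m0 where "\<forall>n\<in>\<rho> -` A. n < m0" unfolding finite_nat_set_iff_bounded by blast
  then have m0: "\<rho> -` A \<subseteq> {..<m0}" by auto
  have "norm (N2 (greedy_sum fun_scale \<tau> unit_P coef m f - f) - 0) < \<epsilon>" if m: "m \<ge> m0" for m
  proof -
    define R where "R = \<rho> ` {..<m}"
    have "comb R (\<lambda>n. coef n f) = comb (R \<union> A) (\<lambda>n. coef n f)"
      unfolding comb_def
    proof (rule sum.mono_neutral_left)
      show "\<forall>n\<in>R \<union> A - R. fun_scale (coef n f) (unit_P n) = 0"
      proof
        fix n assume n: "n \<in> R \<union> A - R"
        have "n \<notin> range \<rho>" using n m0 m by (auto simp: R_def)
        then have "coef n f = 0" using supp by blast
        then show "fun_scale (coef n f) (unit_P n) = 0" by (simp add: fun_scale_def zero_fun_def)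
      qed
    qed (use A in \<open>auto simp: R_def\<close>)
    moreover have "N2 (f - comb (R \<union> A) (\<lambda>n. coef n f)) < \<epsilon>" using A by (intro A(2)) (auto simp: R_def)
    ultimately have "N2 (greedy_sum fun_scale \<tau> unit_P coef m f - f) < \<epsilon>"
      unfolding gs using nrm_diff_commute[OF f comb_mem] by (simp add: R_def)
    then show ?thesis by (simp add: Lp_norm_nonneg)
  qed
  then show "\<exists>m0. \<forall>m\<ge>m0. norm (N2 (greedy_sum fun_scale \<tau> unit_P coef m f - f) - 0) < \<epsilon>" by blast
qed

lemma coef_dual: "coef n \<in> dual_space fun_scale L2 N2"
  unfolding dual_space_def
proof (intro CollectI conjI ballI allI)
  fix f g assume "f \<in> L2" "g \<in> L2"
  then show "coef n (f + g) = coef n f + coef n g"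
    unfolding coef_scaleR by (simp add: scaleR_add_right L2_times_poly)
next
  fix c :: 'k and f assume "f \<in> L2"
  have "coef n (fun_scale c f) = (\<integral>t. c * (f t * of_real (poly (P n) t)) \<partial>\<mu>)"
    by (simp add: coef_def fun_scale_def mult.assoc)
  also have "\<dots> = c * coef n f" by (simp add: coef_def)
  finally show "coef n (fun_scale c f) = c * coef n f" .
next
  show "\<exists>C. \<forall>f\<in>L2. norm (coef n f) \<le> C * N2 f" using coef_bound by (intro exI[of _ 1]) simp
qed

theorem quasi_greedy_L2:
  "quasi_greedy_basis (fun_scale :: 'k \<Rightarrow> (real \<Rightarrow> 'k) \<Rightarrow> real \<Rightarrow> 'k) L2 N2 \<tau> (jacobi_system 2 \<mu> P) (jacobi_functionals 2 \<mu> P)"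
  unfolding quasi_greedy_basis_def system_eq functionals_eq
proof (intro conjI ballI)
  show "semi_normalized N2 unit_P" by (simp add: semi_normalized_def unit_P_norm)
  have "dual_norm L2 N2 (coef n) \<le> 1" for n
    unfolding dual_norm_def
  proof (rule cSUP_least)
    show "{f \<in> L2. N2 f \<le> 1} \<noteq> {}" using zero_mem by (auto intro!: exI[of _ 0])
    show "norm (coef n f) \<le> 1" if "f \<in> {f \<in> L2. N2 f \<le> 1}" for f
      using coef_bound[of f n] that by auto
  qed
  then have "bdd_above (range (\<lambda>n. N2 (unit_P n) * dual_norm L2 N2 (coef n)))"
    by (intro bdd_aboveI2[where M = 1]) (simp add: unit_P_norm)
  then show "bounded_basis fun_scale L2 N2 unit_P coef"
    unfolding bounded_basis_def is_basis_def by (simp add: unit_P_mem coef_dual dense coef_unit_P)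
qed (rule greedy_converges)

end

theorem theorem1p1:
  fixes p \<alpha> \<beta> :: real and P :: "nat \<Rightarrow> real poly" and \<tau> :: "nat \<Rightarrow> nat" and \<mu> :: "real measure"
  defines "\<mu> \<equiv> jacobi_measure \<alpha> \<beta>"
  assumes "1 \<le> p"
    and "min \<alpha> \<beta> > - 1 / 2"
    and "orthonormal_jacobi \<alpha> \<beta> P"
    and "bij \<tau>"
  shows
    "(quasi_greedy_basis (fun_scale :: real \<Rightarrow> (real \<Rightarrow> real) \<Rightarrow> real \<Rightarrow> real)
        (Lp_space p \<mu>) (Lp_norm p \<mu>) \<tau> (jacobi_system p \<mu> P) (jacobi_functionals p \<mu> P)
      \<longleftrightarrow> p = 2) \<and>
     (quasi_greedy_basis (fun_scale :: complex \<Rightarrow> (real \<Rightarrow> complex) \<Rightarrow> real \<Rightarrow> complex)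
        (Lp_space p \<mu>) (Lp_norm p \<mu>) \<tau> (jacobi_system p \<mu> P) (jacobi_functionals p \<mu> P)
      \<longleftrightarrow> p = 2)"
proof (intro conjI iffI)
  have ab: "-1/2 < \<alpha>" "-1/2 < \<beta>" using assms(3) by auto
  then have ab1: "-1 < \<alpha>" "-1 < \<beta>" by auto
  show "p = 2" if "quasi_greedy_basis (fun_scale :: real \<Rightarrow> (real \<Rightarrow> real) \<Rightarrow> real \<Rightarrow> real)
        (Lp_space p \<mu>) (Lp_norm p \<mu>) \<tau> (jacobi_system p \<mu> P) (jacobi_functionals p \<mu> P)"
    by (rule quasi_greedy_jacobi.p_eq_2[OF quasi_greedy_jacobi.intro[OF assms(2) ab assms(4,5) that[unfolded \<mu>_def]]])
  show "p = 2" if "quasi_greedy_basis (fun_scale :: complex \<Rightarrow> (real \<Rightarrow> complex) \<Rightarrow> real \<Rightarrow> complex)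
        (Lp_space p \<mu>) (Lp_norm p \<mu>) \<tau> (jacobi_system p \<mu> P) (jacobi_functionals p \<mu> P)"
    by (rule quasi_greedy_jacobi.p_eq_2[OF quasi_greedy_jacobi.intro[OF assms(2) ab assms(4,5) that[unfolded \<mu>_def]]])
  show "quasi_greedy_basis (fun_scale :: real \<Rightarrow> (real \<Rightarrow> real) \<Rightarrow> real \<Rightarrow> real)
        (Lp_space p \<mu>) (Lp_norm p \<mu>) \<tau> (jacobi_system p \<mu> P) (jacobi_functionals p \<mu> P)" if "p = 2"
    unfolding that \<mu>_def by (rule jacobi_L2.quasi_greedy_L2[OF jacobi_L2.intro[OF ab1 assms(4,5)]])
  show "quasi_greedy_basis (fun_scale :: complex \<Rightarrow> (real \<Rightarrow> complex) \<Rightarrow> real \<Rightarrow> complex)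
        (Lp_space p \<mu>) (Lp_norm p \<mu>) \<tau> (jacobi_system p \<mu> P) (jacobi_functionals p \<mu> P)" if "p = 2"
    unfolding that \<mu>_def by (rule jacobi_L2.quasi_greedy_L2[OF jacobi_L2.intro[OF ab1 assms(4,5)]])
qed

end
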